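(* Let $\Bbbk$ be a field (assumed $F$-finite if it has positive characteristic), let $L\subseteq X$ be a (two-sided) ladder in a $k\times\ell$ generic matrix $X$, and let $t\in\mathbb{Z}_{>0}$. Let $R=\Bbbk[L]$, let $I_t(L)\subseteq R$ be the corresponding unmixed ladder determinantal ideal, and let $f\in R$ be the polynomial attached to $L$ and $t$ as defined in the context. Then $$I_t(L_{[a,b]})\in\mathcal{C}_f\quad\text{for every } 1\le a<b\le\ell\text{ such that } I_t(L_{[a,b]})\ne0,$$ and $$I_t(L^{[c,d]})\in\mathcal{C}_f\quad\text{for every } 1\le c<d\le k\text{ such that } I_t(L^{[c,d]})\ne0.$$ In particular, $I_t(L)\in\mathcal{C}_f$ whenever $I_t(L)$ is not zero.
   Context: Ladders. Let $X=(x_{i,j})$ be a $k\times\ell$ matrix of distinct indeterminates. A subset $L\subseteq X$ is a (two-sided) ladder if whenever $x_{i,j},x_{i',j'}\in L$ with $i\le i'$ and $j\ge j'$, then $x_{u,w}\in L$ for all $i\le u\le i'$, $j'\le w\le j$. (An entry with indices out of range is regarded as not in $L$.) The upper-outside corners of $L$ are the elements $x_{b_1,a_1},\ldots,x_{b_u,a_u}\in L$, with $1=b_1<\cdots<b_u$ and $a_1<\cdots<a_u=\ell$, defined by $x_{b_h-1,a_h}\notin L$ and $x_{b_h,a_h+1}\notin L$. The lower-outside corners $x_{d_1,c_1},\ldots,x_{d_v,c_v}\in L$, with $d_1\le\cdots\le d_v=k$ and $1=c_1\le\cdots\le c_v$, are part of the data of the ladder: they include all $x_{i,j}\in L$ with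 $x_{i+1,j}\notin L$ and $x_{i,j-1}\notin L$, and each of them satisfies $x_{d_h+1,c_h}\notin L$ or $x_{d_h,c_h-1}\notin L$. All corners are assumed distinct. For $j=1,\ldots,v$ set $L_j=\{x_{b,a}\in L\mid 1\le b\le d_j,\ c_j\le a\le \ell\}$. Ideals. $R=\Bbbk[L]$ is the polynomial ring over $\Bbbk$ in the entries of $L$. For a subladder $L'\subseteq L$, $I_t(L')$ is the ideal of $R$ generated by the $t$-minors of $X$ all of whose entries lie in $L'$. $L_{[a,b]}$ is the subladder of entries of $L$ lying in columns $a,\ldots,b$ of $X$, and $L^{[c,d]}$ the subladder of entries of $L$ lying in rows $c,\ldots,d$. Standing assumptions (for $\mathbf t=(t,\ldots,t)\in\mathbb{Z}_{>0}^v$, so that $I_{\mathbf t}(L)=\sum_j I_t(L_j)=I_t(L)$): (1) every entry of $L$ is involved in some of the generating minors; (2) no two consecutive corners coincide, and no two upper-outside corners belong to the same row or the same column; (3) $I_{t}(L_i)\not\subseteq I_{t}(L_j)$ for all $i\ne j$; (4) no proper submatrix of $X$ contains $L$. The polynomial $f$. For $2\le r\le k+\ell$ let $\mathcal{D}_r=\{x_{i,j}\in X\mid i+j=r\}$. For each $j$ let $(L_j)^\circ_t=\{x_{b,a}\in L\mid b\le d_j-t+1,\ a\ge c_j+t-1\}$, and let $L^\circ=\bigcup_{j=1}^v(L_j)^\circ_t$. Let $\mathcal{A}=\{2\le r\le k+\ell\mid \mathcal{D}_r\cap L^\circ\ne\emptyset\}$. For $r\in\mathcal{A}$ set $w_r=\max\{w\mid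 x_{w,r-w}\in\mathcal{D}_r\cap L^\circ\}$, $p_r=\max\{j\mid x_{w_r,r-w_r}\in(L_j)^\circ_t\}$, $a_r=\min\{i\mid x_{i,r-i}\in L_{p_r}\cap\mathcal{D}_r\}$, $b_r=\max\{i\mid x_{i,r-i}\in L_{p_r}\cap\mathcal{D}_r\}$, and let $Y_r$ be the square submatrix of $X$ with rows $a_r,\ldots,b_r$ and columns $r-b_r,\ldots,r-a_r$ (it is contained in $L_{p_r}$). Then $f=\prod_{r\in\mathcal{A}}\det(Y_r)$. Knutson ideals: for $f\in R$ a homogeneous polynomial whose leading term with respect to some term order is a squarefree monomial, $\mathcal{C}_f$ is the smallest set of ideals of $R$ such that: (i) $(f)\in\mathcal{C}_f$; (ii) if $I\in\mathcal{C}_f$ then $(I:J)\in\mathcal{C}_f$ for every ideal $J\subseteq R$; (iii) if $I,J\in\mathcal{C}_f$ then $I+J\in\mathcal{C}_f$ and $I\cap J\in\mathcal{C}_f$. *)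

theory Defs
  imports
    "HOL-Library.Poly_Mapping"
    "HOL-Algebra.Ideal"
    "Jordan_Normal_Form.Determinant"
begin

text \<open>
  For a field of characteristic \<open>p > 0\<close>: the field is finitely generated as a module over its
  subfield of \<open>p\<close>-th powers.
\<close>

definition F_finite :: "'k::field itself \<Rightarrow> bool" where
  "F_finite TYPE('k) \<longleftrightarrow>
    (\<exists>B::'k set. finite B \<and> (\<forall>x. \<exists>c. x = (\<Sum>y\<in>B. c y ^ CHAR('k) * y)))"

section \<open>Polynomial rings on sets of entries of a generic matrix\<close>

text \<open>
  The entry \<open>x\<^bsub>i,j\<^esub>\<close> of the generic matrix is represented by its position \<open>(i, j)\<close>; positions
  are counted from 1, and subsets of the matrix are sets of positions.
\<close>

type_synonym entry = "nat \<times> nat"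
type_synonym monomial = "entry \<Rightarrow>\<^sub>0 nat"
type_synonym 'k polynomial = "monomial \<Rightarrow>\<^sub>0 'k"

definition Var :: "entry \<Rightarrow> 'k::field polynomial" where
  "Var x = Poly_Mapping.single (Poly_Mapping.single x 1) 1"

definition monomials_on :: "entry set \<Rightarrow> monomial set" where
  "monomials_on L = {m. Poly_Mapping.keys m \<subseteq> L}"

definition poly_ring :: "entry set \<Rightarrow> 'k::field polynomial ring" where
  "poly_ring L =
    \<lparr>carrier = {p. Poly_Mapping.keys p \<subseteq> monomials_on L},
     monoid.mult = (*), one = 1, zero = 0, add = (+)\<rparr>"

lemma cring_poly_ring: "cring (poly_ring L :: 'k::field polynomial ring)"
proof -
  have mult: "Poly_Mapping.keys (p * q) \<subseteq> monomials_on L"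
    if "Poly_Mapping.keys p \<subseteq> monomials_on L" "Poly_Mapping.keys q \<subseteq> monomials_on L"
    for p q :: "'k polynomial"
  proof
    fix m assume "m \<in> Poly_Mapping.keys (p * q)"
    then obtain a b where "m = a + b" "a \<in> Poly_Mapping.keys p" "b \<in> Poly_Mapping.keys q"
      using keys_mult[of p q] by auto
    then show "m \<in> monomials_on L"
      using that Poly_Mapping.keys_add[of a b] by (fastforce simp: monomials_on_def)
  qed
  have add: "Poly_Mapping.keys (p + q) \<subseteq> monomials_on L"
    if "Poly_Mapping.keys p \<subseteq> monomials_on L" "Poly_Mapping.keys q \<subseteq> monomials_on L"
    for p q :: "'k polynomial"
    using that Poly_Mapping.keys_add[of p q] by blast
  have neg: "\<exists>q. Poly_Mapping.keys q \<subseteq> monomials_on L \<and> p + q = 0"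
    if "Poly_Mapping.keys p \<subseteq> monomials_on L" for p :: "'k polynomial"
    using that by (intro exI[of _ "- p"]) (simp add: subset_iff in_keys_iff)
  have zero: "0 \<in> monomials_on L"
    by (simp add: monomials_on_def)
  have "abelian_group (poly_ring L :: 'k polynomial ring)"
    by (rule abelian_groupI) (simp_all add: poly_ring_def algebra_simps add neg)
  moreover have "Group.comm_monoid (poly_ring L :: 'k polynomial ring)"
    by (rule comm_monoidI) (simp_all add: poly_ring_def algebra_simps mult zero)
  ultimately show ?thesis
    by (rule cringI) (simp add: poly_ring_def algebra_simps)
qed

definition term_order_on :: "entry set \<Rightarrow> (monomial \<times> monomial) set \<Rightarrow> bool" where
  "term_order_on L r \<longleftrightarrow>
    linear_order_on (monomials_on L) r \<and>
    (\<forall>m\<in>monomials_on L. (0, m) \<in> r) \<and>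
    (\<forall>m n s. (m, n) \<in> r \<longrightarrow> s \<in> monomials_on L \<longrightarrow> (m + s, n + s) \<in> r)"

definition leading_monomial ::
  "(monomial \<times> monomial) set \<Rightarrow> 'k::field polynomial \<Rightarrow> monomial \<Rightarrow> bool" where
  "leading_monomial r p m \<longleftrightarrow> m \<in> Poly_Mapping.keys p \<and> (\<forall>n\<in>Poly_Mapping.keys p. (n, m) \<in> r)"

definition squarefree_monomial :: "monomial \<Rightarrow> bool" where
  "squarefree_monomial m \<longleftrightarrow> (\<forall>x. Poly_Mapping.lookup m x \<le> 1)"

definition total_degree :: "monomial \<Rightarrow> nat" where
  "total_degree m = (\<Sum>x\<in>Poly_Mapping.keys m. Poly_Mapping.lookup m x)"

definition homogeneous :: "'k::field polynomial \<Rightarrow> bool" where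
  "homogeneous p \<longleftrightarrow> (\<exists>n. \<forall>m\<in>Poly_Mapping.keys p. total_degree m = n)"

section \<open>Knutson ideals\<close>

definition ideal_colon :: "('a, 'm) ring_scheme \<Rightarrow> 'a set \<Rightarrow> 'a set \<Rightarrow> 'a set" where
  "ideal_colon R I J = {x \<in> carrier R. \<forall>y\<in>J. x \<otimes>\<^bsub>R\<^esub> y \<in> I}"

definition knutson_admissible :: "entry set \<Rightarrow> 'k::field polynomial \<Rightarrow> bool" where
  "knutson_admissible L f \<longleftrightarrow>
    f \<in> carrier (poly_ring L) \<and> homogeneous f \<and>
    (\<exists>r m. term_order_on L r \<and> leading_monomial r f m \<and> squarefree_monomial m)"

text \<open>
  The family \<open>\<C>\<^sub>f\<close> is only defined for admissible \<open>f\<close>; here it is empty for all other \<open>f\<close>,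
  so that membership in \<open>\<C>\<^sub>f\<close> entails that \<open>f\<close> is admissible.
\<close>

inductive_set knutson_ideals :: "entry set \<Rightarrow> 'k::field polynomial \<Rightarrow> 'k polynomial set set"
  for L :: "entry set" and f :: "'k::field polynomial"
where
  principal: "knutson_admissible L f \<Longrightarrow> PIdl\<^bsub>poly_ring L\<^esub> f \<in> knutson_ideals L f"
| colon: "I \<in> knutson_ideals L f \<Longrightarrow> ideal J (poly_ring L) \<Longrightarrow>
    ideal_colon (poly_ring L) I J \<in> knutson_ideals L f"
| sum: "I \<in> knutson_ideals L f \<Longrightarrow> J \<in> knutson_ideals L f \<Longrightarrow>
    I <+>\<^bsub>poly_ring L\<^esub> J \<in> knutson_ideals L f"
| inter: "I \<in> knutson_ideals L f \<Longrightarrow> J \<in> knutson_ideals L f \<Longrightarrow> I \<inter> J \<in> knutson_ideals L f"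

section \<open>Ladders\<close>

text \<open>Ladders in the generic \<open>k \<times> l\<close> matrix.\<close>

definition ladder :: "nat \<Rightarrow> nat \<Rightarrow> entry set \<Rightarrow> bool" where
  "ladder k l L \<longleftrightarrow>
    L \<subseteq> {1..k} \<times> {1..l} \<and>
    (\<forall>i j i' j'. (i, j) \<in> L \<longrightarrow> (i', j') \<in> L \<longrightarrow> i \<le> i' \<longrightarrow> j' \<le> j \<longrightarrow>
      (\<forall>p q. i \<le> p \<longrightarrow> p \<le> i' \<longrightarrow> j' \<le> q \<longrightarrow> q \<le> j \<longrightarrow> (p, q) \<in> L))"

text \<open>
  The corners are \<open>(b h, a h)\<close> for \<open>1 \<le> h \<le> u\<close> and \<open>(d h, c h)\<close> for \<open>1 \<le> h \<le> v\<close>.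
  Truncated subtraction is harmless: row 0 and column 0 do not meet \<open>L\<close>.
\<close>

definition upper_outside_corners ::
  "nat \<Rightarrow> entry set \<Rightarrow> nat \<Rightarrow> (nat \<Rightarrow> nat) \<Rightarrow> (nat \<Rightarrow> nat) \<Rightarrow> bool" where
  "upper_outside_corners l L u b a \<longleftrightarrow>
    1 \<le> u \<and> b 1 = 1 \<and> a u = l \<and> strict_mono_on {1..u} b \<and> strict_mono_on {1..u} a \<and>
    (\<lambda>h. (b h, a h)) ` {1..u} = {(i, j) \<in> L. (i - 1, j) \<notin> L \<and> (i, j + 1) \<notin> L}"

definition lower_outside_corners ::
  "nat \<Rightarrow> entry set \<Rightarrow> nat \<Rightarrow> (nat \<Rightarrow> nat) \<Rightarrow> (nat \<Rightarrow> nat) \<Rightarrow> bool" where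
  "lower_outside_corners k L v d c \<longleftrightarrow>
    1 \<le> v \<and> d v = k \<and> c 1 = 1 \<and> mono_on {1..v} d \<and> mono_on {1..v} c \<and>
    inj_on (\<lambda>h. (d h, c h)) {1..v} \<and>
    (\<forall>h\<in>{1..v}. (d h, c h) \<in> L \<and> ((d h + 1, c h) \<notin> L \<or> (d h, c h - 1) \<notin> L)) \<and>
    {(i, j) \<in> L. (i + 1, j) \<notin> L \<and> (i, j - 1) \<notin> L} \<subseteq> (\<lambda>h. (d h, c h)) ` {1..v}"

text \<open>The subladder \<open>L\<^sub>j\<close> is \<open>subladder L d c j\<close>.\<close>

definition subladder :: "entry set \<Rightarrow> (nat \<Rightarrow> nat) \<Rightarrow> (nat \<Rightarrow> nat) \<Rightarrow> nat \<Rightarrow> entry set" where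
  "subladder L d c j = {(b, a) \<in> L. b \<le> d j \<and> c j \<le> a}"

definition column_part :: "entry set \<Rightarrow> nat \<Rightarrow> nat \<Rightarrow> entry set" where
  "column_part L p q = {(i, j) \<in> L. p \<le> j \<and> j \<le> q}"

definition row_part :: "entry set \<Rightarrow> nat \<Rightarrow> nat \<Rightarrow> entry set" where
  "row_part L p q = {(i, j) \<in> L. p \<le> i \<and> i \<le> q}"

section \<open>Ladder determinantal ideals\<close>

definition generic_minor :: "nat set \<Rightarrow> nat set \<Rightarrow> 'k::field polynomial" where
  "generic_minor I J = det (mat (card I) (card J)
    (\<lambda>(p, q). Var (sorted_list_of_set I ! p, sorted_list_of_set J ! q)))"

definition minor_positions :: "nat \<Rightarrow> entry set \<Rightarrow> (nat set \<times> nat set) set" where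
  "minor_positions t L' = {(I, J). finite I \<and> finite J \<and> card I = t \<and> card J = t \<and> I \<times> J \<subseteq> L'}"

text \<open>\<open>ladder_ideal L t L'\<close> is \<open>I\<^sub>t(L')\<close> as an ideal of the polynomial ring on \<open>L\<close>.\<close>

definition ladder_ideal :: "entry set \<Rightarrow> nat \<Rightarrow> entry set \<Rightarrow> 'k::field polynomial set" where
  "ladder_ideal L t L' = Idl\<^bsub>poly_ring L\<^esub> ((\<lambda>(I, J). generic_minor I J) ` minor_positions t L')"

text \<open>
  The standing assumptions, in order: every entry lies in a generating minor; the corners are
  pairwise distinct (upper-outside and lower-outside corners are distinct among themselves by
  the two definitions above, no two of the former in a common row or column); there are no
  inclusions among the ideals \<open>I\<^sub>t(L\<^sub>j)\<close>; no proper submatrix contains \<open>L\<close>.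
\<close>

definition ladder_assumptions ::
  "'k::field itself \<Rightarrow> nat \<Rightarrow> nat \<Rightarrow> entry set \<Rightarrow> nat \<Rightarrow> (nat \<Rightarrow> nat) \<Rightarrow> (nat \<Rightarrow> nat) \<Rightarrow>
    nat \<Rightarrow> (nat \<Rightarrow> nat) \<Rightarrow> (nat \<Rightarrow> nat) \<Rightarrow> nat \<Rightarrow> bool" where
  "ladder_assumptions TYPE('k) k l L u b a v d c t \<longleftrightarrow>
    (\<forall>x\<in>L. \<exists>(I, J)\<in>minor_positions t L. x \<in> I \<times> J) \<and>
    (\<lambda>h. (b h, a h)) ` {1..u} \<inter> (\<lambda>h. (d h, c h)) ` {1..v} = {} \<and>
    (\<forall>i\<in>{1..v}. \<forall>j\<in>{1..v}. i \<noteq> j \<longrightarrow>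
      \<not> (ladder_ideal L t (subladder L d c i) :: 'k polynomial set)
          \<subseteq> ladder_ideal L t (subladder L d c j)) \<and>
    (\<forall>I J. I \<subseteq> {1..k} \<longrightarrow> J \<subseteq> {1..l} \<longrightarrow> L \<subseteq> I \<times> J \<longrightarrow> I = {1..k} \<and> J = {1..l})"

section \<open>The polynomial \<open>f\<close> attached to a ladder\<close>

definition antidiagonal :: "nat \<Rightarrow> nat \<Rightarrow> nat \<Rightarrow> entry set" where
  "antidiagonal k l r = {(i, j) \<in> {1..k} \<times> {1..l}. i + j = r}"

text \<open>
  \<open>inner_part L d c t j\<close> is \<open>(L\<^sub>j)\<^sup>\<circ>\<^sub>t\<close>, whose defining inequalities \<open>b \<le> d\<^sub>j - t + 1\<close>
  and \<open>a \<ge> c\<^sub>j + t - 1\<close> are written without subtraction.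
\<close>

definition inner_part ::
  "entry set \<Rightarrow> (nat \<Rightarrow> nat) \<Rightarrow> (nat \<Rightarrow> nat) \<Rightarrow> nat \<Rightarrow> nat \<Rightarrow> entry set" where
  "inner_part L d c t j = {(b, a) \<in> L. b + t \<le> d j + 1 \<and> c j + t \<le> a + 1}"

definition inner_ladder ::
  "entry set \<Rightarrow> nat \<Rightarrow> (nat \<Rightarrow> nat) \<Rightarrow> (nat \<Rightarrow> nat) \<Rightarrow> nat \<Rightarrow> entry set" where
  "inner_ladder L v d c t = (\<Union>j\<in>{1..v}. inner_part L d c t j)"

definition ladder_poly ::
  "nat \<Rightarrow> nat \<Rightarrow> entry set \<Rightarrow> nat \<Rightarrow> (nat \<Rightarrow> nat) \<Rightarrow> (nat \<Rightarrow> nat) \<Rightarrow> nat \<Rightarrow> 'k::field polynomial"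
where
  "ladder_poly k l L v d c t =
    (\<Prod>r\<in>{r\<in>{2..k + l}. antidiagonal k l r \<inter> inner_ladder L v d c t \<noteq> {}}.
      let w = Max (fst ` (antidiagonal k l r \<inter> inner_ladder L v d c t));
          p = Max {j\<in>{1..v}. (w, r - w) \<in> inner_part L d c t j};
          rows = fst ` (subladder L d c p \<inter> antidiagonal k l r);
          a = Min rows;
          b = Max rows
      in generic_minor {a..b} {r - b..r - a})"

end

theory Submission
  imports Defs "HOL-Library.Product_Lexorder"
begin

text \<open>
  Let \<open>s = t - 1\<close>. Substituting \<open>\<Sum>\<^sub>c u\<^bsub>i,c\<^esub> v\<^bsub>c,j\<^esub>\<close> (\<open>c < s\<close>) for the variables \<open>x\<^bsub>i,j\<^esub>\<close> in a
  subladder \<open>T\<close> is a homomorphism into a domain whose kernel is \<open>I\<^sub>t(T)\<close>: its injectivity on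
  polynomials without monomials divisible by an antidiagonal of length \<open>t\<close> comes from the north-west
  corner rule. Hence \<open>I\<^sub>t(T)\<close> is prime, and it is equal to a colon ideal \<open>Q : g\<close> as soon as
  \<open>Q \<subseteq> I\<^sub>t(T)\<close>, \<open>g \<notin> I\<^sub>t(T)\<close> and \<open>g\<close> multiplies the \<open>t\<close>-minors of \<open>T\<close> into \<open>Q\<close>. For a window of \<open>t\<close>
  consecutive columns, \<open>Q\<close> is generated by the factors \<open>det(Y\<^sub>r)\<close> of \<open>f\<close> whose antidiagonals cross
  the window and \<open>g\<close> is a determinant of cofactors; for a wider window, \<open>Q\<close> is the sum of the ideals of
  the two windows with one column fewer and \<open>g\<close> is a \<open>(t - 1)\<close>-minor. Rows follow by transposition.
\<close>

section \<open>Ideals of the polynomial ring\<close>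

text \<open>The minimal window carries the weight. If N rows of the ladder contain all t of its
  columns, the ideal of its t-minors has height m = N - s, and exactly m antidiagonals have t
  positions in those rows and columns. The m corresponding factors generate an ideal Q with as few
  generators as this height permits, but Q may have further components; the colon by g removes them,
  so g has to be exhibited explicitly outside the prime ideal. One order serves throughout:
  positions are compared row by row and monomials lexicographically, so that a monomial is small
  when it avoids early positions. The lowest monomial of a determinant of variables is then its
  antidiagonal product. This drives the straightening modulo minors, the squarefree leading monomial
  of f and the nonvanishing of g. A nonzero polynomial whose monomials are all standard is never in
  the kernel; hence it suffices that g avoids one column of the window, or that it has degree s.
  Entries outside T stay free variables under the substitution, because I_t(T) is an ideal of the
  ring on all of L.\<close>

lemma poly_ring_sel:
  "carrier (poly_ring L) = {p. Poly_Mapping.keys p \<subseteq> monomials_on L}"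
  "x \<otimes>\<^bsub>poly_ring L\<^esub> y = x * y" "x \<oplus>\<^bsub>poly_ring L\<^esub> y = x + y"
  "\<one>\<^bsub>poly_ring L\<^esub> = 1" "\<zero>\<^bsub>poly_ring L\<^esub> = 0"
  by (simp_all add: poly_ring_def)

lemma monomials_on_add_iff: "m + n \<in> monomials_on L \<longleftrightarrow> m \<in> monomials_on L \<and> n \<in> monomials_on L"
  by (auto simp: monomials_on_def in_keys_iff lookup_add subset_iff)

lemma monomials_on_0: "0 \<in> monomials_on L"
  by (simp add: monomials_on_def)

lemma poly_ring_closed:
  fixes x y :: "'k::field polynomial"
  shows carrier_plus: "x \<in> carrier (poly_ring L) \<Longrightarrow> y \<in> carrier (poly_ring L) \<Longrightarrow> x + y \<in> carrier (poly_ring L)"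
    and carrier_mult: "x \<in> carrier (poly_ring L) \<Longrightarrow> y \<in> carrier (poly_ring L) \<Longrightarrow> x * y \<in> carrier (poly_ring L)"
    and carrier_uminus: "x \<in> carrier (poly_ring L) \<Longrightarrow> - x \<in> carrier (poly_ring L)"
    and carrier_0: "0 \<in> carrier (poly_ring L :: 'k polynomial ring)"
    and carrier_1: "1 \<in> carrier (poly_ring L :: 'k polynomial ring)"
proof -
  interpret R: cring "poly_ring L :: 'k polynomial ring" by (rule cring_poly_ring)
  show "x \<in> carrier (poly_ring L) \<Longrightarrow> y \<in> carrier (poly_ring L) \<Longrightarrow> x + y \<in> carrier (poly_ring L)"
    using R.a_closed by (simp add: poly_ring_sel)
  show "x \<in> carrier (poly_ring L) \<Longrightarrow> y \<in> carrier (poly_ring L) \<Longrightarrow> x * y \<in> carrier (poly_ring L)"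
    using R.m_closed by (simp add: poly_ring_sel)
  show "x \<in> carrier (poly_ring L) \<Longrightarrow> - x \<in> carrier (poly_ring L)"
    by (simp add: poly_ring_sel subset_iff in_keys_iff)
  show "0 \<in> carrier (poly_ring L :: 'k polynomial ring)" "1 \<in> carrier (poly_ring L :: 'k polynomial ring)"
    using R.zero_closed R.one_closed by (simp_all add: poly_ring_sel)
qed

lemma carrier_sum:
  fixes g :: "'a \<Rightarrow> 'k::field polynomial"
  shows "(\<And>i. i \<in> A \<Longrightarrow> g i \<in> carrier (poly_ring L)) \<Longrightarrow> sum g A \<in> carrier (poly_ring L)"
  by (induction A rule: infinite_finite_induct) (auto intro: carrier_0 carrier_plus)

lemma carrier_prod:
  fixes g :: "'a \<Rightarrow> 'k::field polynomial"
  shows "(\<And>i. i \<in> A \<Longrightarrow> g i \<in> carrier (poly_ring L)) \<Longrightarrow> prod g A \<in> carrier (poly_ring L)"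
  by (induction A rule: infinite_finite_induct) (auto intro: carrier_1 carrier_mult)

lemma carrier_single: "m \<in> monomials_on L \<Longrightarrow> Poly_Mapping.single m (a::'k::field) \<in> carrier (poly_ring L)"
  by (auto simp: poly_ring_sel)

lemma carrier_Var: "x \<in> L \<Longrightarrow> Var x \<in> carrier (poly_ring L)"
  unfolding Var_def by (rule carrier_single) (auto simp: monomials_on_def)

lemma carrier_sign: "of_int (sign p) \<in> carrier (poly_ring L :: 'k::field polynomial ring)"
  using carrier_1[of L] carrier_uminus[OF carrier_1[of L]] by (auto simp: sign_def)

lemma carrier_det:
  fixes A :: "'k::field polynomial mat"
  assumes "A \<in> carrier_mat n n" "\<And>i j. i < n \<Longrightarrow> j < n \<Longrightarrow> A $$ (i, j) \<in> carrier (poly_ring L)"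
  shows "det A \<in> carrier (poly_ring L)"
  unfolding det_def'[OF assms(1)]
  by (intro carrier_sum carrier_mult carrier_prod carrier_sign assms(2))
    (auto simp: permutes_in_image)

lemma carrier_mono: "L \<subseteq> L' \<Longrightarrow> carrier (poly_ring L) \<subseteq> carrier (poly_ring L')"
  by (auto simp: poly_ring_sel monomials_on_def)

text \<open>Negation is multiplication by \<open>- 1\<close>, which lies in the ring, so sums and
  multiples already give the additive subgroup that \<open>idealI\<close> asks for.\<close>

lemma ideal_poly_ringI:
  fixes I :: "'k::field polynomial set"
  assumes "I \<subseteq> carrier (poly_ring L)" "0 \<in> I" "\<And>x y. x \<in> I \<Longrightarrow> y \<in> I \<Longrightarrow> x + y \<in> I"
    "\<And>x y. x \<in> I \<Longrightarrow> y \<in> carrier (poly_ring L) \<Longrightarrow> y * x \<in> I"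
  shows "ideal I (poly_ring L)"
proof -
  interpret R: cring "poly_ring L :: 'k polynomial ring" by (rule cring_poly_ring)
  have neg: "- x \<in> I" if "x \<in> I" for x
    using assms(4)[OF that, of "- 1"] carrier_uminus[OF carrier_1[of L]] by simp
  have inv: "\<ominus>\<^bsub>poly_ring L\<^esub> x = - x" if "x \<in> carrier (poly_ring L)"
    for x :: "'k polynomial"
    using R.minus_equality[of "-x" x] that carrier_uminus[of x L] by (simp add: poly_ring_sel)
  show ?thesis
  proof (rule idealI)
    show "ring (poly_ring L :: 'k polynomial ring)" by (rule R.ring_axioms)
    show "subgroup I (add_monoid (poly_ring L))"
      using assms neg inv
      by unfold_locales (auto simp: poly_ring_sel a_inv_def)
  qed (use assms in \<open>auto simp: poly_ring_sel mult.commute\<close>)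
qed

lemma ideal_poly_ringD:
  assumes "ideal I (poly_ring L :: 'k::field polynomial ring)"
  shows "I \<subseteq> carrier (poly_ring L)" "0 \<in> I" "\<And>x y. x \<in> I \<Longrightarrow> y \<in> I \<Longrightarrow> x + y \<in> I"
    "\<And>x y. x \<in> I \<Longrightarrow> y \<in> carrier (poly_ring L) \<Longrightarrow> y * x \<in> I"
proof -
  interpret ideal I "poly_ring L :: 'k polynomial ring" by (rule assms)
  show "I \<subseteq> carrier (poly_ring L)" "0 \<in> I" "\<And>x y. x \<in> I \<Longrightarrow> y \<in> I \<Longrightarrow> x + y \<in> I"
    "\<And>x y. x \<in> I \<Longrightarrow> y \<in> carrier (poly_ring L) \<Longrightarrow> y * x \<in> I"
    using a_subset I_l_closed additive_subgroup.zero_closed[OF is_additive_subgroup]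
      additive_subgroup.a_closed[OF is_additive_subgroup]
    by (simp_all add: poly_ring_sel)
qed

lemma ideal_sum_mem:
  assumes "ideal I (poly_ring L :: 'k::field polynomial ring)" "\<And>i. i \<in> A \<Longrightarrow> g i \<in> I"
  shows "sum g A \<in> I"
  using assms(2) by (induction A rule: infinite_finite_induct)
    (auto intro: ideal_poly_ringD[OF assms(1)])

lemma add_ideals_poly_ring:
  "I <+>\<^bsub>poly_ring L\<^esub> J = {x + y | x y. x \<in> I \<and> y \<in> J}"
  by (auto simp: set_add_def' poly_ring_sel)

lemma mem_add_ideals:
  assumes "ideal I (poly_ring L :: 'k::field polynomial ring)" "ideal J (poly_ring L)"
  shows "x \<in> I \<Longrightarrow> x \<in> I <+>\<^bsub>poly_ring L\<^esub> J" "x \<in> J \<Longrightarrow> x \<in> I <+>\<^bsub>poly_ring L\<^esub> J"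
  unfolding add_ideals_poly_ring
  using ideal_poly_ringD(2)[OF assms(1)] ideal_poly_ringD(2)[OF assms(2)] by force+

lemma PIdl_poly_ring:
  fixes g :: "'k::field polynomial"
  assumes "g \<in> carrier (poly_ring L)"
  shows "PIdl\<^bsub>poly_ring L\<^esub> g = {x * g | x. x \<in> carrier (poly_ring L)}"
  by (auto simp: cgenideal_def poly_ring_sel)

lemma ideal_PIdl:
  fixes g :: "'k::field polynomial"
  assumes "g \<in> carrier (poly_ring L)"
  shows "ideal (PIdl\<^bsub>poly_ring L\<^esub> g) (poly_ring L)"
proof -
  interpret R: cring "poly_ring L :: 'k polynomial ring" by (rule cring_poly_ring)
  show ?thesis using assms by (rule R.cgenideal_ideal)
qed

section \<open>Colon ideals and factors in Knutson families\<close>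

lemma ideal_colon_PIdl:
  fixes g :: "'k::field polynomial"
  assumes "ideal I (poly_ring L)" "g \<in> carrier (poly_ring L)"
  shows "ideal_colon (poly_ring L) I (PIdl\<^bsub>poly_ring L\<^esub> g) = {x \<in> carrier (poly_ring L). x * g \<in> I}"
proof (intro Set.set_eqI iffI)
  fix x assume "x \<in> ideal_colon (poly_ring L) I (PIdl\<^bsub>poly_ring L\<^esub> g)"
  moreover have "g \<in> PIdl\<^bsub>poly_ring L\<^esub> g"
    unfolding PIdl_poly_ring[OF assms(2)] using carrier_1[of L] by force
  ultimately show "x \<in> {x \<in> carrier (poly_ring L). x * g \<in> I}"
    unfolding ideal_colon_def by (auto simp: poly_ring_sel(2))
next
  fix x assume x: "x \<in> {x \<in> carrier (poly_ring L). x * g \<in> I}"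
  have "x * (y * g) \<in> I" if "y \<in> carrier (poly_ring L)" for y
    using ideal_poly_ringD(4)[OF assms(1) _ that, of "x * g"] x by (simp add: algebra_simps)
  with x show "x \<in> ideal_colon (poly_ring L) I (PIdl\<^bsub>poly_ring L\<^esub> g)"
    unfolding ideal_colon_def PIdl_poly_ring[OF assms(2)] by (auto simp: poly_ring_sel(2))
qed

lemma ideal_knutson:
  assumes "I \<in> knutson_ideals L (f :: 'k::field polynomial)"
  shows "ideal I (poly_ring L)"
  using assms
proof induction
  case principal
  then show ?case by (intro ideal_PIdl) (simp add: knutson_admissible_def)
next
  case (colon I J)
  note I = ideal_poly_ringD[OF colon.IH] and J = ideal_poly_ringD[OF colon.hyps(2)]
  show ?case
  proof (rule ideal_poly_ringI)
    fix x y :: "'k polynomial"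
    assume x: "x \<in> ideal_colon (poly_ring L) I J" and y: "y \<in> carrier (poly_ring L)"
    then show "y * x \<in> ideal_colon (poly_ring L) I J"
      using I(4) by (auto simp: ideal_colon_def poly_ring_sel(2) mult.assoc intro: carrier_mult)
  qed (use I in \<open>auto simp: ideal_colon_def poly_ring_sel(2) distrib_right intro: carrier_0 carrier_plus\<close>)
next
  case (sum I J)
  interpret R: cring "poly_ring L :: 'k polynomial ring" by (rule cring_poly_ring)
  show ?case using sum.IH by (rule R.add_ideals)
next
  case (inter I J)
  interpret I: ideal I "poly_ring L :: 'k polynomial ring" by (rule inter.IH(1))
  show ?case using inter.IH by (rule I.i_intersect)
qed

lemma knutson_colon_element:
  fixes f g :: "'k::field polynomial"
  assumes "I \<in> knutson_ideals L f" "g \<in> carrier (poly_ring L)"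
  shows "{x \<in> carrier (poly_ring L). x * g \<in> I} \<in> knutson_ideals L f"
  using knutson_ideals.colon[OF assms(1) ideal_PIdl[OF assms(2)]]
    ideal_colon_PIdl[OF ideal_knutson[OF assms(1)] assms(2)] by simp

text \<open>From f = g h follows (f) : h = (g), because the nonzero h cancels in a domain. This is
  how each factor det(Y_r) of the ladder polynomial enters the family.\<close>

lemma knutson_factor:
  fixes f g h :: "'k::field polynomial"
  assumes "knutson_admissible L f" "f = g * h" "f \<noteq> 0"
    "g \<in> carrier (poly_ring L)" "h \<in> carrier (poly_ring L)"
  shows "PIdl\<^bsub>poly_ring L\<^esub> g \<in> knutson_ideals L f"
proof -
  have f: "f \<in> carrier (poly_ring L)" using assms(1) by (simp add: knutson_admissible_def)
  have "{x \<in> carrier (poly_ring L). x * h \<in> PIdl\<^bsub>poly_ring L\<^esub> f} = PIdl\<^bsub>poly_ring L\<^esub> g"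
  proof (intro Set.set_eqI iffI)
    fix x assume "x \<in> {x \<in> carrier (poly_ring L). x * h \<in> PIdl\<^bsub>poly_ring L\<^esub> f}"
    then obtain y where "y \<in> carrier (poly_ring L)" "x * h = y * (g * h)"
      unfolding PIdl_poly_ring[OF f] using assms(2) by blast
    moreover have "h \<noteq> 0" using assms by auto
    ultimately have "y \<in> carrier (poly_ring L)" "x = y * g" by (auto simp flip: mult.assoc)
    then show "x \<in> PIdl\<^bsub>poly_ring L\<^esub> g" unfolding PIdl_poly_ring[OF assms(4)] by blast
  next
    fix x assume "x \<in> PIdl\<^bsub>poly_ring L\<^esub> g"
    then show "x \<in> {x \<in> carrier (poly_ring L). x * h \<in> PIdl\<^bsub>poly_ring L\<^esub> f}"
      unfolding PIdl_poly_ring[OF f] PIdl_poly_ring[OF assms(4)] using assms(2,4)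
      by (auto simp: mult.assoc intro: carrier_mult)
  qed
  then show ?thesis
    using knutson_colon_element[OF knutson_ideals.principal[OF assms(1)] assms(5)] by simp
qed

section \<open>Substitution homomorphisms\<close>

lemma poly_mapping_expand: "p = (\<Sum>m\<in>Poly_Mapping.keys p. Poly_Mapping.single m (Poly_Mapping.lookup p m))"
  by (rule poly_mapping_eqI)
    (simp add: lookup_sum lookup_single when_def sum.delta' in_keys_iff)

lemma poly_mapping_add_induct [case_names zero single add]:
  fixes p :: "'a \<Rightarrow>\<^sub>0 'b::comm_monoid_add"
  assumes "P 0" "\<And>m c. P (Poly_Mapping.single m c)" "\<And>p q. P p \<Longrightarrow> P q \<Longrightarrow> P (p + q)"
  shows "P p"
proof -
  have "P (\<Sum>m\<in>A. Poly_Mapping.single m (Poly_Mapping.lookup p m))" for A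
    using assms by (induction A rule: infinite_finite_induct) auto
  then show ?thesis by (subst poly_mapping_expand) auto
qed

lemma monomial_induct [case_names zero add]:
  fixes m :: "'x \<Rightarrow>\<^sub>0 nat"
  assumes "P 0" "\<And>m x. P m \<Longrightarrow> P (m + Poly_Mapping.single x 1)"
  shows "P m"
proof -
  have single: "P (m + Poly_Mapping.single x n)" if "P m" for m x n
  proof (induction n)
    case (Suc n)
    then show ?case
      using assms(2)[of "m + Poly_Mapping.single x n" x] by (simp add: add.assoc flip: single_add)
  qed (use that in simp)
  have "P (\<Sum>x\<in>A. Poly_Mapping.single x (Poly_Mapping.lookup m x))" for A
    using assms(1) single by (induction A rule: infinite_finite_induct) (auto simp: add.commute[of "Poly_Mapping.single _ _"])
  then show ?thesis by (subst poly_mapping_expand) auto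
qed

definition mon_eval :: "('x \<Rightarrow> 'r::comm_monoid_mult) \<Rightarrow> ('x \<Rightarrow>\<^sub>0 nat) \<Rightarrow> 'r" where
  "mon_eval g m = (\<Prod>x\<in>Poly_Mapping.keys m. g x ^ Poly_Mapping.lookup m x)"

lemma mon_eval_superset:
  "finite A \<Longrightarrow> Poly_Mapping.keys m \<subseteq> A \<Longrightarrow> mon_eval g m = (\<Prod>x\<in>A. g x ^ Poly_Mapping.lookup m x)"
  unfolding mon_eval_def by (rule prod.mono_neutral_left) (auto simp: in_keys_iff)

lemma mon_eval_0: "mon_eval g 0 = 1"
  by (simp add: mon_eval_def)

lemma mon_eval_add: "mon_eval g (m + n) = mon_eval g m * mon_eval g n"
proof -
  let ?A = "Poly_Mapping.keys m \<union> Poly_Mapping.keys n"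
  have "finite ?A" by simp
  then show ?thesis
    using Poly_Mapping.keys_add[of m n]
    by (simp add: mon_eval_superset[of ?A] lookup_add power_add prod.distrib)
qed

lemma mon_eval_single: "mon_eval g (Poly_Mapping.single x 1) = g x"
  by (simp add: mon_eval_def)

text \<open>Evaluation at \<open>g\<close> as a homomorphism of algebras; constants are embedded as
  \<open>Poly_Mapping.single 0\<close>. The target has its own type of variables because the entries
  of the factors of a matrix product are not positions of the ladder.\<close>

definition subst ::
  "('x \<Rightarrow> ('y \<Rightarrow>\<^sub>0 nat) \<Rightarrow>\<^sub>0 'k::field) \<Rightarrow> (('x \<Rightarrow>\<^sub>0 nat) \<Rightarrow>\<^sub>0 'k) \<Rightarrow> ('y \<Rightarrow>\<^sub>0 nat) \<Rightarrow>\<^sub>0 'k" where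
  "subst g p = (\<Sum>m\<in>Poly_Mapping.keys p. Poly_Mapping.single 0 (Poly_Mapping.lookup p m) * mon_eval g m)"

lemma subst_superset:
  "finite A \<Longrightarrow> Poly_Mapping.keys p \<subseteq> A \<Longrightarrow>
    subst g p = (\<Sum>m\<in>A. Poly_Mapping.single 0 (Poly_Mapping.lookup p m) * mon_eval g m)"
  unfolding subst_def by (rule sum.mono_neutral_left) (auto simp: in_keys_iff)

lemma subst_0 [simp]: "subst g 0 = 0"
  by (simp add: subst_def)

lemma subst_single: "subst g (Poly_Mapping.single m c) = Poly_Mapping.single 0 c * mon_eval g m"
  by (subst subst_superset[of "{m}"]) auto

lemma subst_1 [simp]: "subst g 1 = 1"
  using subst_single[of g 0 1] by (simp add: mon_eval_0)

lemma subst_add: "subst g (p + q) = subst g p + subst g q"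
proof -
  let ?A = "Poly_Mapping.keys p \<union> Poly_Mapping.keys q"
  have "finite ?A" by simp
  then show ?thesis
    using Poly_Mapping.keys_add[of p q]
    by (simp add: subst_superset[of ?A] lookup_add single_add distrib_right sum.distrib)
qed

lemma subst_mult: "subst g (p * q) = subst g p * subst g q"
proof (induction p rule: poly_mapping_add_induct)
  case (single m c)
  show ?case
  proof (induction q rule: poly_mapping_add_induct)
    case (single n d)
    have "subst g (Poly_Mapping.single m c * Poly_Mapping.single n d) =
        Poly_Mapping.single 0 (c * d) * (mon_eval g m * mon_eval g n)"
      by (simp add: mult_single subst_single mon_eval_add)
    also have "Poly_Mapping.single 0 (c * d) = Poly_Mapping.single 0 c * Poly_Mapping.single 0 d"
      by (simp add: mult_single)
    finally show ?case by (simp add: subst_single mult_ac)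
  qed (simp_all add: subst_add distrib_left)
qed (simp_all add: subst_add distrib_right)

lemma subst_uminus: "subst g (- p) = - subst g p"
  using subst_add[of g p "- p"] by (simp add: minus_unique)

lemma subst_diff: "subst g (p - q) = subst g p - subst g q"
  using subst_add[of g p "- q"] by (simp add: subst_uminus)

lemma subst_Var: "subst g (Var x) = g x"
  by (simp add: Var_def subst_single mon_eval_single del: One_nat_def)

lemma subst_det: "subst g (det A) = det (map_mat (subst g) A)"
proof -
  interpret comm_ring_hom "subst g"
    by unfold_locales (simp_all add: subst_add subst_mult)
  show ?thesis by (rule hom_det[symmetric])
qed

lemma det_mat_sum_permutations:
  "det (mat n n A) = (\<Sum>\<pi>\<in>{\<pi>. \<pi> permutes {0..<n}}. signof \<pi> * (\<Prod>i = 0..<n. A (i, \<pi> i)))"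
  unfolding det_def'[OF mat_carrier]
  by (intro sum.cong refl arg_cong2[of _ _ _ _ "(*)"] prod.cong)
    (auto simp: permutes_in_image intro!: index_mat)

section \<open>Generic matrices of bounded rank\<close>

text \<open>
  A monomial in the image of a product of linear forms \<open>\<Sum>\<^sub>c w c x\<close> arises from a colouring of the
  factors, which is represented by a multiset of pairs (variable, colour).
\<close>

definition underlying :: "('x \<times> 'c) multiset \<Rightarrow> 'x \<Rightarrow>\<^sub>0 nat" where
  "underlying E = (\<Sum>z\<in>#E. Poly_Mapping.single (fst z) 1)"

definition colour_weight :: "('c \<Rightarrow> 'x \<Rightarrow> 'y \<Rightarrow>\<^sub>0 nat) \<Rightarrow> ('x \<times> 'c) multiset \<Rightarrow> 'y \<Rightarrow>\<^sub>0 nat" where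
  "colour_weight w E = (\<Sum>z\<in>#E. w (snd z) (fst z))"

definition colouring :: "('x \<Rightarrow> 'c set) \<Rightarrow> ('x \<times> 'c) multiset \<Rightarrow> bool" where
  "colouring C E \<longleftrightarrow> (\<forall>z\<in>#E. snd z \<in> C (fst z))"

lemma underlying_simps [simp]:
  "underlying {#} = 0"
  "underlying (add_mset z E) = underlying E + Poly_Mapping.single (fst z) 1"
  by (simp_all add: underlying_def add.commute)

lemma colour_weight_simps [simp]:
  "colour_weight w {#} = 0"
  "colour_weight w (add_mset z E) = colour_weight w E + w (snd z) (fst z)"
  by (simp_all add: colour_weight_def add.commute)

lemma lookup_underlying: "Poly_Mapping.lookup (underlying E) x = size (filter_mset (\<lambda>z. fst z = x) E)"
  by (induction E) (auto simp: lookup_add lookup_single when_def)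

lemma lookup_mult_single:
  fixes p :: "('y \<Rightarrow>\<^sub>0 nat) \<Rightarrow>\<^sub>0 'k::field"
  shows "Poly_Mapping.lookup (p * Poly_Mapping.single w 1) (n + w) = Poly_Mapping.lookup p n"
  by (induction p rule: poly_mapping_add_induct)
    (simp_all add: mult_single lookup_single distrib_right lookup_add when_def)

text \<open>Expanding the product picks one summand from the form of each factor; the picks,
  repeated factors included, make up the multiset \<open>E\<close>.\<close>

lemma mon_eval_linear_keys:
  fixes g :: "'x \<Rightarrow> ('y \<Rightarrow>\<^sub>0 nat) \<Rightarrow>\<^sub>0 'k::field"
  assumes g: "\<And>x. g x = (\<Sum>c\<in>C x. Poly_Mapping.single (w c x) 1)"
    and "v \<in> Poly_Mapping.keys (mon_eval g m)"
  shows "\<exists>E. colouring C E \<and> underlying E = m \<and> colour_weight w E = v"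
  using assms(2)
proof (induction m arbitrary: v rule: monomial_induct)
  case zero
  then show ?case by (intro exI[of _ "{#}"]) (simp add: colouring_def mon_eval_0)
next
  case (add m x)
  then obtain a b where v: "v = a + b" "a \<in> Poly_Mapping.keys (mon_eval g m)" "b \<in> Poly_Mapping.keys (g x)"
    using keys_mult[of "mon_eval g m" "g x"] by (auto simp: mon_eval_add mon_eval_single simp del: One_nat_def)
  obtain c where c: "c \<in> C x" "b = w c x"
    using v(3) keys_sum[of "\<lambda>c. Poly_Mapping.single (w c x) (1::'k)" "C x"] unfolding g by auto
  obtain E where "colouring C E" "underlying E = m" "colour_weight w E = a"
    using add.IH[OF v(2)] by blast
  then show ?case using c v(1)
    by (intro exI[of _ "add_mset (x, c) E"]) (auto simp: colouring_def)
qed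

text \<open>Distinct colourings of equal weight would add up, and a variable bearing several colours
  would contribute a multinomial coefficient, possibly 0 in positive characteristic. Uniqueness of
  the colouring excludes the former and one colour per variable the latter, so the coefficient is
  exactly 1.\<close>

lemma mon_eval_linear_coeff:
  fixes g :: "'x \<Rightarrow> ('y \<Rightarrow>\<^sub>0 nat) \<Rightarrow>\<^sub>0 'k::field"
  assumes g: "\<And>x. g x = (\<Sum>c\<in>C x. Poly_Mapping.single (w c x) 1)" and fin: "\<And>x. finite (C x)"
    and "colouring C E"
    and "\<And>x c c'. (x, c) \<in># E \<Longrightarrow> (x, c') \<in># E \<Longrightarrow> c = c'"
    and "\<And>E'. colouring C E' \<Longrightarrow> underlying E' = underlying E \<Longrightarrow> colour_weight w E' = colour_weight w E
      \<Longrightarrow> E' = E"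
  shows "Poly_Mapping.lookup (mon_eval g (underlying E)) (colour_weight w E) = 1"
  using assms(3-)
proof (induction E)
  case empty
  then show ?case by (simp add: mon_eval_0 lookup_one)
next
  case (add z E)
  obtain x c where z: "z = (x, c)" by (cases z)
  have c: "c \<in> C x" and E: "colouring C E" using add.prems(1) by (auto simp: z colouring_def)
  have "E' = E" if "colouring C E'" "underlying E' = underlying E" "colour_weight w E' = colour_weight w E" for E'
    using add.prems(3)[of "add_mset z E'"] that add.prems(1) by (auto simp: colouring_def)
  then have IH: "Poly_Mapping.lookup (mon_eval g (underlying E)) (colour_weight w E) = 1"
    using add.prems(2) by (intro add.IH[OF E]) auto
  \<comment> \<open>Another colour \<open>c'\<close> of the last factor would complete to a second
    colouring of the same weight. By uniqueness it is \<open>add_mset z E\<close>, in which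
    \<open>x\<close> has only the colour \<open>c\<close>.\<close>
  have other: "Poly_Mapping.lookup (mon_eval g (underlying E) * Poly_Mapping.single (w c' x) 1)
      (colour_weight w E + w c x) = 0" if "c' \<in> C x" "c' \<noteq> c" for c'
  proof (rule ccontr)
    assume "\<not> ?thesis"
    then have "colour_weight w E + w c x \<in>
        Poly_Mapping.keys (mon_eval g (underlying E) * Poly_Mapping.single (w c' x) 1)"
      by (simp add: in_keys_iff)
    then obtain a where a: "a \<in> Poly_Mapping.keys (mon_eval g (underlying E))"
        "colour_weight w E + w c x = a + w c' x"
      using keys_mult[of "mon_eval g (underlying E)" "Poly_Mapping.single (w c' x) 1"] by auto
    obtain E' where E': "colouring C E'" "underlying E' = underlying E" "colour_weight w E' = a"
      using mon_eval_linear_keys[OF g a(1)] by blast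
    have "add_mset (x, c') E' = add_mset z E"
      using E' a(2) that by (intro add.prems(3)) (auto simp: z colouring_def)
    then have "(x, c') \<in># add_mset z E" by (metis union_single_eq_member)
    then show False using add.prems(2)[of x c c'] that(2) z by auto
  qed
  have "mon_eval g (underlying (add_mset z E)) =
      (\<Sum>c'\<in>C x. mon_eval g (underlying E) * Poly_Mapping.single (w c' x) 1)"
    by (simp add: z mon_eval_add mon_eval_single g sum_distrib_left del: One_nat_def)
  also have "Poly_Mapping.lookup \<dots> (colour_weight w E + w c x) =
      (\<Sum>c'\<in>C x. if c' = c then 1 else 0)"
    unfolding lookup_sum using other by (intro sum.cong refl) (auto simp: lookup_mult_single IH)
  also have "\<dots> = 1" using c fin by simp
  finally show ?case by (simp add: z)
qed

text \<open>Multisets with equal totals on \<open>P\<close> cannot differ there in one direction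
  only. Equal row and column sums thereby produce compensating positions.\<close>

lemma size_filter_excess:
  assumes "size (filter_mset P E) = size (filter_mset P E')" "P y" "count E y < count E' y"
  shows "\<exists>z. P z \<and> count E' z < count E z"
proof (rule ccontr)
  assume "\<not> ?thesis"
  then have "filter_mset P E \<subseteq># filter_mset P E'" by (auto simp: subseteq_mset_def not_less)
  moreover have "filter_mset P E \<noteq> filter_mset P E'" using assms(2,3) by (metis count_filter_mset less_irrefl)
  ultimately show False using assms(1) mset_subset_size[of "filter_mset P E" "filter_mset P E'"]
    by (auto simp: subset_mset.less_le)
qed

section \<open>Antidiagonal sequences and their levels\<close>

definition antidiagonal_seq :: "entry set \<Rightarrow> nat \<Rightarrow> (nat \<Rightarrow> entry) \<Rightarrow> bool" where
  "antidiagonal_seq S n \<sigma> \<longleftrightarrow> (\<forall>p<n. \<sigma> p \<in> S) \<and>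
    (\<forall>p q. p < q \<longrightarrow> q < n \<longrightarrow> fst (\<sigma> p) < fst (\<sigma> q) \<and> snd (\<sigma> q) < snd (\<sigma> p))"

text \<open>Mirsky's argument: the level of x is one less than the greatest length of an
  antidiagonal sequence ending in x, and a position strictly south-west of x extends such a sequence
  by one.\<close>

lemma antidiagonal_levels:
  assumes "\<And>\<sigma>. \<not> antidiagonal_seq S (Suc s) \<sigma>"
  shows "\<exists>lev. (\<forall>x\<in>S. lev x < s) \<and>
    (\<forall>x\<in>S. \<forall>y\<in>S. fst x < fst y \<longrightarrow> snd y < snd x \<longrightarrow> lev x < (lev y :: nat))"
proof -
  define N where "N x = {n. \<exists>\<sigma>. antidiagonal_seq S (Suc n) \<sigma> \<and> \<sigma> n = x}" for x
  have N: "n < s" if "n \<in> N x" for n x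
  proof (rule ccontr)
    assume "\<not> n < s"
    moreover have "\<exists>\<sigma>. antidiagonal_seq S (Suc n) \<sigma>" using that unfolding N_def by blast
    moreover have "antidiagonal_seq S (Suc s) \<sigma>" if "antidiagonal_seq S (Suc n) \<sigma>" "s \<le> n" for \<sigma>
      using that by (auto simp: antidiagonal_seq_def)
    ultimately show False using assms by (auto simp: not_less)
  qed
  then have fin: "finite (N x)" for x by (meson bounded_nat_set_is_finite)
  have ne: "0 \<in> N x" if "x \<in> S" for x
    using that unfolding N_def by (auto simp: antidiagonal_seq_def intro: exI[of _ "\<lambda>_. x"])
  have step: "Suc n \<in> N y" if n: "n \<in> N x" and y: "y \<in> S" "fst x < fst y" "snd y < snd x" for n x y
  proof -
    obtain \<sigma> where \<sigma>: "antidiagonal_seq S (Suc n) \<sigma>" "\<sigma> n = x" using n by (auto simp: N_def)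
    have "antidiagonal_seq S (Suc (Suc n)) (\<sigma>(Suc n := y))"
      unfolding antidiagonal_seq_def
    proof (intro conjI allI impI)
      fix p q assume pq: "p < q" "q < Suc (Suc n)"
      have "fst (\<sigma> p) \<le> fst x \<and> snd x \<le> snd (\<sigma> p)" if "p \<le> n"
        using \<sigma> that unfolding antidiagonal_seq_def by (cases "p = n") (auto simp: less_imp_le)
      then show "fst ((\<sigma>(Suc n := y)) p) < fst ((\<sigma>(Suc n := y)) q)"
          "snd ((\<sigma>(Suc n := y)) q) < snd ((\<sigma>(Suc n := y)) p)"
        using pq \<sigma>(1) y by (auto simp: antidiagonal_seq_def less_Suc_eq)
    qed (use \<sigma>(1) y in \<open>auto simp: antidiagonal_seq_def\<close>)
    then show ?thesis by (auto simp: N_def intro: exI[of _ "\<sigma>(Suc n := y)"])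
  qed
  show ?thesis
  proof (intro exI[of _ "\<lambda>x. Max (N x)"] conjI ballI impI)
    show "Max (N x) < s" if "x \<in> S" for x
      using N fin ne[OF that] by (metis Max_in empty_iff)
    fix x y assume "x \<in> S" "y \<in> S" "fst x < fst y" "snd y < snd x"
    then have "Suc (Max (N x)) \<in> N y" using fin[of x] ne[of x] by (intro step[of _ x] Max_in) auto
    then show "Max (N x) < Max (N y)" using fin by (metis Max_ge Suc_le_eq)
  qed
qed

type_synonym rank_var = "nat \<times> entry"

text \<open>
  The variables \<open>(0, i, c)\<close> and \<open>(1, c, j)\<close> are the entries of the two factors of a generic matrix
  product; \<open>(2, x)\<close> stands for an entry \<open>x\<close> that is left generic.
\<close>

definition rank_weight :: "entry set \<Rightarrow> nat \<Rightarrow> entry \<Rightarrow> rank_var \<Rightarrow>\<^sub>0 nat" where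
  "rank_weight T c x = (if x \<in> T then Poly_Mapping.single (0, (fst x, c)) 1 + Poly_Mapping.single (1, (c, snd x)) 1
    else Poly_Mapping.single (2, x) 1)"

text \<open>Outside \<open>T\<close> the single colour 0 makes the linear form a single variable,
  also when \<open>s = 0\<close>.\<close>

definition rank_colours :: "entry set \<Rightarrow> nat \<Rightarrow> entry \<Rightarrow> nat set" where
  "rank_colours T s x = (if x \<in> T then {..<s} else {0})"

definition rank_gen :: "entry set \<Rightarrow> nat \<Rightarrow> entry \<Rightarrow> (rank_var \<Rightarrow>\<^sub>0 nat) \<Rightarrow>\<^sub>0 'k::field" where
  "rank_gen T s x = (\<Sum>c\<in>rank_colours T s x. Poly_Mapping.single (rank_weight T c x) 1)"

lemma lookup_rank_weight:
  "Poly_Mapping.lookup (colour_weight (rank_weight T) E) (0, (i, c)) =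
    size (filter_mset (\<lambda>z. fst z \<in> T \<and> fst (fst z) = i \<and> snd z = c) E)"
  "Poly_Mapping.lookup (colour_weight (rank_weight T) E) (1, (c, j)) =
    size (filter_mset (\<lambda>z. fst z \<in> T \<and> snd (fst z) = j \<and> snd z = c) E)"
  "Poly_Mapping.lookup (colour_weight (rank_weight T) E) (2, x) =
    size (filter_mset (\<lambda>z. fst z \<notin> T \<and> fst z = x) E)"
  by (induction E) (auto simp: lookup_add lookup_single when_def rank_weight_def)

text \<open>
  A colour class without strictly antidiagonal pairs is the transport plan of the north-west corner
  rule, so it is lexicographically larger than every other plan with the same row and column sums.
\<close>

lemma north_west_colouring_max:
  fixes E E' :: "(entry \<times> nat) multiset"
  assumes C: "colouring (rank_colours T s) E" "colouring (rank_colours T s) E'"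
    and W: "colour_weight (rank_weight T) E' = colour_weight (rank_weight T) E"
    and chain: "\<And>x y c. (x, c) \<in># E \<Longrightarrow> (y, c) \<in># E \<Longrightarrow> x \<in> T \<Longrightarrow> y \<in> T \<Longrightarrow> fst x < fst y \<Longrightarrow> snd x \<le> snd y"
    and ne: "E' \<noteq> E"
  shows "underlying E' < underlying E"
proof -
  define B where "B = {x. \<exists>c. count E' (x, c) \<noteq> count E (x, c)}"
  have "B \<subseteq> fst ` (set_mset E \<union> set_mset E')"
  proof
    fix x assume "x \<in> B"
    then obtain c where "count E' (x, c) \<noteq> count E (x, c)" unfolding B_def by blast
    then have "(x, c) \<in># E \<or> (x, c) \<in># E'" by (metis not_in_iff)
    then show "x \<in> fst ` (set_mset E \<union> set_mset E')" by force
  qed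
  then have finB: "finite B" by (rule finite_subset) simp
  have neB: "B \<noteq> {}" using ne by (auto simp: B_def multiset_eq_iff)
  \<comment> \<open>The first position, row by row, at which the colourings differ; at all earlier
    positions they agree in every colour.\<close>
  define x where "x = Min B"
  have below: "count E' (y, c) = count E (y, c)" if "y < x" for y c
    using that Min_le[OF finB, of y] unfolding x_def B_def by force
  have le: "count E' (x, c) \<le> count E (x, c)" for c
  proof (rule ccontr)
    assume "\<not> ?thesis"
    then have gt: "count E (x, c) < count E' (x, c)" by simp
    then have mem: "(x, c) \<in># E'" by (metis not_in_iff not_less0)
    show False
    proof (cases "x \<in> T")
      case True
      \<comment> \<open>An excess of \<open>E'\<close> at \<open>x\<close> in colour
        \<open>c\<close> is compensated by an excess of \<open>E\<close> at some \<open>z\<close> in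
        the same row and some \<open>z'\<close> in the same column. Minimality of \<open>x\<close>
        puts \<open>z\<close> to the right and \<open>z'\<close> below, so they form a strictly
        antidiagonal pair of colour \<open>c\<close> in \<open>E\<close>.\<close>
      obtain z where z: "fst z \<in> T" "fst (fst z) = fst x" "snd z = c" "count E' z < count E z"
        using size_filter_excess[of "\<lambda>z. fst z \<in> T \<and> fst (fst z) = fst x \<and> snd z = c" E E' "(x, c)"] gt True
          lookup_rank_weight(1)[of T E "fst x" c] lookup_rank_weight(1)[of T E' "fst x" c] W by auto
      obtain z' where z': "fst z' \<in> T" "snd (fst z') = snd x" "snd z' = c" "count E' z' < count E z'"
        using size_filter_excess[of "\<lambda>z. fst z \<in> T \<and> snd (fst z) = snd x \<and> snd z = c" E E' "(x, c)"] gt True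
          lookup_rank_weight(2)[of T E c "snd x"] lookup_rank_weight(2)[of T E' c "snd x"] W by auto
      have "\<not> fst z < x" using z below[of "fst z" "snd z"] by auto
      moreover have "fst z \<noteq> x" using z gt by (metis less_asym prod.collapse)
      ultimately have 1: "snd x < snd (fst z)" using z(2) by (auto simp: less_prod_def prod_eq_iff)
      have "\<not> fst z' < x" using z' below[of "fst z'" "snd z'"] by auto
      moreover have "fst z' \<noteq> x" using z' gt by (metis less_asym prod.collapse)
      ultimately have 2: "fst x < fst (fst z')" using z'(2) by (auto simp: less_prod_def prod_eq_iff)
      have "(fst z, c) \<in># E" "(fst z', c) \<in># E"
        using z(3,4) z'(3,4) by (metis not_in_iff not_less0 prod.collapse)+
      from chain[OF this z(1) z'(1)] 1 2 z(2) z'(2) show False by simp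
    next
      case False
      obtain z where z: "fst z = x" "count E' z < count E z"
        using size_filter_excess[of "\<lambda>z. fst z \<notin> T \<and> fst z = x" E E' "(x, c)"] gt False
          lookup_rank_weight(3)[of T E x] lookup_rank_weight(3)[of T E' x] W by auto
      have "z \<in># E" using z(2) by (metis not_in_iff not_less0)
      then have "snd z = 0" "c = 0"
        using C mem False z(1) by (auto simp: colouring_def rank_colours_def)
      then show False using z gt by (metis less_asym prod.collapse)
    qed
  qed
  obtain c where "count E' (x, c) \<noteq> count E (x, c)"
    using Min_in[OF finB neB] by (auto simp: x_def B_def)
  then have "filter_mset (\<lambda>z. fst z = x) E' \<noteq> filter_mset (\<lambda>z. fst z = x) E"
    by (metis (mono_tags, lifting) count_filter_mset fst_conv)
  moreover have "filter_mset (\<lambda>z. fst z = x) E' \<subseteq># filter_mset (\<lambda>z. fst z = x) E"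
    using le by (auto simp: subseteq_mset_def)
  ultimately have "Poly_Mapping.lookup (underlying E') x < Poly_Mapping.lookup (underlying E) x"
    unfolding lookup_underlying by (intro mset_subset_size) (simp add: subset_mset.less_le)
  moreover have "Poly_Mapping.lookup (underlying E') y = Poly_Mapping.lookup (underlying E) y" if "y < x" for y
    unfolding lookup_underlying using below[OF that]
    by (intro arg_cong[of _ _ size] multiset_eqI) auto
  ultimately show ?thesis unfolding less_poly_mapping.rep_eq less_fun_def by blast
qed

lemma colouring_by_function:
  "\<exists>E. underlying E = m \<and> (\<forall>z\<in>#E. fst z \<in> Poly_Mapping.keys m \<and> snd z = \<kappa> (fst z))"
proof (induction m rule: monomial_induct)
  case zero
  then show ?case by (intro exI[of _ "{#}"]) simp
next
  case (add m x)
  then obtain E where E: "underlying E = m" "\<forall>z\<in>#E. fst z \<in> Poly_Mapping.keys m \<and> snd z = \<kappa> (fst z)" by blast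
  have "Poly_Mapping.keys (m + Poly_Mapping.single x 1) = insert x (Poly_Mapping.keys m)"
    by (auto simp: in_keys_iff lookup_add lookup_single when_def split: if_splits)
  with E show ?case by (intro exI[of _ "add_mset (x, \<kappa> x) E"]) auto
qed

text \<open>Only the support of the monomial matters: the positions of an antidiagonal sequence are
  distinct, so their product is squarefree.\<close>

definition standard_monomial :: "entry set \<Rightarrow> nat \<Rightarrow> monomial \<Rightarrow> bool" where
  "standard_monomial T t m \<longleftrightarrow> (\<forall>\<sigma>. \<not> antidiagonal_seq (Poly_Mapping.keys m \<inter> T) t \<sigma>)"

text \<open>The least monomial m of \<open>h\<close> is coloured by levels outside of which no
  antidiagonal pair shares a colour. The resulting weight occurs in the image of m with coefficient
  1, and every other colouring of that weight lies over a monomial below m, hence over none of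
  \<open>h\<close>. So the coefficient of this weight in the image is the coefficient of m in
  \<open>h\<close>.\<close>

theorem rank_subst_nonzero:
  fixes h :: "'k::field polynomial"
  assumes "h \<noteq> 0" and std: "\<And>m. m \<in> Poly_Mapping.keys h \<Longrightarrow> standard_monomial T (Suc s) m"
  shows "subst (rank_gen T s) h \<noteq> 0"
proof -
  define m where "m = Min (Poly_Mapping.keys h)"
  have ne: "Poly_Mapping.keys h \<noteq> {}" using assms(1) by simp
  then have m: "m \<in> Poly_Mapping.keys h" by (simp add: m_def)
  obtain lev where lev: "\<And>x. x \<in> Poly_Mapping.keys m \<inter> T \<Longrightarrow> lev x < s"
      "\<And>x y. x \<in> Poly_Mapping.keys m \<inter> T \<Longrightarrow> y \<in> Poly_Mapping.keys m \<inter> T \<Longrightarrow>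
        fst x < fst y \<Longrightarrow> snd y < snd x \<Longrightarrow> lev x < (lev y :: nat)"
    using antidiagonal_levels[of "Poly_Mapping.keys m \<inter> T" s] std[OF m]
    unfolding standard_monomial_def by blast
  obtain E where E: "underlying E = m"
      "\<And>z. z \<in># E \<Longrightarrow> fst z \<in> Poly_Mapping.keys m \<and> snd z = (if fst z \<in> T then lev (fst z) else 0)"
    using colouring_by_function[where m = m and \<kappa> = "\<lambda>x. if x \<in> T then lev x else 0"] by blast
  let ?C = "rank_colours T s" and ?W = "colour_weight (rank_weight T)"
  have CE: "colouring ?C E" using E(2) lev(1) by (auto simp: colouring_def rank_colours_def)
  have chain: "snd x \<le> snd y" if "(x, c) \<in># E" "(y, c) \<in># E" "x \<in> T" "y \<in> T" "fst x < fst y" for x y c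
    using lev(2)[of x y] E(2)[OF that(1)] E(2)[OF that(2)] that(3-) by (auto simp flip: not_less)
  have max: "underlying E' < m" if "colouring ?C E'" "?W E' = ?W E" "E' \<noteq> E" for E'
    using north_west_colouring_max[OF CE that(1,2) _ that(3)] chain E(1) by blast
  have one: "Poly_Mapping.lookup (mon_eval (rank_gen T s :: _ \<Rightarrow> _ \<Rightarrow>\<^sub>0 'k) m) (?W E) = 1"
    unfolding E(1)[symmetric]
  proof (rule mon_eval_linear_coeff[where C = ?C])
    show "c = c'" if "(x, c) \<in># E" "(x, c') \<in># E" for x c c'
      using E(2)[OF that(1)] E(2)[OF that(2)] by (metis fst_conv snd_conv)
    show "E' = E" if "colouring ?C E'" "underlying E' = underlying E" "?W E' = ?W E" for E'
      using max[OF that(1,3)] that(2) E(1) by auto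
  qed (auto simp: rank_gen_def CE rank_colours_def)
  have zero: "Poly_Mapping.lookup (mon_eval (rank_gen T s :: _ \<Rightarrow> _ \<Rightarrow>\<^sub>0 'k) n) (?W E) = 0"
    if "n \<in> Poly_Mapping.keys h" "n \<noteq> m" for n
  proof (rule ccontr)
    assume "\<not> ?thesis"
    then have "?W E \<in> Poly_Mapping.keys (mon_eval (rank_gen T s :: _ \<Rightarrow> _ \<Rightarrow>\<^sub>0 'k) n)"
      by (simp add: in_keys_iff)
    then obtain E' where E': "colouring ?C E'" "underlying E' = n" "?W E' = ?W E"
      using mon_eval_linear_keys[where g = "rank_gen T s :: _ \<Rightarrow> _ \<Rightarrow>\<^sub>0 'k" and C = ?C
          and w = "rank_weight T", OF rank_gen_def] by blast
    then have "n < m" using max[OF E'(1,3)] that(2) E(1) by auto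
    then show False using that(1) by (simp add: m_def flip: not_le)
  qed
  have scale: "Poly_Mapping.lookup (Poly_Mapping.single 0 c * p) v = c * Poly_Mapping.lookup p v"
    for c :: 'k and p :: "(rank_var \<Rightarrow>\<^sub>0 nat) \<Rightarrow>\<^sub>0 'k" and v
    by (induction p rule: poly_mapping_add_induct)
      (simp_all add: mult_single lookup_single distrib_left lookup_add when_def)
  have "Poly_Mapping.lookup (subst (rank_gen T s) h) (?W E) =
      (\<Sum>n\<in>Poly_Mapping.keys h. if n = m then Poly_Mapping.lookup h m else 0)"
    unfolding subst_def lookup_sum scale
    by (intro sum.cong refl) (auto simp: one zero)
  also have "\<dots> = Poly_Mapping.lookup h m" using m by simp
  also have "\<dots> \<noteq> 0" using m by (simp add: in_keys_iff)
  finally show ?thesis by auto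
qed

section \<open>Determinants of matrices of variables\<close>

lemma det_column_sum:
  fixes y :: "'i \<Rightarrow> 'r::comm_ring_1"
  assumes "q0 < n"
  shows "det (mat n n (\<lambda>(p, q). if q = q0 then (\<Sum>i\<in>A. y i * b i p) else B p q)) =
    (\<Sum>i\<in>A. y i * det (mat n n (\<lambda>(p, q). if q = q0 then b i p else B p q)))"
proof -
  let ?S = "{\<pi>. \<pi> permutes {0..<n}}"
  have *: "det (mat n n (\<lambda>(p, q). if q = q0 then b' p else B p q)) =
      (\<Sum>\<pi>\<in>?S. signof \<pi> * (b' (\<pi> q0) * (\<Prod>j\<in>{..<n} - {q0}. B (\<pi> j) j)))" for b' :: "nat \<Rightarrow> 'r"
    unfolding det_col[OF mat_carrier]
  proof (intro sum.cong refl arg_cong2[of _ _ _ _ "(*)"])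
    fix \<pi> assume "\<pi> \<in> ?S"
    then have \<pi>: "\<pi> j < n" if "j < n" for j
      using permutes_in_image[of \<pi> "{0..<n}" j] that by auto
    have "(\<Prod>j<n. mat n n (\<lambda>(p, q). if q = q0 then b' p else B p q) $$ (\<pi> j, j)) =
        (\<Prod>j<n. if j = q0 then b' (\<pi> j) else B (\<pi> j) j)"
      using \<pi> by (intro prod.cong) auto
    also have "\<dots> = b' (\<pi> q0) * (\<Prod>j\<in>{..<n} - {q0}. if j = q0 then b' (\<pi> j) else B (\<pi> j) j)"
      using assms by (subst prod.remove[of _ q0]) auto
    also have "(\<Prod>j\<in>{..<n} - {q0}. if j = q0 then b' (\<pi> j) else B (\<pi> j) j) = (\<Prod>j\<in>{..<n} - {q0}. B (\<pi> j) j)"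
      by (intro prod.cong) auto
    finally show "(\<Prod>j<n. mat n n (\<lambda>(p, q). if q = q0 then b' p else B p q) $$ (\<pi> j, j)) =
        b' (\<pi> q0) * (\<Prod>j\<in>{..<n} - {q0}. B (\<pi> j) j)" .
  qed
  show ?thesis
    unfolding * sum_distrib_left sum_distrib_right
    by (subst sum.swap) (intro sum.cong refl, simp add: mult_ac)
qed

text \<open>The s + 1 columns from \<open>e\<close> to \<open>e + s\<close> lie in the span of s
  vectors. In A = B C the factor B stores these vectors in the columns from \<open>e\<close> on and
  a zero column at \<open>e + s\<close>; C stores the coefficients and is the identity on the other
  columns.\<close>

lemma det_low_rank_columns:
  fixes A :: "nat \<Rightarrow> nat \<Rightarrow> 'r::comm_ring_1"
  assumes "e + s < n"
    and A: "\<And>i j. i < n \<Longrightarrow> e \<le> j \<Longrightarrow> j \<le> e + s \<Longrightarrow> A i j = (\<Sum>c<s. u i c * v c j)"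
  shows "det (mat n n (\<lambda>(i, j). A i j)) = 0"
proof -
  let ?W = "{e..e + s}"
  define B where "B = mat n n (\<lambda>(i, j). if j \<in> ?W then if j = e + s then 0 else u i (j - e) else A i j)"
  define C where "C = mat n n (\<lambda>(i, j). if j \<in> ?W then if e \<le> i \<and> i < e + s then v (i - e) j else 0
    else if i = j then 1 else 0)"
  have BC: "B \<in> carrier_mat n n" "C \<in> carrier_mat n n" by (auto simp: B_def C_def)
  have "mat n n (\<lambda>(i, j). A i j) = B * C"
  proof (rule eq_matI)
    fix i j assume "i < dim_row (B * C)" "j < dim_col (B * C)"
    then have ij: "i < n" "j < n" using BC by auto
    have "(B * C) $$ (i, j) = (\<Sum>k = 0..<n. B $$ (i, k) * C $$ (k, j))"
      using ij BC by (simp add: scalar_prod_def)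
    also have "\<dots> = A i j"
    proof (cases "j \<in> ?W")
      case True
      have "(\<Sum>k = 0..<n. B $$ (i, k) * C $$ (k, j)) = (\<Sum>k\<in>{e..<e + s}. u i (k - e) * v (k - e) j)"
        using ij True assms(1) by (intro sum.mono_neutral_cong_right) (auto simp: B_def C_def)
      also have "\<dots> = (\<Sum>c<s. u i c * v c j)"
        by (rule sum.reindex_bij_witness[of _ "\<lambda>c. c + e" "\<lambda>k. k - e"]) auto
      finally show ?thesis using A ij True by simp
    next
      case False
      have "(\<Sum>k = 0..<n. B $$ (i, k) * C $$ (k, j)) = (\<Sum>k\<in>{j}. A i k)"
        using ij False by (intro sum.mono_neutral_cong_right) (auto simp: B_def C_def)
      then show ?thesis by simp
    qed
    finally show "mat n n (\<lambda>(i, j). A i j) $$ (i, j) = (B * C) $$ (i, j)" using ij by simp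
  qed (use BC in auto)
  moreover have "det (B * C) = det B * det C" by (rule det_mult[OF BC])
  moreover have "det B = 0"
    unfolding det_col[OF BC(1)]
  proof (rule sum.neutral, intro ballI)
    fix \<pi> assume "\<pi> \<in> {\<pi>. \<pi> permutes {0..<n}}"
    then have "\<pi> (e + s) < n" using permutes_in_image[of \<pi> "{0..<n}" "e + s"] assms(1) by auto
    then have "B $$ (\<pi> (e + s), e + s) = 0" using assms(1) by (simp add: B_def)
    then have "(\<Prod>j<n. B $$ (\<pi> j, j)) = 0" using assms(1) by (intro prod_zero) auto
    then show "signof \<pi> * (\<Prod>j<n. B $$ (\<pi> j, j)) = 0" by simp
  qed
  ultimately show ?thesis by simp
qed

lemma subst_rank_gen_Var:
  assumes "x \<in> T"
  shows "subst (rank_gen T s) (Var x) = (\<Sum>c<s. Poly_Mapping.single (Poly_Mapping.single (0, (fst x, c)) 1) 1 *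
    Poly_Mapping.single (Poly_Mapping.single (1, (c, snd x)) 1) (1::'k::field))"
  using assms by (simp add: subst_Var rank_gen_def rank_colours_def rank_weight_def mult_single)

text \<open>Only s + 1 adjacent columns have to consist of variables of \<open>T\<close>, so a block
  wider than the window can be tested; \<rho> and \<kappa> may repeat or be unordered.\<close>

lemma subst_rank_gen_det:
  fixes A :: "nat \<Rightarrow> nat \<Rightarrow> 'k::field polynomial"
  assumes "e + s < n"
    and "\<And>i j. i < n \<Longrightarrow> e \<le> j \<Longrightarrow> j \<le> e + s \<Longrightarrow> A i j = Var (\<rho> i, \<kappa> j) \<and> (\<rho> i, \<kappa> j) \<in> T"
  shows "subst (rank_gen T s) (det (mat n n (\<lambda>(i, j). A i j))) = 0"
proof -
  have "map_mat (subst (rank_gen T s)) (mat n n (\<lambda>(i, j). A i j)) =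
      mat n n (\<lambda>(i, j). subst (rank_gen T s) (A i j))"
    by (rule eq_matI) auto
  moreover have "det (mat n n (\<lambda>(i, j). subst (rank_gen T s) (A i j))) = 0"
    by (rule det_low_rank_columns[where s = s and e = e and
          u = "\<lambda>i c. Poly_Mapping.single (Poly_Mapping.single (0, (\<rho> i, c)) 1) 1" and
          v = "\<lambda>c j. Poly_Mapping.single (Poly_Mapping.single (1, (c, \<kappa> j)) 1) 1", OF assms(1)])
      (simp add: assms(2) subst_rank_gen_Var)
  ultimately show ?thesis by (simp add: subst_det)
qed

text \<open>The lexicographically lowest monomial of a polynomial plays the role of a leading monomial.\<close>

definition bounded_below :: "('m::linorder) \<Rightarrow> ('m \<Rightarrow>\<^sub>0 'k::zero) \<Rightarrow> bool" where
  "bounded_below \<delta> p \<longleftrightarrow> (\<forall>m\<in>Poly_Mapping.keys p. \<delta> \<le> m)"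

lemma bounded_below_mult:
  fixes p q :: "'k::field polynomial"
  assumes "bounded_below \<delta> p" "bounded_below \<epsilon> q"
  shows "bounded_below (\<delta> + \<epsilon>) (p * q)"
    and "Poly_Mapping.lookup (p * q) (\<delta> + \<epsilon>) = Poly_Mapping.lookup p \<delta> * Poly_Mapping.lookup q \<epsilon>"
proof -
  show "bounded_below (\<delta> + \<epsilon>) (p * q)"
    unfolding bounded_below_def
  proof
    fix m assume "m \<in> Poly_Mapping.keys (p * q)"
    then obtain a b where "m = a + b" "a \<in> Poly_Mapping.keys p" "b \<in> Poly_Mapping.keys q"
      using keys_mult[of p q] by auto
    then show "\<delta> + \<epsilon> \<le> m" using assms by (auto simp: bounded_below_def intro: add_mono)
  qed
  have gap: "Poly_Mapping.lookup (p' * q') (\<delta> + \<epsilon>) = 0"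
    if "\<And>a b. a \<in> Poly_Mapping.keys p' \<Longrightarrow> b \<in> Poly_Mapping.keys q' \<Longrightarrow> \<delta> + \<epsilon> < a + b"
    for p' q' :: "'k polynomial"
  proof (rule ccontr)
    assume "\<not> ?thesis"
    then have "\<delta> + \<epsilon> \<in> Poly_Mapping.keys (p' * q')" by (simp add: in_keys_iff)
    then show False using keys_mult[of p' q'] that by fastforce
  qed
  \<comment> \<open>Once the lowest terms are split off, every remaining product has all its
    monomials strictly above \<open>\<delta> + \<epsilon>\<close>.\<close>
  define p' where "p' = p - Poly_Mapping.single \<delta> (Poly_Mapping.lookup p \<delta>)"
  define q' where "q' = q - Poly_Mapping.single \<epsilon> (Poly_Mapping.lookup q \<epsilon>)"
  have p': "\<delta> < a" if "a \<in> Poly_Mapping.keys p'" for a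
    using that assms(1)
    by (auto simp: p'_def in_keys_iff lookup_minus lookup_single when_def bounded_below_def order.strict_iff_order
      split: if_splits)
  have q': "\<epsilon> < a" if "a \<in> Poly_Mapping.keys q'" for a
    using that assms(2)
    by (auto simp: q'_def in_keys_iff lookup_minus lookup_single when_def bounded_below_def order.strict_iff_order
      split: if_splits)
  have split: "p * q = Poly_Mapping.single (\<delta> + \<epsilon>) (Poly_Mapping.lookup p \<delta> * Poly_Mapping.lookup q \<epsilon>) +
      Poly_Mapping.single \<delta> (Poly_Mapping.lookup p \<delta>) * q' + p' * q"
    by (simp add: p'_def q'_def algebra_simps flip: mult_single)
  have "Poly_Mapping.lookup (Poly_Mapping.single \<delta> (Poly_Mapping.lookup p \<delta>) * q') (\<delta> + \<epsilon>) = 0"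
    using q' by (intro gap) (auto split: if_splits)
  moreover have "Poly_Mapping.lookup (p' * q) (\<delta> + \<epsilon>) = 0"
    using p' assms(2) by (intro gap) (auto simp: bounded_below_def intro: add_less_le_mono)
  ultimately show "Poly_Mapping.lookup (p * q) (\<delta> + \<epsilon>) = Poly_Mapping.lookup p \<delta> * Poly_Mapping.lookup q \<epsilon>"
    by (simp add: split lookup_add)
qed

lemma bounded_below_1: "bounded_below 0 (1 :: 'k::field polynomial)"
  by (simp add: bounded_below_def)

lemma bounded_below_prod:
  fixes p :: "'i \<Rightarrow> 'k::field polynomial"
  assumes "finite A" "\<And>i. i \<in> A \<Longrightarrow> bounded_below (\<delta> i) (p i)"
  shows "bounded_below (\<Sum>i\<in>A. \<delta> i) (\<Prod>i\<in>A. p i) \<and>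
    Poly_Mapping.lookup (\<Prod>i\<in>A. p i) (\<Sum>i\<in>A. \<delta> i) = (\<Prod>i\<in>A. Poly_Mapping.lookup (p i) (\<delta> i))"
  using assms
  by (induction A rule: finite_induct) (simp_all add: bounded_below_1 lookup_one bounded_below_mult)

section \<open>Lowest monomials of determinants of variables\<close>

definition permutation_monomial :: "(nat \<Rightarrow> nat) \<Rightarrow> (nat \<Rightarrow> nat) \<Rightarrow> nat \<Rightarrow> (nat \<Rightarrow> nat) \<Rightarrow> monomial" where
  "permutation_monomial \<rho> \<kappa> n \<pi> = (\<Sum>i<n. Poly_Mapping.single (\<rho> i, \<kappa> (\<pi> i)) 1)"

lemma prod_Var: "finite A \<Longrightarrow> (\<Prod>i\<in>A. Var (x i)) = Poly_Mapping.single (\<Sum>i\<in>A. Poly_Mapping.single (x i) 1) (1::'k::field)"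
  by (induction A rule: finite_induct) (simp_all add: Var_def mult_single)

lemma signof_single: "signof \<pi> * Poly_Mapping.single m (1::'k::field) = Poly_Mapping.single m (signof \<pi>)"
  by (simp add: sign_def single_uminus)

lemma det_Var_expand:
  "det (mat n n (\<lambda>(p, q). Var (\<rho> p, \<kappa> q) :: 'k::field polynomial)) =
    (\<Sum>\<pi>\<in>{\<pi>. \<pi> permutes {0..<n}}. Poly_Mapping.single (permutation_monomial \<rho> \<kappa> n \<pi>) (signof \<pi>))"
  unfolding det_mat_sum_permutations
  by (intro sum.cong refl) (simp add: prod_Var signof_single permutation_monomial_def atLeast0LessThan)

lemma reverse_permutes: "(\<lambda>i. if i < n then n - 1 - i else i) permutes {0..<n::nat}"
  by (rule bij_imp_permutes, rule bij_betw_byWitness[where f' = "\<lambda>i. n - 1 - i"]) auto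

text \<open>In the first row k where \<pi> leaves the reversal, all columns beyond
  \<open>n - 1 - k\<close> are already taken, so \<pi> chooses an earlier column. That position
  occurs in the monomial of \<pi> but not in that of the reversal, and at all smaller positions the
  two monomials agree.\<close>

lemma permutation_monomial_reverse_less:
  assumes \<rho>: "strict_mono_on {..<n} \<rho>" and \<kappa>: "strict_mono_on {..<n} \<kappa>"
    and \<pi>: "\<pi> permutes {0..<n}" and i: "i < n" "\<pi> i \<noteq> n - 1 - i"
  shows "permutation_monomial \<rho> \<kappa> n (\<lambda>i. n - 1 - i) < permutation_monomial \<rho> \<kappa> n \<pi>"
proof -
  define k where "k = (LEAST i. i < n \<and> \<pi> i \<noteq> n - 1 - i)"
  have k: "k < n" "\<pi> k \<noteq> n - 1 - k"
    using LeastI[of "\<lambda>i. i < n \<and> \<pi> i \<noteq> n - 1 - i" i] i by (auto simp: k_def)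
  have before: "\<pi> j = n - 1 - j" if "j < k" for j
    using not_less_Least[of j "\<lambda>i. i < n \<and> \<pi> i \<noteq> n - 1 - i"] that k(1) unfolding k_def by auto
  have \<pi>n: "\<pi> j < n" if "j < n" for j using permutes_in_image[OF \<pi>, of j] that by auto
  have lt: "\<pi> k < n - 1 - k"
  proof (rule ccontr)
    assume "\<not> ?thesis"
    then have gt: "n - 1 - k < \<pi> k" using k(2) by simp
    define j where "j = n - 1 - \<pi> k"
    have "j < k" "n - 1 - j = \<pi> k" using gt \<pi>n[OF k(1)] k(1) by (auto simp: j_def)
    then have "\<pi> j = \<pi> k" "j \<noteq> k" using before by auto
    then show False using permutes_inj[OF \<pi>] by (auto dest: injD)
  qed
  have look: "Poly_Mapping.lookup (permutation_monomial \<rho> \<kappa> n \<tau>) x =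
      (\<Sum>i<n. if (\<rho> i, \<kappa> (\<tau> i)) = x then 1 else 0)" for \<tau> x
    unfolding permutation_monomial_def lookup_sum by (intro sum.cong) (auto simp: lookup_single when_def)
  have \<kappa>lt: "\<kappa> (\<pi> k) < \<kappa> (n - 1 - k)" using strict_mono_onD[OF \<kappa>, of "\<pi> k" "n - 1 - k"] lt by auto
  let ?x = "(\<rho> k, \<kappa> (\<pi> k))"
  have "Poly_Mapping.lookup (permutation_monomial \<rho> \<kappa> n (\<lambda>i. n - 1 - i)) ?x = 0"
    unfolding look
  proof (rule sum.neutral, intro ballI)
    fix i assume "i \<in> {..<n}"
    then show "(if (\<rho> i, \<kappa> (n - 1 - i)) = ?x then 1 else 0) = (0::nat)"
      using strict_mono_on_eqD[OF \<rho>, of i k] \<kappa>lt k(1) by auto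
  qed
  moreover have "0 < Poly_Mapping.lookup (permutation_monomial \<rho> \<kappa> n \<pi>) ?x"
    unfolding look using k(1) by (intro sum_pos2[of _ k]) auto
  moreover have "Poly_Mapping.lookup (permutation_monomial \<rho> \<kappa> n (\<lambda>i. n - 1 - i)) y =
      Poly_Mapping.lookup (permutation_monomial \<rho> \<kappa> n \<pi>) y" if "y < ?x" for y
    unfolding look
  proof (intro sum.cong refl)
    fix i assume i: "i \<in> {..<n}"
    consider "i < k" | "i = k" | "k < i" by linarith
    then show "(if (\<rho> i, \<kappa> (n - 1 - i)) = y then 1 else 0) = (if (\<rho> i, \<kappa> (\<pi> i)) = y then 1 else (0::nat))"
    proof cases
      case 3
      then have "\<rho> k < \<rho> i" using strict_mono_onD[OF \<rho>, of k i] i by auto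
      then show ?thesis using that by (auto simp: less_prod_def)
    qed (use before that \<kappa>lt in \<open>auto simp: less_prod_def\<close>)
  qed
  ultimately show ?thesis unfolding less_poly_mapping.rep_eq less_fun_def by (metis order_refl)
qed

lemma permutation_monomial_reverse_eq:
  "permutation_monomial \<rho> \<kappa> n (\<lambda>i. if i < n then n - 1 - i else i) = permutation_monomial \<rho> \<kappa> n (\<lambda>i. n - 1 - i)"
  unfolding permutation_monomial_def by (intro sum.cong) auto

text \<open>A set \<open>S\<close> of permutations is allowed so that one computation serves both
  the whole determinant and the part of it that uses one given entry.\<close>

lemma sum_permutation_monomials_low:
  assumes \<rho>: "strict_mono_on {..<n} \<rho>" and \<kappa>: "strict_mono_on {..<n} \<kappa>"
    and S: "S \<subseteq> {\<pi>. \<pi> permutes {0..<n}}"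
  defines "\<delta> \<equiv> permutation_monomial \<rho> \<kappa> n (\<lambda>i. n - 1 - i)"
    and "\<tau> \<equiv> \<lambda>i. if i < n then n - 1 - i else i"
    and "h \<equiv> \<Sum>\<pi>\<in>S. Poly_Mapping.single (permutation_monomial \<rho> \<kappa> n \<pi>) (signof \<pi> :: 'k::field)"
  shows "bounded_below \<delta> h" "Poly_Mapping.lookup h \<delta> = (if \<tau> \<in> S then signof \<tau> else 0)"
proof -
  have fin: "finite S" using S by (rule finite_subset) (simp add: finite_permutations)
  have \<tau>: "\<tau> permutes {0..<n}" unfolding \<tau>_def by (rule reverse_permutes)
  have lt: "\<delta> < permutation_monomial \<rho> \<kappa> n \<pi>" if \<pi>: "\<pi> \<in> S" "\<pi> \<noteq> \<tau>" for \<pi>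
  proof -
    have p: "\<pi> permutes {0..<n}" using \<pi>(1) S by auto
    obtain i where "\<pi> i \<noteq> \<tau> i" using \<pi>(2) by auto
    then have "i < n" "\<pi> i \<noteq> n - 1 - i"
      using permutes_not_in[OF p, of i] permutes_not_in[OF \<tau>, of i] by (auto simp: \<tau>_def split: if_splits)
    then show ?thesis unfolding \<delta>_def by (rule permutation_monomial_reverse_less[OF \<rho> \<kappa> p])
  qed
  have eq: "permutation_monomial \<rho> \<kappa> n \<tau> = \<delta>"
    unfolding \<tau>_def \<delta>_def by (rule permutation_monomial_reverse_eq)
  show "bounded_below \<delta> h"
    unfolding bounded_below_def
  proof
    fix m assume "m \<in> Poly_Mapping.keys h"
    then obtain \<pi> where "\<pi> \<in> S" "m = permutation_monomial \<rho> \<kappa> n \<pi>"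
      using keys_sum[of "\<lambda>\<pi>. Poly_Mapping.single (permutation_monomial \<rho> \<kappa> n \<pi>) (signof \<pi> :: 'k)" S]
      unfolding h_def by (auto split: if_splits)
    then show "\<delta> \<le> m" using lt[of \<pi>] eq order.strict_implies_order by (cases "\<pi> = \<tau>") blast+
  qed
  have "Poly_Mapping.lookup h \<delta> = (\<Sum>\<pi>\<in>S. if \<pi> = \<tau> then signof \<tau> else 0)"
    unfolding h_def lookup_sum using lt[THEN less_imp_neq] eq
    by (intro sum.cong refl) (metis lookup_single_eq lookup_single_not_eq)
  then show "Poly_Mapping.lookup h \<delta> = (if \<tau> \<in> S then signof \<tau> else 0)" using fin by simp
qed

lemma det_Var_low:
  assumes "strict_mono_on {..<n} \<rho>" "strict_mono_on {..<n} \<kappa>"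
  defines "\<delta> \<equiv> permutation_monomial \<rho> \<kappa> n (\<lambda>i. n - 1 - i)"
    and "D \<equiv> det (mat n n (\<lambda>(p, q). Var (\<rho> p, \<kappa> q) :: 'k::field polynomial))"
  shows "bounded_below \<delta> D" "Poly_Mapping.lookup D \<delta> \<in> {1, -1}"
  using sum_permutation_monomials_low[OF assms(1,2) subset_refl, where ?'k = 'k] reverse_permutes[of n]
  unfolding D_def \<delta>_def det_Var_expand by (auto simp: sign_def)

lemma det_Var_keys:
  assumes "m \<in> Poly_Mapping.keys (det (mat n n (\<lambda>(p, q). Var (\<rho> p, \<kappa> q) :: 'k::field polynomial)))"
  shows "\<exists>\<pi>. \<pi> permutes {0..<n} \<and> m = permutation_monomial \<rho> \<kappa> n \<pi>"
  using assms keys_sum[of "\<lambda>\<pi>. Poly_Mapping.single (permutation_monomial \<rho> \<kappa> n \<pi>) (signof \<pi> :: 'k)"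
      "{\<pi>. \<pi> permutes {0..<n}}"]
  unfolding det_Var_expand by (auto split: if_splits)

section \<open>Ladder determinantal ideals as kernels\<close>

text \<open>The ladder condition without the bounding rectangle of \<open>ladder\<close>, in a form
  that windows and transposes inherit.\<close>

definition ladder_convex :: "entry set \<Rightarrow> bool" where
  "ladder_convex T \<longleftrightarrow> (\<forall>i j i' j'. (i, j) \<in> T \<longrightarrow> (i', j') \<in> T \<longrightarrow> i \<le> i' \<longrightarrow> j' \<le> j \<longrightarrow>
      (\<forall>p q. i \<le> p \<longrightarrow> p \<le> i' \<longrightarrow> j' \<le> q \<longrightarrow> q \<le> j \<longrightarrow> (p, q) \<in> T))"

lemma ladder_convexD:
  "ladder_convex T \<Longrightarrow> (i, j) \<in> T \<Longrightarrow> (i', j') \<in> T \<Longrightarrow> i \<le> p \<Longrightarrow> p \<le> i' \<Longrightarrow> j' \<le> q \<Longrightarrow> q \<le> j \<Longrightarrow> (p, q) \<in> T"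
  unfolding ladder_convex_def by (meson order_trans)

section \<open>Degrees of monomials and enumeration of minors\<close>

lemma total_degree_superset:
  "finite A \<Longrightarrow> Poly_Mapping.keys m \<subseteq> A \<Longrightarrow> total_degree m = (\<Sum>x\<in>A. Poly_Mapping.lookup m x)"
  unfolding total_degree_def by (rule sum.mono_neutral_left) (auto simp: in_keys_iff)

lemma total_degree_add: "total_degree (m + n) = total_degree m + total_degree n"
proof -
  let ?A = "Poly_Mapping.keys m \<union> Poly_Mapping.keys n"
  have "finite ?A" by simp
  then show ?thesis
    using Poly_Mapping.keys_add[of m n] by (simp add: total_degree_superset[of ?A] lookup_add sum.distrib)
qed

lemma total_degree_0: "total_degree 0 = 0"
  by (simp add: total_degree_def)

lemma total_degree_single: "total_degree (Poly_Mapping.single x 1) = 1"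
  by (simp add: total_degree_def)

lemma total_degree_permutation_monomial: "total_degree (permutation_monomial \<rho> \<kappa> n \<pi>) = n"
proof -
  have "total_degree (\<Sum>i<k. Poly_Mapping.single (\<rho> i, \<kappa> (\<pi> i)) 1) = k" for k
    by (induction k) (simp_all add: total_degree_0 total_degree_add total_degree_single del: One_nat_def)
  then show ?thesis by (simp add: permutation_monomial_def)
qed

lemma finite_monomials_on_degree:
  assumes "finite L"
  shows "finite {m \<in> monomials_on L. total_degree m = d}" (is "finite ?F")
proof (rule finite_imageD)
  have "Poly_Mapping.lookup ` ?F \<subseteq> {f. \<forall>x. (x \<in> L \<longrightarrow> f x \<in> {..d}) \<and> (x \<notin> L \<longrightarrow> f x = 0)}"
  proof (intro subsetI CollectI allI)
    fix f x assume "f \<in> Poly_Mapping.lookup ` ?F"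
    then obtain m where m: "f = Poly_Mapping.lookup m" "Poly_Mapping.keys m \<subseteq> L" "total_degree m = d"
      by (auto simp: monomials_on_def)
    have "f x \<le> d" if "x \<in> L"
      using total_degree_superset[OF assms m(2)] m(1,3) member_le_sum[OF that, of f] assms by simp
    then show "(x \<in> L \<longrightarrow> f x \<in> {..d}) \<and> (x \<notin> L \<longrightarrow> f x = 0)"
      using m(1,2) by (auto simp: in_keys_iff)
  qed
  then show "finite (Poly_Mapping.lookup ` ?F)"
    by (rule finite_subset) (rule finite_set_of_finite_funs[OF assms finite_atMost])
  show "inj_on Poly_Mapping.lookup ?F" by (rule inj_onI) (simp only: lookup_inject)
qed

lemma sorted_list_of_set_strict_mono_image:
  fixes \<rho> :: "nat \<Rightarrow> nat"
  assumes "strict_mono_on {..<n} \<rho>"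
  shows "sorted_list_of_set (\<rho> ` {..<n}) = map \<rho> [0..<n]"
proof -
  have "sorted_wrt (<) (map \<rho> [0..<n])"
    using assms by (auto simp: sorted_wrt_iff_nth_less strict_mono_on_def)
  moreover have "set (map \<rho> [0..<n]) = \<rho> ` {..<n}" by auto
  ultimately show ?thesis by (metis sorted_list_of_set.idem_if_sorted_distinct strict_sorted_iff)
qed

lemma card_strict_mono_image: "strict_mono_on {..<n} (\<rho> :: nat \<Rightarrow> nat) \<Longrightarrow> card (\<rho> ` {..<n}) = n"
  by (simp add: card_image strict_mono_on_imp_inj_on)

lemma generic_minor_strict_mono:
  assumes "strict_mono_on {..<n} \<rho>" "strict_mono_on {..<n} \<kappa>"
  shows "generic_minor (\<rho> ` {..<n}) (\<kappa> ` {..<n}) = det (mat n n (\<lambda>(p, q). Var (\<rho> p, \<kappa> q)))"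
  unfolding generic_minor_def card_strict_mono_image[OF assms(1)] card_strict_mono_image[OF assms(2)]
    sorted_list_of_set_strict_mono_image[OF assms(1)] sorted_list_of_set_strict_mono_image[OF assms(2)]
  by (intro arg_cong[of _ _ det] eq_matI) auto

lemma finite_set_strict_mono_enum:
  assumes "finite I" "card I = n"
  obtains \<rho> :: "nat \<Rightarrow> nat" where "strict_mono_on {..<n} \<rho>" "I = \<rho> ` {..<n}"
proof
  let ?xs = "sorted_list_of_set I"
  have len: "length ?xs = n" using assms by simp
  show "strict_mono_on {..<n} ((!) ?xs)"
    using strict_sorted_list_of_set[of I] len by (auto simp: sorted_wrt_iff_nth_less intro: strict_mono_onI)
  show "I = (!) ?xs ` {..<n}"
    using assms(1) len by (metis nth_image order_refl set_sorted_list_of_set take_all atLeast0LessThan)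
qed

text \<open>Increasing enumerations of the rows and columns turn a minor into a determinant with
  explicit entries, to which the results on lowest monomials and on ranks apply.\<close>

lemma minor_positionsE:
  assumes "(I, J) \<in> minor_positions t T"
  obtains \<rho> \<kappa> where "strict_mono_on {..<t} \<rho>" "strict_mono_on {..<t} \<kappa>" "I = \<rho> ` {..<t}" "J = \<kappa> ` {..<t}"
    "\<And>p q. p < t \<Longrightarrow> q < t \<Longrightarrow> (\<rho> p, \<kappa> q) \<in> T"
    "generic_minor I J = det (mat t t (\<lambda>(p, q). Var (\<rho> p, \<kappa> q) :: 'k::field polynomial))"
proof -
  have IJ: "finite I" "card I = t" "finite J" "card J = t" "I \<times> J \<subseteq> T"
    using assms by (auto simp: minor_positions_def)
  obtain \<rho> where \<rho>: "strict_mono_on {..<t} \<rho>" "I = \<rho> ` {..<t}" by (rule finite_set_strict_mono_enum[OF IJ(1,2)])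
  obtain \<kappa> where \<kappa>: "strict_mono_on {..<t} \<kappa>" "J = \<kappa> ` {..<t}" by (rule finite_set_strict_mono_enum[OF IJ(3,4)])
  show thesis
    by (rule that[OF \<rho>(1) \<kappa>(1) \<rho>(2) \<kappa>(2)])
      (use IJ(5) \<rho> \<kappa> in \<open>auto intro: generic_minor_strict_mono\<close>)
qed

lemma minor_positionsI:
  assumes "strict_mono_on {..<t} \<rho>" "strict_mono_on {..<t} \<kappa>" "\<And>p q. p < t \<Longrightarrow> q < t \<Longrightarrow> (\<rho> p, \<kappa> q) \<in> T"
  shows "(\<rho> ` {..<t}, \<kappa> ` {..<t}) \<in> minor_positions t T"
  using assms by (auto simp: minor_positions_def card_strict_mono_image)

lemma carrier_det_Var:
  assumes "\<And>p q. p < n \<Longrightarrow> q < n \<Longrightarrow> (\<rho> p, \<kappa> q) \<in> L"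
  shows "det (mat n n (\<lambda>(p, q). Var (\<rho> p, \<kappa> q))) \<in> carrier (poly_ring L :: 'k::field polynomial ring)"
  using assms by (intro carrier_det[of _ n]) (auto intro: carrier_Var)

lemma generators_in_carrier:
  assumes "T \<subseteq> L"
  shows "(\<lambda>(I, J). generic_minor I J) ` minor_positions t T \<subseteq> carrier (poly_ring L :: 'k::field polynomial ring)"
proof
  fix x :: "'k polynomial" assume "x \<in> (\<lambda>(I, J). generic_minor I J) ` minor_positions t T"
  then obtain I J where IJ: "(I, J) \<in> minor_positions t T" "x = generic_minor I J" by auto
  show "x \<in> carrier (poly_ring L)"
    by (rule minor_positionsE[OF IJ(1), where ?'k = 'k]) (use IJ(2) assms in \<open>auto intro!: carrier_det_Var\<close>)
qed

lemma ideal_ladder_ideal: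
  assumes "T \<subseteq> L"
  shows "ideal (ladder_ideal L t T) (poly_ring L :: 'k::field polynomial ring)"
proof -
  interpret R: cring "poly_ring L :: 'k polynomial ring" by (rule cring_poly_ring)
  show ?thesis unfolding ladder_ideal_def by (rule R.genideal_ideal[OF generators_in_carrier[OF assms]])
qed

lemma generic_minor_in_ladder_ideal:
  assumes "T \<subseteq> L" "(I, J) \<in> minor_positions t T"
  shows "(generic_minor I J :: 'k::field polynomial) \<in> ladder_ideal L t T"
proof -
  interpret R: cring "poly_ring L :: 'k polynomial ring" by (rule cring_poly_ring)
  show ?thesis unfolding ladder_ideal_def
    using R.genideal_self[OF generators_in_carrier[OF assms(1)]] assms(2) by fast
qed

lemma ladder_ideal_minimal:
  assumes "ideal K (poly_ring L)"
    "\<And>I J. (I, J) \<in> minor_positions t T \<Longrightarrow> (generic_minor I J :: 'k::field polynomial) \<in> K"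
  shows "ladder_ideal L t T \<subseteq> K"
proof -
  interpret R: cring "poly_ring L :: 'k polynomial ring" by (rule cring_poly_ring)
  show ?thesis unfolding ladder_ideal_def by (rule R.genideal_minimal[OF assms(1)]) (use assms(2) in auto)
qed

lemma ladder_ideal_mono:
  assumes "T \<subseteq> T'" "T' \<subseteq> L"
  shows "(ladder_ideal L t T :: 'k::field polynomial set) \<subseteq> ladder_ideal L t T'"
  using assms by (intro ladder_ideal_minimal ideal_ladder_ideal generic_minor_in_ladder_ideal)
    (auto simp: minor_positions_def)

lemma ideal_rank_kernel:
  "ideal {h \<in> carrier (poly_ring L). subst g h = 0} (poly_ring L :: 'k::field polynomial ring)"
  by (rule ideal_poly_ringI) (auto simp: subst_add subst_mult intro: carrier_0 carrier_plus carrier_mult)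

lemma ladder_ideal_subset_kernel:
  assumes "T \<subseteq> L"
  shows "ladder_ideal L (Suc s) T \<subseteq> {h \<in> carrier (poly_ring L). subst (rank_gen T s) h = (0 :: _ \<Rightarrow>\<^sub>0 'k::field)}"
proof (rule ladder_ideal_minimal[OF ideal_rank_kernel])
  fix I J assume IJ: "(I, J) \<in> minor_positions (Suc s) T"
  obtain \<rho> \<kappa> where rk: "\<And>p q. p < Suc s \<Longrightarrow> q < Suc s \<Longrightarrow> (\<rho> p, \<kappa> q) \<in> T"
    "generic_minor I J = det (mat (Suc s) (Suc s) (\<lambda>(p, q). Var (\<rho> p, \<kappa> q) :: 'k polynomial))"
    by (rule minor_positionsE[OF IJ, where ?'k = 'k]) blast
  have "subst (rank_gen T s) (generic_minor I J) = (0 :: _ \<Rightarrow>\<^sub>0 'k)"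
    unfolding rk(2) using rk(1) by (intro subst_rank_gen_det[where e = 0 and \<rho> = \<rho> and \<kappa> = \<kappa>]) auto
  moreover have "generic_minor I J \<in> carrier (poly_ring L :: 'k polynomial ring)"
    using generators_in_carrier[OF assms] IJ by fast
  ultimately show "generic_minor I J \<in> {h \<in> carrier (poly_ring L). subst (rank_gen T s) h = (0 :: _ \<Rightarrow>\<^sub>0 'k)}" by simp
qed

section \<open>Straightening modulo the minors of a ladder\<close>

definition reducible :: "entry set \<Rightarrow> nat \<Rightarrow> entry set \<Rightarrow> 'k::field polynomial \<Rightarrow> bool" where
  "reducible L t T p \<longleftrightarrow> (\<exists>r\<in>carrier (poly_ring L). (\<forall>m\<in>Poly_Mapping.keys r. standard_monomial T t m) \<and>
    p - r \<in> ladder_ideal L t T)"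

lemma reducible_add:
  assumes "T \<subseteq> L" "reducible L t T p" "reducible L t T q"
  shows "reducible L t T (p + q)"
proof -
  obtain r r' where "r \<in> carrier (poly_ring L)" "\<forall>m\<in>Poly_Mapping.keys r. standard_monomial T t m"
      "p - r \<in> ladder_ideal L t T"
    "r' \<in> carrier (poly_ring L)" "\<forall>m\<in>Poly_Mapping.keys r'. standard_monomial T t m"
      "q - r' \<in> ladder_ideal L t T"
    using assms(2,3) by (auto simp: reducible_def)
  then show ?thesis
    unfolding reducible_def
    using Poly_Mapping.keys_add[of r r'] ideal_poly_ringD(3)[OF ideal_ladder_ideal[OF assms(1)], of "p - r" t "q - r'"]
    by (intro bexI[of _ "r + r'"]) (auto simp: algebra_simps intro: carrier_plus)
qed

lemma reducible_ideal: "T \<subseteq> L \<Longrightarrow> p \<in> ladder_ideal L t T \<Longrightarrow> reducible L t T p"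
  unfolding reducible_def by (rule bexI[of _ 0]) (auto intro: carrier_0)

lemma reducible_scale:
  fixes p :: "'k::field polynomial"
  assumes "T \<subseteq> L" "reducible L t T p"
  shows "reducible L t T (Poly_Mapping.single 0 c * p)"
proof -
  obtain r where r: "r \<in> carrier (poly_ring L)" "\<forall>m\<in>Poly_Mapping.keys r. standard_monomial T t m"
      "p - r \<in> ladder_ideal L t T"
    using assms(2) by (auto simp: reducible_def)
  have c: "Poly_Mapping.single 0 c \<in> carrier (poly_ring L)" by (rule carrier_single) (simp add: monomials_on_0)
  have "\<forall>m\<in>Poly_Mapping.keys (Poly_Mapping.single 0 c * r). standard_monomial T t m"
    using keys_mult[of "Poly_Mapping.single 0 c" r] r(2) by (fastforce split: if_splits)
  moreover have "Poly_Mapping.single 0 c * p - Poly_Mapping.single 0 c * r \<in> ladder_ideal L t T"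
    using ideal_poly_ringD(4)[OF ideal_ladder_ideal[OF assms(1)] r(3) c] by (simp add: algebra_simps)
  ultimately show ?thesis
    unfolding reducible_def using carrier_mult[OF c r(1)] by blast
qed

lemma reducible_by_keys:
  fixes p :: "'k::field polynomial"
  assumes "T \<subseteq> L" "\<And>m. m \<in> Poly_Mapping.keys p \<Longrightarrow> reducible L t T (Poly_Mapping.single m (1::'k::field))"
  shows "reducible L t T p"
proof -
  have 0: "reducible L t T (0 :: 'k polynomial)"
    by (rule reducible_ideal[OF assms(1) ideal_poly_ringD(2)[OF ideal_ladder_ideal[OF assms(1)]]])
  have "reducible L t T (\<Sum>m\<in>A. Poly_Mapping.single m (Poly_Mapping.lookup p m))"
    if "finite A" "A \<subseteq> Poly_Mapping.keys p" for A
    using that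
  proof (induction A rule: finite_induct)
    case (insert m A)
    have "reducible L t T (Poly_Mapping.single 0 (Poly_Mapping.lookup p m) * Poly_Mapping.single m 1)"
      using insert.prems by (intro reducible_scale assms) auto
    then have "reducible L t T (Poly_Mapping.single m (Poly_Mapping.lookup p m))"
      by (simp add: mult_single)
    then show ?case using insert by (simp add: reducible_add[OF assms(1)])
  qed (simp add: 0)
  then show ?thesis by (subst poly_mapping_expand) auto
qed

text \<open>A monomial m that is not standard is divisible by the antidiagonal product \<delta> of
  some t-minor D in \<open>T\<close>. Subtracting a scalar multiple of (m / \<delta>) D cancels m
  and leaves only larger monomials of the same degree. There are finitely many of each degree, so
  the number of larger ones decreases.\<close>

lemma reducible_monomial:
  fixes L T :: "entry set"
  assumes L: "finite L" and T: "T \<subseteq> L" "ladder_convex T"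
    and "m \<in> monomials_on L"
  shows "reducible L t T (Poly_Mapping.single m (1::'k::field))"
  using assms(4)
proof (induction m rule: measure_induct_rule[where
      f = "\<lambda>m. card {n \<in> monomials_on L. total_degree n = total_degree m \<and> m < n}"])
  case (less m)
  show ?case
  proof (cases "standard_monomial T t m")
    case True
    then show ?thesis
      unfolding reducible_def using ideal_poly_ringD(2)[OF ideal_ladder_ideal[OF T(1)]] less.prems
      by (intro bexI[of _ "Poly_Mapping.single m 1"]) (auto intro: carrier_single)
  next
    case False
    then obtain \<sigma> where \<sigma>: "antidiagonal_seq (Poly_Mapping.keys m \<inter> T) t \<sigma>"
      by (auto simp: standard_monomial_def)
    have \<sigma>mem: "\<sigma> p \<in> Poly_Mapping.keys m" "\<sigma> p \<in> T" if "p < t" for p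
      using \<sigma> that by (auto simp: antidiagonal_seq_def)
    have \<sigma>lt: "fst (\<sigma> p) < fst (\<sigma> q)" "snd (\<sigma> q) < snd (\<sigma> p)" if "p < q" "q < t" for p q
      using \<sigma> that by (auto simp: antidiagonal_seq_def)
    define \<rho> where "\<rho> p = fst (\<sigma> p)" for p
    \<comment> \<open>Columns decrease along \<open>\<sigma>\<close> and are read backwards to
      become increasing; the reversal permutation then recovers \<open>\<sigma>\<close>.\<close>
    define \<kappa> where "\<kappa> q = snd (\<sigma> (t - 1 - q))" for q
    define D :: "'k polynomial" where "D = det (mat t t (\<lambda>(p, q). Var (\<rho> p, \<kappa> q)))"
    define \<delta> where "\<delta> = permutation_monomial \<rho> \<kappa> t (\<lambda>i. t - 1 - i)"
    have \<rho>: "strict_mono_on {..<t} \<rho>" unfolding \<rho>_def by (rule strict_mono_onI) (use \<sigma>lt(1) in blast)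
    have \<kappa>: "strict_mono_on {..<t} \<kappa>"
    proof (rule strict_mono_onI)
      fix p q assume "p \<in> {..<t}" "q \<in> {..<t}" "p < q"
      then show "\<kappa> p < \<kappa> q" unfolding \<kappa>_def by (intro \<sigma>lt(2)) auto
    qed
    \<comment> \<open>Two members of \<open>\<sigma>\<close> are the north-east and south-west
      corners of a rectangle, which convexity fills; hence \<open>T\<close> contains the whole t by
      t grid.\<close>
    have box: "(fst (\<sigma> p), snd (\<sigma> q)) \<in> T" if "p < t" "q < t" for p q
    proof (cases "p \<le> q")
      case True
      then have "fst (\<sigma> p) \<le> fst (\<sigma> q)" "snd (\<sigma> q) \<le> snd (\<sigma> p)"
        using \<sigma>lt[of p q] that by (cases "p = q"; simp add: less_imp_le)+
      then show ?thesis using \<sigma>mem(2)[OF that(1)] \<sigma>mem(2)[OF that(2)]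
        by - (rule ladder_convexD[OF T(2), of "fst (\<sigma> p)" "snd (\<sigma> p)" "fst (\<sigma> q)" "snd (\<sigma> q)"], simp_all)
    next
      case False
      then have "fst (\<sigma> q) \<le> fst (\<sigma> p)" "snd (\<sigma> p) \<le> snd (\<sigma> q)"
        using \<sigma>lt[of q p] that by (cases "p = q"; simp add: less_imp_le)+
      then show ?thesis using \<sigma>mem(2)[OF that(1)] \<sigma>mem(2)[OF that(2)]
        by - (rule ladder_convexD[OF T(2), of "fst (\<sigma> q)" "snd (\<sigma> q)" "fst (\<sigma> p)" "snd (\<sigma> p)"], simp_all)
    qed
    have pos: "(\<rho> p, \<kappa> q) \<in> T" if "p < t" "q < t" for p q
      using box[of p "t - 1 - q"] that by (simp add: \<rho>_def \<kappa>_def)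
    have D: "D \<in> ladder_ideal L t T"
      using generic_minor_in_ladder_ideal[OF T(1) minor_positionsI[OF \<rho> \<kappa> pos], where ?'k = 'k]
      by (simp add: D_def generic_minor_strict_mono[OF \<rho> \<kappa>])
    have \<delta>_eq: "\<delta> = (\<Sum>i<t. Poly_Mapping.single (\<sigma> i) 1)"
      unfolding \<delta>_def permutation_monomial_def by (intro sum.cong refl) (auto simp: \<rho>_def \<kappa>_def)
    have \<delta>_le: "Poly_Mapping.lookup \<delta> x \<le> Poly_Mapping.lookup m x" for x
    proof (cases "\<exists>p<t. \<sigma> p = x")
      case True
      then obtain p where p: "p < t" "\<sigma> p = x" by blast
      have "\<sigma> i = x \<longleftrightarrow> i = p" if "i < t" for i
        using \<sigma>lt(1)[of i p] \<sigma>lt(1)[of p i] that p by (metis less_irrefl nat_neq_iff)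
      then have "Poly_Mapping.lookup \<delta> x = (\<Sum>i<t. if i = p then 1 else 0)"
        unfolding \<delta>_eq lookup_sum by (intro sum.cong refl) (auto simp: lookup_single when_def)
      also have "\<dots> = 1" using p by simp
      finally show ?thesis using \<sigma>mem(1)[OF p(1)] p(2) by (simp add: in_keys_iff)
    next
      case False
      then have "Poly_Mapping.lookup \<delta> x = 0" unfolding \<delta>_eq lookup_sum by (auto simp: lookup_single when_def)
      then show ?thesis by simp
    qed
    define m' where "m' = m - \<delta>"
    have m: "m = m' + \<delta>"
      by (rule poly_mapping_eqI) (simp add: m'_def lookup_add minus_poly_mapping.rep_eq \<delta>_le)
    have m'L: "m' \<in> monomials_on L" using less.prems m monomials_on_add_iff by metis
    define c where "c = inverse (Poly_Mapping.lookup D \<delta>)"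
    have low: "bounded_below \<delta> D" "Poly_Mapping.lookup D \<delta> \<in> {1, -1}"
      using det_Var_low[OF \<rho> \<kappa>, where ?'k = 'k] by (simp_all add: D_def \<delta>_def)
    have c: "c * Poly_Mapping.lookup D \<delta> = 1" using low(2) by (auto simp: c_def)
    define p where "p = Poly_Mapping.single m 1 - Poly_Mapping.single m' c * D"
    have "Poly_Mapping.lookup (Poly_Mapping.single m' c * D) m = 1"
      unfolding m using bounded_below_mult(2)[OF _ low(1), of m' "Poly_Mapping.single m' c"] c
      by (simp add: bounded_below_def)
    then have pm: "Poly_Mapping.lookup p m = 0" by (simp add: p_def lookup_minus)
    have keys_p: "n \<in> monomials_on L \<and> total_degree n = total_degree m \<and> m < n" if "n \<in> Poly_Mapping.keys p" for n
    proof -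
      have nm: "n \<noteq> m" using that pm by (auto simp: in_keys_iff)
      then have "n \<in> Poly_Mapping.keys (Poly_Mapping.single m' c * D)"
        using that by (auto simp: p_def in_keys_iff lookup_minus lookup_single when_def)
      then obtain a where a: "n = m' + a" "a \<in> Poly_Mapping.keys D"
        using keys_mult[of "Poly_Mapping.single m' c" D] by (auto split: if_splits)
      have "total_degree a = t" "total_degree \<delta> = t"
        using det_Var_keys[of a t \<rho> \<kappa>, where ?'k = 'k] a(2)
        by (auto simp: D_def \<delta>_def total_degree_permutation_monomial)
      moreover have "m \<le> n" using low(1) a by (auto simp: m bounded_below_def)
      moreover have "a \<in> monomials_on L"
        using a(2) ideal_poly_ringD(1)[OF ideal_ladder_ideal[OF T(1)]] D by (auto simp: poly_ring_sel)
      ultimately show ?thesis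
        using nm m'L a(1) by (auto simp: m total_degree_add monomials_on_add_iff)
    qed
    have "reducible L t T (Poly_Mapping.single n (1::'k))" if "n \<in> Poly_Mapping.keys p" for n
    proof (rule less.IH)
      note n = keys_p[OF that]
      show "n \<in> monomials_on L" using n by blast
      have "{n' \<in> monomials_on L. total_degree n' = total_degree n \<and> n < n'} \<subset>
          {n' \<in> monomials_on L. total_degree n' = total_degree m \<and> m < n'}"
        using n by (auto intro: less_trans)
      then show "card {n' \<in> monomials_on L. total_degree n' = total_degree n \<and> n < n'} <
          card {n' \<in> monomials_on L. total_degree n' = total_degree m \<and> m < n'}"
        by (rule psubset_card_mono[rotated])
          (rule finite_subset[OF _ finite_monomials_on_degree[OF L, of "total_degree m"]], auto)
    qed
    then have "reducible L t T p" by (rule reducible_by_keys[OF T(1)])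
    moreover have "Poly_Mapping.single m' c * D \<in> ladder_ideal L t T"
      by (rule ideal_poly_ringD(4)[OF ideal_ladder_ideal[OF T(1)] D carrier_single[OF m'L]])
    ultimately have "reducible L t T (p + Poly_Mapping.single m' c * D)"
      by (rule reducible_add[OF T(1) _ reducible_ideal[OF T(1)]])
    then show ?thesis by (simp add: p_def)
  qed
qed

text \<open>An element of the kernel is congruent modulo the minors to a standard polynomial, which
  again lies in the kernel and therefore is 0.\<close>

theorem ladder_ideal_eq_kernel:
  assumes "finite L" "T \<subseteq> L" "ladder_convex T"
  shows "ladder_ideal L (Suc s) T = {h \<in> carrier (poly_ring L). subst (rank_gen T s) h = (0 :: _ \<Rightarrow>\<^sub>0 'k::field)}"
proof (rule subset_antisym[OF ladder_ideal_subset_kernel[OF assms(2)]], rule subsetI)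
  fix h :: "'k polynomial" assume "h \<in> {h \<in> carrier (poly_ring L). subst (rank_gen T s) h = (0 :: _ \<Rightarrow>\<^sub>0 'k)}"
  then have h: "h \<in> carrier (poly_ring L)" "subst (rank_gen T s) h = 0" by auto
  have "reducible L (Suc s) T h"
  proof (rule reducible_by_keys[OF assms(2)])
    fix m assume "m \<in> Poly_Mapping.keys h"
    then have "m \<in> monomials_on L" using h(1) unfolding poly_ring_sel(1) by blast
    then show "reducible L (Suc s) T (Poly_Mapping.single m (1::'k))" by (rule reducible_monomial[OF assms])
  qed
  then obtain r where r: "\<forall>m\<in>Poly_Mapping.keys r. standard_monomial T (Suc s) m" "h - r \<in> ladder_ideal L (Suc s) T"
    unfolding reducible_def by blast
  have "subst (rank_gen T s) (h - r) = 0" using ladder_ideal_subset_kernel[OF assms(2)] r(2) by blast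
  then have "subst (rank_gen T s) r = 0" using h(2) by (simp add: subst_diff)
  then have "r = 0" using rank_subst_nonzero[of r T s] r(1) by blast
  then show "h \<in> ladder_ideal L (Suc s) T" using r(2) by simp
qed

section \<open>Cofactors of matrices of variables\<close>

text \<open>For injective \<rho> this is the signed cofactor in column \<open>q0\<close> of the row
  labelled \<open>i\<close>, and 0 if no row has that label. Sums over labels can therefore run over
  any finite set containing the rows.\<close>

definition unit_column_det :: "nat \<Rightarrow> (nat \<Rightarrow> nat) \<Rightarrow> (nat \<Rightarrow> nat) \<Rightarrow> nat \<Rightarrow> nat \<Rightarrow> 'k::field polynomial" where
  "unit_column_det n \<rho> \<kappa> q0 i =
    det (mat n n (\<lambda>(p, q). if q = q0 then if i = \<rho> p then 1 else 0 else Var (\<rho> p, \<kappa> q)))"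

text \<open>The sum is the determinant with column \<open>q0\<close> replaced by a copy of column
  \<open>q1\<close>; two columns coincide unless \<open>q1 = q0\<close>.\<close>

lemma sum_Var_unit_column_det:
  assumes "finite F" "\<And>p. p < n \<Longrightarrow> \<rho> p \<in> F" "q0 < n" "q1 < n"
  shows "(\<Sum>i\<in>F. Var (i, \<kappa> q1) * unit_column_det n \<rho> \<kappa> q0 i) =
    (if q1 = q0 then det (mat n n (\<lambda>(p, q). Var (\<rho> p, \<kappa> q))) else (0 :: 'k::field polynomial))"
proof -
  let ?M = "mat n n (\<lambda>(p, q). if q = q0 then Var (\<rho> p, \<kappa> q1) else Var (\<rho> p, \<kappa> q) :: 'k polynomial)"
  have "(\<Sum>i\<in>F. Var (i, \<kappa> q1) * unit_column_det n \<rho> \<kappa> q0 i) =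
      det (mat n n (\<lambda>(p, q). if q = q0 then \<Sum>i\<in>F. Var (i, \<kappa> q1) * (if i = \<rho> p then 1 else 0)
        else Var (\<rho> p, \<kappa> q) :: 'k polynomial))"
    unfolding unit_column_det_def by (rule det_column_sum[OF assms(3), symmetric])
  also have "\<dots> = det ?M"
  proof (intro arg_cong[of _ _ det] eq_matI)
    have "(\<Sum>i\<in>F. Var (i, \<kappa> q1) * (if i = \<rho> p then 1 else 0)) = (Var (\<rho> p, \<kappa> q1) :: 'k polynomial)" if "p < n" for p
    proof -
      have "(\<Sum>i\<in>F. Var (i, \<kappa> q1) * (if i = \<rho> p then 1 else 0)) =
          (\<Sum>i\<in>F. if i = \<rho> p then Var (\<rho> p, \<kappa> q1) else (0 :: 'k polynomial))"
        by (intro sum.cong) auto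
      then show ?thesis using assms(1,2) that by simp
    qed
    then show "mat n n (\<lambda>(p, q). if q = q0 then \<Sum>i\<in>F. Var (i, \<kappa> q1) * (if i = \<rho> p then 1 else 0)
        else Var (\<rho> p, \<kappa> q) :: 'k polynomial) $$ (i, j) = ?M $$ (i, j)"
      if "i < dim_row ?M" "j < dim_col ?M" for i j using that by simp
  qed auto
  also have "\<dots> = (if q1 = q0 then det (mat n n (\<lambda>(p, q). Var (\<rho> p, \<kappa> q))) else 0)"
  proof (cases "q1 = q0")
    case True
    then show ?thesis by (auto intro!: arg_cong[of _ _ det] eq_matI)
  next
    case False
    have "det ?M = 0"
      by (rule det_identical_columns[of _ n q0 q1]) (use assms(3,4) False in \<open>auto intro!: eq_vecI\<close>)
    then show ?thesis using False by simp
  qed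
  finally show ?thesis .
qed

lemma carrier_unit_column_det:
  assumes "\<And>p q. p < n \<Longrightarrow> q < n \<Longrightarrow> q \<noteq> q0 \<Longrightarrow> (\<rho> p, \<kappa> q) \<in> L"
  shows "unit_column_det n \<rho> \<kappa> q0 i \<in> carrier (poly_ring L :: 'k::field polynomial ring)"
  unfolding unit_column_det_def using assms
  by (intro carrier_det[of _ n]) (auto intro: carrier_Var carrier_0 carrier_1)

text \<open>The variable turns the unit column into a single entry of the generic matrix, so exactly
  the permutations through this entry survive, with their terms in the full determinant.\<close>

lemma Var_unit_column_det_expand:
  assumes "q0 < n"
  shows "Var (i, \<kappa> q0) * unit_column_det n \<rho> \<kappa> q0 i =
    (\<Sum>\<pi>\<in>{\<pi>. \<pi> permutes {0..<n} \<and> (\<exists>p<n. \<pi> p = q0 \<and> \<rho> p = i)}.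
      Poly_Mapping.single (permutation_monomial \<rho> \<kappa> n \<pi>) (signof \<pi> :: 'k::field))"
    (is "_ = sum ?m ?S")
proof -
  let ?A = "\<lambda>(p, q). if q = q0 then if i = \<rho> p then Var (i, \<kappa> q0) else 0 else Var (\<rho> p, \<kappa> q) :: 'k polynomial"
  have "Var (i, \<kappa> q0) * unit_column_det n \<rho> \<kappa> q0 i =
      (\<Sum>_\<in>{()}. Var (i, \<kappa> q0) * unit_column_det n \<rho> \<kappa> q0 i)" by simp
  also have "\<dots> = det (mat n n (\<lambda>(p, q). if q = q0 then \<Sum>_\<in>{()}. Var (i, \<kappa> q0) * (if i = \<rho> p then 1 else 0)
      else Var (\<rho> p, \<kappa> q) :: 'k polynomial))"
    unfolding unit_column_det_def by (rule det_column_sum[OF assms, symmetric])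
  also have "\<dots> = det (mat n n ?A)"
    by (intro arg_cong[of _ _ det] eq_matI) auto
  also have "\<dots> = (\<Sum>\<pi>\<in>{\<pi>. \<pi> permutes {0..<n}}. signof \<pi> * (\<Prod>p = 0..<n. ?A (p, \<pi> p)))"
    by (rule det_mat_sum_permutations)
  also have "\<dots> = sum ?m ?S"
  proof (rule sum.mono_neutral_cong_right)
    show "finite {\<pi>. \<pi> permutes {0..<n}}" by (simp add: finite_permutations)
    show "\<forall>\<pi>\<in>{\<pi>. \<pi> permutes {0..<n}} - ?S. signof \<pi> * (\<Prod>p = 0..<n. ?A (p, \<pi> p)) = 0"
    proof
      fix \<pi> assume \<pi>: "\<pi> \<in> {\<pi>. \<pi> permutes {0..<n}} - ?S"
      then have "q0 \<in> \<pi> ` {0..<n}" using permutes_image[of \<pi> "{0..<n}"] assms by auto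
      then obtain p where "p < n" "\<pi> p = q0" by auto
      moreover have "\<rho> p \<noteq> i" using \<pi> calculation by auto
      ultimately have "(\<Prod>p = 0..<n. ?A (p, \<pi> p)) = 0" by (intro prod_zero bexI[of _ p]) auto
      then show "signof \<pi> * (\<Prod>p = 0..<n. ?A (p, \<pi> p)) = 0" by simp
    qed
    fix \<pi> assume "\<pi> \<in> ?S"
    then obtain p where \<pi>: "\<pi> permutes {0..<n}" "p < n" "\<pi> p = q0" "\<rho> p = i" by auto
    have "p' = p" if "\<pi> p' = q0" for p' using that \<pi>(3) permutes_inj[OF \<pi>(1)] by (metis injD)
    then have "(\<Prod>p = 0..<n. ?A (p, \<pi> p)) = (\<Prod>p\<in>{0..<n}. Var (\<rho> p, \<kappa> (\<pi> p)))"
      using \<pi>(4) by (intro prod.cong refl) auto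
    then show "signof \<pi> * (\<Prod>p = 0..<n. ?A (p, \<pi> p)) = ?m \<pi>"
      by (simp add: prod_Var signof_single permutation_monomial_def atLeast0LessThan)
  qed auto
  finally show ?thesis .
qed

text \<open>The antidiagonal meets column \<open>q0\<close> in row \<open>n - 1 - q0\<close>, so
  among the parts of the determinant belonging to this column only that row carries the lowest
  monomial.\<close>

lemma Var_unit_column_det_low:
  fixes i :: nat
  assumes "strict_mono_on {..<n} \<rho>" "strict_mono_on {..<n} \<kappa>" "q0 < n"
  defines "\<delta> \<equiv> permutation_monomial \<rho> \<kappa> n (\<lambda>i. n - 1 - i)"
    and "h \<equiv> Var (i, \<kappa> q0) * unit_column_det n \<rho> \<kappa> q0 i :: 'k::field polynomial"
  shows "bounded_below \<delta> h"
    and "i = \<rho> (n - 1 - q0) \<Longrightarrow> Poly_Mapping.lookup h \<delta> \<in> {1, -1}"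
    and "i \<noteq> \<rho> (n - 1 - q0) \<Longrightarrow> Poly_Mapping.lookup h \<delta> = 0"
proof -
  let ?S = "{\<pi>. \<pi> permutes {0..<n} \<and> (\<exists>p<n. \<pi> p = q0 \<and> \<rho> p = i)}"
  let ?\<tau> = "\<lambda>i. if i < n then n - 1 - i else i"
  have S: "?S \<subseteq> {\<pi>. \<pi> permutes {0..<n}}" by auto
  have mem: "?\<tau> \<in> ?S \<longleftrightarrow> i = \<rho> (n - 1 - q0)"
  proof
    assume "?\<tau> \<in> ?S"
    then obtain p where "p < n" "n - 1 - p = q0" "\<rho> p = i" by auto
    moreover from this have "p = n - 1 - q0" by simp
    ultimately show "i = \<rho> (n - 1 - q0)" by simp
  next
    assume "i = \<rho> (n - 1 - q0)"
    then show "?\<tau> \<in> ?S" using reverse_permutes[of n] assms(3) by (auto intro!: exI[of _ "n - 1 - q0"])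
  qed
  note low = sum_permutation_monomials_low[OF assms(1,2) S, where ?'k = 'k]
  show "bounded_below \<delta> h"
    unfolding h_def \<delta>_def Var_unit_column_det_expand[OF assms(3)] by (rule low(1))
  have *: "Poly_Mapping.lookup h \<delta> = (if ?\<tau> \<in> ?S then signof ?\<tau> else 0)"
    unfolding h_def \<delta>_def Var_unit_column_det_expand[OF assms(3)] by (rule low(2))
  show "i = \<rho> (n - 1 - q0) \<Longrightarrow> Poly_Mapping.lookup h \<delta> \<in> {1, -1}"
    unfolding * mem by (simp add: sign_def)
  show "i \<noteq> \<rho> (n - 1 - q0) \<Longrightarrow> Poly_Mapping.lookup h \<delta> = 0"
    unfolding * mem by simp
qed

text \<open>At the sum of the \<open>\<delta> k\<close> each permutation contributes, up to sign,
  the product of the coefficients of its entries at \<open>\<delta> k\<close>. Every permutation but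
  the identity meets an off-diagonal entry, whose coefficient is 0.\<close>

lemma det_nonzero_by_low:
  fixes E :: "nat \<Rightarrow> nat \<Rightarrow> 'k::field polynomial"
  assumes low: "\<And>k k'. k < m \<Longrightarrow> k' < m \<Longrightarrow> bounded_below (\<delta> k) (E k k')"
    and diag: "\<And>k. k < m \<Longrightarrow> Poly_Mapping.lookup (E k k) (\<delta> k) \<noteq> 0"
    and off: "\<And>k k'. k < m \<Longrightarrow> k' < m \<Longrightarrow> k \<noteq> k' \<Longrightarrow> Poly_Mapping.lookup (E k k') (\<delta> k) = 0"
  shows "det (mat m m (\<lambda>(k, k'). E k k')) \<noteq> 0"
proof
  assume zero: "det (mat m m (\<lambda>(k, k'). E k k')) = 0"
  let ?\<delta> = "\<Sum>k = 0..<m. \<delta> k"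
  have look: "Poly_Mapping.lookup (signof \<pi> * (\<Prod>k = 0..<m. E k (\<pi> k))) ?\<delta> =
      (if \<pi> = id then \<Prod>k = 0..<m. Poly_Mapping.lookup (E k k) (\<delta> k) else 0)" if \<pi>: "\<pi> permutes {0..<m}" for \<pi>
  proof -
    have \<pi>m: "\<pi> k < m" if "k < m" for k using permutes_in_image[OF \<pi>, of k] that by auto
    have "Poly_Mapping.lookup (\<Prod>k = 0..<m. E k (\<pi> k)) ?\<delta> = (\<Prod>k = 0..<m. Poly_Mapping.lookup (E k (\<pi> k)) (\<delta> k))"
      using bounded_below_prod[of "{0..<m}" \<delta> "\<lambda>k. E k (\<pi> k)"] low \<pi>m by simp
    moreover have "\<dots> = 0" if ne: "\<pi> \<noteq> id"
    proof -
      obtain k where "\<pi> k \<noteq> k" using ne by fastforce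
      moreover have "k < m" using permutes_not_in[OF \<pi>, of k] calculation by auto
      ultimately show ?thesis using off[of k "\<pi> k"] \<pi>m by (intro prod_zero bexI[of _ k]) auto
    qed
    ultimately show ?thesis by (auto simp: sign_def sign_id)
  qed
  have "Poly_Mapping.lookup (det (mat m m (\<lambda>(k, k'). E k k'))) ?\<delta> =
      (\<Sum>\<pi>\<in>{\<pi>. \<pi> permutes {0..<m}}. if \<pi> = id then \<Prod>k = 0..<m. Poly_Mapping.lookup (E k k) (\<delta> k) else 0)"
    unfolding det_mat_sum_permutations lookup_sum using look by (intro sum.cong refl) auto
  also have "\<dots> = (\<Prod>k = 0..<m. Poly_Mapping.lookup (E k k) (\<delta> k))"
    by (subst sum.delta) (auto simp: finite_permutations permutes_id)
  also have "\<dots> \<noteq> 0" using diag by simp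
  finally show False using zero by simp
qed

lemma det_scale_columns:
  fixes A :: "nat \<Rightarrow> nat \<Rightarrow> 'r::comm_ring_1"
  shows "det (mat m m (\<lambda>(k, k'). x k' * A k k')) = (\<Prod>k<m. x k) * det (mat m m (\<lambda>(k, k'). A k k'))"
  unfolding det_col[OF mat_carrier] sum_distrib_left
proof (intro sum.cong refl)
  fix \<pi> assume "\<pi> \<in> {\<pi>. \<pi> permutes {0..<m}}"
  then have "\<pi> k < m" if "k < m" for k using permutes_in_image[of \<pi> "{0..<m}" k] that by auto
  then show "signof \<pi> * (\<Prod>j<m. mat m m (\<lambda>(k, k'). x k' * A k k') $$ (\<pi> j, j)) =
      (\<Prod>k<m. x k) * (signof \<pi> * (\<Prod>j<m. mat m m (\<lambda>(k, k'). A k k') $$ (\<pi> j, j)))"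
    by (simp add: prod.distrib mult_ac)
qed

text \<open>Multiplying z A = 0 by the adjugate gives det(A) z = 0, and det(A) cancels in a
  domain.\<close>

lemma left_kernel_trivial:
  fixes A :: "nat \<Rightarrow> nat \<Rightarrow> 'r::idom"
  assumes "det (mat n n (\<lambda>(p, q). A p q)) \<noteq> 0" "\<And>q. q < n \<Longrightarrow> (\<Sum>p<n. z p * A p q) = 0" "p < n"
  shows "z p = 0"
proof -
  let ?M = "mat n n (\<lambda>(p, q). A p q)"
  have adj: "(\<Sum>q<n. A p' q * adj_mat ?M $$ (q, p)) = (if p' = p then det ?M else 0)" if "p' < n" for p'
  proof -
    have "(\<Sum>q<n. A p' q * adj_mat ?M $$ (q, p)) = (?M * adj_mat ?M) $$ (p', p)"
      using that assms(3) adj_mat(1)[of ?M n] by (simp add: scalar_prod_def atLeast0LessThan)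
    also have "\<dots> = (det ?M \<cdot>\<^sub>m 1\<^sub>m n) $$ (p', p)" by (subst adj_mat(2)) auto
    also have "\<dots> = (if p' = p then det ?M else 0)" using that assms(3) by simp
    finally show ?thesis .
  qed
  have "z p * det ?M = (\<Sum>p'<n. z p' * (if p' = p then det ?M else 0))"
    using assms(3) by (simp add: if_distrib cong: if_cong)
  also have "\<dots> = (\<Sum>p'<n. z p' * (\<Sum>q<n. A p' q * adj_mat ?M $$ (q, p)))"
    using adj by (intro sum.cong) auto
  also have "\<dots> = (\<Sum>q<n. (\<Sum>p'<n. z p' * A p' q) * adj_mat ?M $$ (q, p))"
    unfolding sum_distrib_left sum_distrib_right by (subst sum.swap) (simp add: mult_ac)
  also have "\<dots> = 0" using assms(2) by simp
  finally show ?thesis using assms(1) by simp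
qed

lemma carrier_adj_mat:
  assumes "A \<in> carrier_mat n n" "\<And>i j. i < n \<Longrightarrow> j < n \<Longrightarrow> A $$ (i, j) \<in> carrier (poly_ring L :: 'k::field polynomial ring)"
    "i < n" "j < n"
  shows "adj_mat A $$ (i, j) \<in> carrier (poly_ring L)"
proof -
  have power: "(- 1) ^ e \<in> carrier (poly_ring L :: 'k polynomial ring)" for e
    by (induction e) (use carrier_1 carrier_uminus[OF carrier_1] carrier_uminus in auto)
  have "mat_delete A j i $$ (p, q) \<in> carrier (poly_ring L)" if "p < n - 1" "q < n - 1" for p q
    using assms that by (auto simp: mat_delete_def)
  then have "det (mat_delete A j i) \<in> carrier (poly_ring L)"
    by (rule carrier_det[OF mat_delete_carrier[OF assms(1)]])
  then show ?thesis
    using assms(1,3,4) power by (simp add: adj_mat_def cofactor_def carrier_mult)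
qed

lemma standard_monomial_total_degree:
  assumes "total_degree m < t"
  shows "standard_monomial T t m"
  unfolding standard_monomial_def
proof (intro allI notI)
  fix \<sigma> assume \<sigma>: "antidiagonal_seq (Poly_Mapping.keys m \<inter> T) t \<sigma>"
  have "inj_on \<sigma> {..<t}"
  proof (rule inj_onI, rule ccontr)
    fix p q assume "p \<in> {..<t}" "q \<in> {..<t}" "\<sigma> p = \<sigma> q" "p \<noteq> q"
    then show False using \<sigma> unfolding antidiagonal_seq_def by (metis lessThan_iff less_irrefl nat_neq_iff)
  qed
  then have "t = card (\<sigma> ` {..<t})" by (simp add: card_image)
  also have "\<dots> \<le> card (Poly_Mapping.keys m)"
    using \<sigma> by (intro card_mono) (auto simp: antidiagonal_seq_def)
  also have "\<dots> \<le> total_degree m"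
    unfolding total_degree_def card_eq_sum by (intro sum_mono) (simp add: in_keys_iff)
  finally show False using assms by simp
qed

section \<open>Column windows of a ladder\<close>

definition block_minor :: "nat \<Rightarrow> nat \<Rightarrow> nat \<Rightarrow> 'k::field polynomial" where
  "block_minor \<alpha> \<gamma> n = det (mat n n (\<lambda>(p, q). Var (\<alpha> + p, \<gamma> + q)))"

text \<open>
  The family \<open>K\<close> abstracts from Knutson ideals, which makes it possible to transpose it. For
  \<open>r \<in> D\<close> the square block with first row \<open>\<alpha> r\<close>, first column \<open>\<gamma> r\<close> and size \<open>n r\<close>
  has its antidiagonal on \<open>i + j = r\<close>.
\<close>

locale ladder_blocks =
  fixes L :: "entry set" and s :: nat and K :: "'k::field polynomial set set"
    and D :: "nat set" and \<alpha> \<gamma> n :: "nat \<Rightarrow> nat"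
  assumes finite_L: "finite L" and convex_L: "ladder_convex L"
    and K_ideal: "I \<in> K \<Longrightarrow> ideal I (poly_ring L)"
    and K_colon: "I \<in> K \<Longrightarrow> g \<in> carrier (poly_ring L) \<Longrightarrow> {x \<in> carrier (poly_ring L). x * g \<in> I} \<in> K"
    and K_sum: "I \<in> K \<Longrightarrow> J \<in> K \<Longrightarrow> I <+>\<^bsub>poly_ring L\<^esub> J \<in> K"
    and block_subset: "r \<in> D \<Longrightarrow> p < n r \<Longrightarrow> q < n r \<Longrightarrow> (\<alpha> r + p, \<gamma> r + q) \<in> L"
    and block_antidiagonal: "r \<in> D \<Longrightarrow> \<alpha> r + \<gamma> r + n r = Suc r"
    and block_covers: "(i + s, a) \<in> L \<Longrightarrow> (i, a + s) \<in> L \<Longrightarrow>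
      i + s + a \<in> D \<and> \<gamma> (i + s + a) \<le> a \<and> a + s < \<gamma> (i + s + a) + n (i + s + a)"
    and block_ideal: "r \<in> D \<Longrightarrow> PIdl\<^bsub>poly_ring L\<^esub> (block_minor (\<alpha> r) (\<gamma> r) (n r)) \<in> K"
begin

abbreviation "W \<equiv> column_part L"
abbreviation "I_W a b \<equiv> ladder_ideal L (Suc s) (column_part L a b) :: 'k polynomial set"

lemma W_subset: "W a b \<subseteq> L"
  by (auto simp: column_part_def)

lemma W_convex: "ladder_convex (W a b)"
  unfolding ladder_convex_def
proof (intro allI impI)
  fix i j i' j' p q
  assume "(i, j) \<in> W a b" "(i', j') \<in> W a b" "i \<le> p" "p \<le> i'" "j' \<le> q" "q \<le> j"
  then show "(p, q) \<in> W a b"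
    using ladder_convexD[OF convex_L, of i j i' j' p q] by (simp add: column_part_def)
qed

lemmas I_W_kernel = ladder_ideal_eq_kernel[OF finite_L W_subset W_convex]

lemma colon_ladder_ideal:
  fixes g :: "'k polynomial"
  assumes T: "T \<subseteq> L" "ladder_convex T"
    and "Q \<in> K" "Q \<subseteq> ladder_ideal L (Suc s) T"
    and g: "g \<in> carrier (poly_ring L)" "subst (rank_gen T s) g \<noteq> 0"
    and minors: "\<And>I J. (I, J) \<in> minor_positions (Suc s) T \<Longrightarrow> g * generic_minor I J \<in> Q"
  shows "ladder_ideal L (Suc s) T \<in> K"
proof -
  let ?C = "{x \<in> carrier (poly_ring L). x * g \<in> Q}"
  have C: "?C \<in> K" by (rule K_colon[OF assms(3) g(1)])
  have "ladder_ideal L (Suc s) T \<subseteq> ?C"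
  proof (rule ladder_ideal_minimal[OF K_ideal[OF C]])
    fix I J assume IJ: "(I, J) \<in> minor_positions (Suc s) T"
    then have "(generic_minor I J :: 'k polynomial) \<in> carrier (poly_ring L)"
      using generators_in_carrier[OF T(1)] by fast
    then show "generic_minor I J \<in> ?C" using minors[OF IJ] by (simp add: mult.commute)
  qed
  moreover have "?C \<subseteq> ladder_ideal L (Suc s) T"
  proof
    fix x assume "x \<in> ?C"
    then have x: "x \<in> carrier (poly_ring L)" "x * g \<in> ladder_ideal L (Suc s) T" using assms(4) by auto
    then have "subst (rank_gen T s) x * subst (rank_gen T s) g = (0 :: _ \<Rightarrow>\<^sub>0 'k)"
      using ladder_ideal_subset_kernel[OF T(1)] by (auto simp flip: subst_mult)
    then show "x \<in> ladder_ideal L (Suc s) T"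
      using g(2) x(1) unfolding ladder_ideal_eq_kernel[OF finite_L T] by simp
  qed
  ultimately show ?thesis using C by simp
qed

text \<open>The kernel description replaces a Laplace expansion along the s + 1 columns inside the
  window. The other columns may leave the window, and columns may repeat or be unordered.\<close>

lemma det_Var_in_I_W:
  assumes "e + s < m" "\<And>p q. p < m \<Longrightarrow> q < m \<Longrightarrow> (\<rho> p, \<kappa> q) \<in> L"
    "\<And>q. e \<le> q \<Longrightarrow> q \<le> e + s \<Longrightarrow> a \<le> \<kappa> q \<and> \<kappa> q \<le> b"
  shows "det (mat m m (\<lambda>(p, q). Var (\<rho> p, \<kappa> q))) \<in> I_W a b"
  unfolding I_W_kernel
proof (intro CollectI conjI carrier_det_Var)
  show "subst (rank_gen (W a b) s) (det (mat m m (\<lambda>(p, q). Var (\<rho> p, \<kappa> q) :: 'k polynomial))) = 0"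
    by (rule subst_rank_gen_det[where e = e and \<rho> = \<rho> and \<kappa> = \<kappa>, OF assms(1)])
      (use assms in \<open>auto simp: column_part_def\<close>)
qed (rule assms(2))

subsection \<open>Windows of minimal width\<close>

text \<open>\<open>Q\<close> is the ideal generated by the chosen block minors. It is built from
  binary sums in \<open>K\<close>, which start from at least one principal ideal.\<close>

lemma sum_of_block_ideals:
  fixes m :: nat
  assumes "m > 0" "\<And>k. k < m \<Longrightarrow> r k \<in> D"
  shows "\<exists>Q\<in>K. (\<forall>k<m. block_minor (\<alpha> (r k)) (\<gamma> (r k)) (n (r k)) \<in> Q) \<and>
    (\<forall>I. ideal I (poly_ring L) \<longrightarrow> (\<forall>k<m. block_minor (\<alpha> (r k)) (\<gamma> (r k)) (n (r k)) \<in> I) \<longrightarrow> Q \<subseteq> I)"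
  using assms
proof (induction m)
  case (Suc m)
  let ?d = "\<lambda>k. block_minor (\<alpha> (r k)) (\<gamma> (r k)) (n (r k)) :: 'k polynomial"
  let ?P = "PIdl\<^bsub>poly_ring L\<^esub> (?d m)"
  have P: "?P \<in> K" using Suc.prems by (intro block_ideal) auto
  have d: "?d m \<in> carrier (poly_ring L)"
    unfolding block_minor_def using block_subset[OF Suc.prems(2)[of m]] by (intro carrier_det_Var) auto
  have dP: "?d m \<in> ?P" unfolding PIdl_poly_ring[OF d] using carrier_1[of L] by force
  have Pmin: "?P \<subseteq> I" if "ideal I (poly_ring L)" "?d m \<in> I" for I
    unfolding PIdl_poly_ring[OF d] using ideal_poly_ringD(4)[OF that] by blast
  show ?case
  proof (cases "m = 0")
    case True
    then show ?thesis using P dP Pmin by (intro bexI[of _ ?P]) auto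
  next
    case False
    then obtain Q where Q: "Q \<in> K" "\<And>k. k < m \<Longrightarrow> ?d k \<in> Q"
        "\<And>I. ideal I (poly_ring L) \<Longrightarrow> (\<And>k. k < m \<Longrightarrow> ?d k \<in> I) \<Longrightarrow> Q \<subseteq> I"
      using Suc by (metis less_SucI neq0_conv)
    note mem = mem_add_ideals[OF K_ideal[OF Q(1)] K_ideal[OF P]]
    show ?thesis
    proof (intro bexI[OF _ K_sum[OF Q(1) P]] conjI allI impI)
      fix k assume "k < Suc m"
      then show "?d k \<in> Q <+>\<^bsub>poly_ring L\<^esub> ?P" using mem Q(2) dP by (cases "k = m") auto
    next
      fix I :: "'k polynomial set" assume I: "ideal I (poly_ring L)" "\<forall>k<Suc m. ?d k \<in> I"
      then have "Q \<subseteq> I" "?P \<subseteq> I" using Q(3)[OF I(1)] Pmin by auto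
      then show "Q <+>\<^bsub>poly_ring L\<^esub> ?P \<subseteq> I"
        unfolding add_ideals_poly_ring using ideal_poly_ringD(3)[OF I(1)] by blast
    qed
  qed
qed simp

lemma full_rows_interval:
  assumes "F = {i. (i, a) \<in> L \<and> (i, b) \<in> L}" "a \<le> b" "i \<in> F" "i' \<in> F" "i \<le> x" "x \<le> i'"
  shows "x \<in> F"
  using assms ladder_convexD[OF convex_L, of i b i' a x] by auto

lemma finite_full_rows: "finite {i. (i, a) \<in> L \<and> (i, b) \<in> L}"
  by (rule finite_subset[of _ "fst ` L"]) (use finite_L in \<open>auto intro: rev_image_eqI\<close>)

lemma row_segment_in_L: "(i, a) \<in> L \<Longrightarrow> (i, b) \<in> L \<Longrightarrow> a \<le> j \<Longrightarrow> j \<le> b \<Longrightarrow> (i, j) \<in> L"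
  by (rule ladder_convexD[OF convex_L, of i b i a]) auto

text \<open>
  Cramer's rule: the determinant \<open>g\<close> of the matrix of cofactors \<open>J\<close> along the first column of the window multiplies
  every maximal minor of the window into the ideal generated by the block minors.
\<close>

theorem minimal_window:
  assumes ne: "minor_positions (Suc s) (W a (a + s)) \<noteq> {}"
  shows "I_W a (a + s) \<in> K"
proof -
  define F where "F = {i. (i, a) \<in> L \<and> (i, a + s) \<in> L}"
  have finF: "finite F" unfolding F_def by (rule finite_full_rows)
  have FL: "(i, j) \<in> L" if "i \<in> F" "a \<le> j" "j \<le> a + s" for i j
    using that row_segment_in_L[of i a "a + s" j] by (auto simp: F_def)
  \<comment> \<open>A minor of size s + 1 in s + 1 columns uses all of them, so only its rows vary,
    and these cross the whole window.\<close>
  have minorE: "\<exists>\<rho>. (\<forall>p<Suc s. \<rho> p \<in> F) \<and> inj_on \<rho> {..<Suc s} \<and>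
      generic_minor I J = det (mat (Suc s) (Suc s) (\<lambda>(p, q). Var (\<rho> p, a + q) :: 'k polynomial))"
    if IJ: "(I, J) \<in> minor_positions (Suc s) (W a (a + s))" for I J
  proof (rule minor_positionsE[OF IJ, where ?'k = 'k])
    fix \<rho> \<kappa> assume rk: "strict_mono_on {..<Suc s} \<rho>" "strict_mono_on {..<Suc s} \<kappa>" "J = \<kappa> ` {..<Suc s}"
      "\<And>p q. p < Suc s \<Longrightarrow> q < Suc s \<Longrightarrow> (\<rho> p, \<kappa> q) \<in> W a (a + s)"
      "generic_minor I J = det (mat (Suc s) (Suc s) (\<lambda>(p, q). Var (\<rho> p, \<kappa> q) :: 'k polynomial))"
    have "J \<subseteq> {a..a + s}" using rk(3) rk(4)[of 0] by (auto simp: column_part_def)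
    moreover have "card J = Suc s" unfolding rk(3) by (rule card_strict_mono_image[OF rk(2)])
    ultimately have J: "J = {a..a + s}" by (intro card_subset_eq) auto
    have shift: "(\<lambda>q. a + q) ` {..<Suc s} = {a..a + s}"
      by (auto simp: image_iff Bex_def) presburger
    have "map \<kappa> [0..<Suc s] = map (\<lambda>q. a + q) [0..<Suc s]"
      using sorted_list_of_set_strict_mono_image[OF rk(2)]
        sorted_list_of_set_strict_mono_image[of "Suc s" "\<lambda>q. a + q"] rk(3) J shift
      by (simp add: strict_mono_on_def)
    then have \<kappa>: "\<kappa> q = a + q" if "q < Suc s" for q using that by (metis add_0 nth_map_upt diff_zero)
    have "\<rho> p \<in> F" if "p < Suc s" for p
      using rk(4)[OF that, of 0] rk(4)[OF that, of s] \<kappa>[of 0] \<kappa>[of s] by (auto simp: F_def column_part_def)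
    moreover have "det (mat (Suc s) (Suc s) (\<lambda>(p, q). Var (\<rho> p, \<kappa> q) :: 'k polynomial)) =
        det (mat (Suc s) (Suc s) (\<lambda>(p, q). Var (\<rho> p, a + q)))"
      using \<kappa> by (intro arg_cong[of _ _ det] eq_matI) auto
    ultimately show ?thesis using rk(1,5) strict_mono_on_imp_inj_on by metis
  qed
  obtain I J where "(I, J) \<in> minor_positions (Suc s) (W a (a + s))" using ne by auto
  from minorE[OF this] obtain \<rho>0 where "\<forall>p<Suc s. \<rho>0 p \<in> F" "inj_on \<rho>0 {..<Suc s}" by blast
  then have "card (\<rho>0 ` {..<Suc s}) = Suc s" "\<rho>0 ` {..<Suc s} \<subseteq> F" by (auto simp: card_image)
  then have cardF: "Suc s \<le> card F" using card_mono[OF finF] by metis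
  then have F_ne: "F \<noteq> {}" by auto
  define i0 where "i0 = Min F"
  define i1 where "i1 = Max F"
  have i01: "i0 \<in> F" "i1 \<in> F" using F_ne finF by (auto simp: i0_def i1_def)
  have F_eq: "F = {i0..i1}"
  proof
    show "F \<subseteq> {i0..i1}" using finF by (auto simp: i0_def i1_def)
    show "{i0..i1} \<subseteq> F" using full_rows_interval[OF F_def _ i01] by auto
  qed
  \<comment> \<open>The antidiagonals with s + 1 positions in the full rows number \<open>m\<close>.
    \<open>B k\<close> is the row where the k-th of them meets column \<open>a\<close>; the s rows
    from \<open>i0\<close> to \<open>i0 + s - 1\<close> are left over.\<close>
  define m where "m = Suc i1 - (i0 + s)"
  have m: "m > 0" "i0 + s + m = Suc i1" using cardF by (auto simp: m_def F_eq)
  define B where "B k = i0 + s + k" for k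
  define r where "r k = B k + a" for k
  define d where "d k = (block_minor (\<alpha> (r k)) (\<gamma> (r k)) (n (r k)) :: 'k polynomial)" for k
  \<comment> \<open>The offset of column \<open>a\<close> in the k-th block; \<open>cover\<close>
    shows that the subtraction does not truncate.\<close>
  define e where "e k = a - \<gamma> (r k)" for k
  have cover: "r k \<in> D" "\<gamma> (r k) + e k = a" "e k + s < n (r k)" if "k < m" for k
  proof -
    have "i0 + k \<in> F" "i0 + k + s \<in> F" using that m by (auto simp: F_eq)
    then have "i0 + k + s + a \<in> D \<and> \<gamma> (i0 + k + s + a) \<le> a \<and> a + s < \<gamma> (i0 + k + s + a) + n (i0 + k + s + a)"
      by (intro block_covers) (auto simp: F_def)
    moreover have "i0 + k + s + a = r k" by (simp add: r_def B_def)
    ultimately show "r k \<in> D" "\<gamma> (r k) + e k = a" "e k + s < n (r k)" by (auto simp: e_def)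
  qed
  \<comment> \<open>A block contains all columns of the window, so each of its rows is full, even
    when the block is wider than the window.\<close>
  have rowsF: "\<alpha> (r k) + p \<in> F" if "k < m" "p < n (r k)" for k p
    using block_subset[OF cover(1)[OF that(1)] that(2), of "e k"]
      block_subset[OF cover(1)[OF that(1)] that(2), of "e k + s"] cover(2,3)[OF that(1)]
    by (simp add: F_def flip: add.assoc)
  have d_det: "d k = det (mat (n (r k)) (n (r k)) (\<lambda>(p, q). Var (\<alpha> (r k) + p, \<gamma> (r k) + q)))" for k
    by (simp add: d_def block_minor_def)
  have dI: "d k \<in> I_W a (a + s)" if "k < m" for k
    unfolding d_det using cover(2)[OF that] block_subset[OF cover(1)[OF that]]
    by (intro det_Var_in_I_W[OF cover(3)[OF that]]) auto
  define J where "J k i = (unit_column_det (n (r k)) (\<lambda>p. \<alpha> (r k) + p) (\<lambda>q. \<gamma> (r k) + q) (e k) i :: 'k polynomial)" for k i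
  have J_rel: "(\<Sum>i\<in>F. Var (i, a + j) * J k i) = (if j = 0 then d k else 0)" if "k < m" "j \<le> s" for k j
    using sum_Var_unit_column_det[OF finF, of "n (r k)" "\<lambda>p. \<alpha> (r k) + p" "e k" "e k + j" "\<lambda>q. \<gamma> (r k) + q", where ?'k = 'k]
      rowsF[OF that(1)] cover(2,3)[OF that(1)] that(2)
    by (simp add: J_def d_det flip: add.assoc)
  \<comment> \<open>Cofactors along column \<open>a\<close> contain no variable of that column; the
    smaller ring records this property for \<open>g\<close>.\<close>
  let ?L' = "{x \<in> L. snd x \<noteq> a}"
  have J_car': "J k i \<in> carrier (poly_ring ?L')" if "k < m" for k i
    unfolding J_def using cover(2)[OF that] block_subset[OF cover(1)[OF that]]
    by (intro carrier_unit_column_det) auto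
  have L'_car: "x \<in> carrier (poly_ring L)" if "x \<in> carrier (poly_ring ?L')" for x :: "'k polynomial"
    using carrier_mono[of ?L' L] that by auto
  define JB where "JB = mat m m (\<lambda>(k, k'). J k (B k'))"
  have JB: "JB \<in> carrier_mat m m" by (simp add: JB_def)
  define g where "g = det JB"
  have g': "g \<in> carrier (poly_ring ?L')"
    unfolding g_def by (rule carrier_det[OF JB]) (auto simp: JB_def J_car')
  \<comment> \<open>Scaling column k' of \<open>JB\<close> by the variable at
    \<open>(B k', a)\<close> turns row k into parts of the k-th block minor. The antidiagonal of
    that block meets column \<open>a\<close> in row \<open>B k\<close>, so its lowest monomial
    occurs on the diagonal of the matrix only.\<close>
  have "g \<noteq> 0"
  proof
    define \<delta> where "\<delta> k = permutation_monomial (\<lambda>p. \<alpha> (r k) + p) (\<lambda>q. \<gamma> (r k) + q) (n (r k)) (\<lambda>i. n (r k) - 1 - i)" for k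
    assume "g = 0"
    then have "det (mat m m (\<lambda>(k, k'). Var (B k', a) * J k (B k'))) = 0"
      by (simp add: det_scale_columns[of m "\<lambda>k'. Var (B k', a)"] g_def JB_def)
    moreover have "det (mat m m (\<lambda>(k, k'). Var (B k', a) * J k (B k'))) \<noteq> 0"
    proof (rule det_nonzero_by_low)
      fix k k' assume k: "k < m"
      have mono: "strict_mono_on {..<n (r k)} (\<lambda>p. \<alpha> (r k) + p)" "strict_mono_on {..<n (r k)} (\<lambda>q. \<gamma> (r k) + q)"
        by (auto simp: strict_mono_on_def)
      have e: "e k < n (r k)" using cover(3)[OF k] by simp
      have row: "B k = \<alpha> (r k) + (n (r k) - 1 - e k)"
        using block_antidiagonal[OF cover(1)[OF k]] cover(2,3)[OF k] by (simp add: r_def)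
      note low = Var_unit_column_det_low[OF mono e, where ?'k = 'k, folded J_def \<delta>_def, unfolded cover(2)[OF k]]
      show "bounded_below (\<delta> k) (Var (B k', a) * J k (B k'))" by (rule low(1))
      show "Poly_Mapping.lookup (Var (B k, a) * J k (B k)) (\<delta> k) \<noteq> 0"
        using low(2)[OF row] by auto
      show "Poly_Mapping.lookup (Var (B k', a) * J k (B k')) (\<delta> k) = 0" if "k \<noteq> k'"
        using that row by (intro low(3)) (auto simp: B_def)
    qed
    ultimately show False by contradiction
  qed
  \<comment> \<open>Without column \<open>a\<close> the window offers s columns, one too few for an
    antidiagonal sequence of length s + 1.\<close>
  have g_hom: "subst (rank_gen (W a (a + s)) s) g \<noteq> 0"
  proof (rule rank_subst_nonzero[OF \<open>g \<noteq> 0\<close>])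
    fix \<mu> assume "\<mu> \<in> Poly_Mapping.keys g"
    then have \<mu>: "Poly_Mapping.keys \<mu> \<inter> W a (a + s) \<subseteq> {x. snd x \<in> {a<..a + s}}"
      using g' by (fastforce simp: poly_ring_sel monomials_on_def column_part_def)
    show "standard_monomial (W a (a + s)) (Suc s) \<mu>"
      unfolding standard_monomial_def
    proof (intro allI notI)
      fix \<sigma> assume \<sigma>: "antidiagonal_seq (Poly_Mapping.keys \<mu> \<inter> W a (a + s)) (Suc s) \<sigma>"
      have "inj_on (\<lambda>p. snd (\<sigma> p)) {..<Suc s}"
        using \<sigma> unfolding antidiagonal_seq_def inj_on_def by (metis lessThan_iff less_irrefl nat_neq_iff)
      then have "Suc s = card ((\<lambda>p. snd (\<sigma> p)) ` {..<Suc s})" by (simp add: card_image)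
      also have "\<dots> \<le> card {a<..a + s}"
        using \<sigma> \<mu> by (intro card_mono) (auto simp: antidiagonal_seq_def)
      finally show False by simp
    qed
  qed
  obtain Q where Q: "Q \<in> K" "\<And>k. k < m \<Longrightarrow> d k \<in> Q"
      "\<And>I. ideal I (poly_ring L) \<Longrightarrow> (\<And>k. k < m \<Longrightarrow> d k \<in> I) \<Longrightarrow> Q \<subseteq> I"
    using sum_of_block_ideals[OF m(1), of r] cover(1) unfolding d_def by metis
  have "g * generic_minor I J' \<in> Q" if IJ: "(I, J') \<in> minor_positions (Suc s) (W a (a + s))" for I J'
  proof -
    obtain \<rho> where \<rho>: "\<And>p. p < Suc s \<Longrightarrow> \<rho> p \<in> F"
        "generic_minor I J' = det (mat (Suc s) (Suc s) (\<lambda>(p, q). Var (\<rho> p, a + q) :: 'k polynomial))"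
      using minorE[OF IJ] by blast
    define M where "M = (generic_minor I J' :: 'k polynomial)"
    define w where "w i = (unit_column_det (Suc s) \<rho> (\<lambda>q. a + q) 0 i :: 'k polynomial)" for i
    have w_rel: "(\<Sum>i\<in>F. Var (i, a + j) * w i) = (if j = 0 then M else 0)" if "j \<le> s" for j
      using sum_Var_unit_column_det[where n = "Suc s" and ?q0.0 = 0 and ?q1.0 = j and \<kappa> = "\<lambda>q. a + q" and ?'k = 'k,
          OF finF \<rho>(1)] that
      by (simp add: w_def M_def \<rho>(2))
    have w_car: "w i \<in> carrier (poly_ring L)" for i
      unfolding w_def using \<rho>(1) by (intro carrier_unit_column_det FL) auto
    \<comment> \<open>The adjugate solves y JB = g w on the rows \<open>B\<close>.\<close>
    define y where "y k = (\<Sum>l<m. w (B l) * adj_mat JB $$ (l, k))" for k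
    have y_car: "y k \<in> carrier (poly_ring L)" if "k < m" for k
      unfolding y_def using that
      by (intro carrier_sum carrier_mult w_car carrier_adj_mat[OF JB]) (auto simp: JB_def J_car' L'_car)
    \<comment> \<open>The defect of y J = g w on all full rows. It vanishes on the rows
      \<open>B\<close>, so at most s entries remain, and it is orthogonal to the s columns after
      \<open>a\<close>; a generic s by s determinant is nonzero, hence z = 0. Column
      \<open>a\<close> then yields g M as the combination of the \<open>d k\<close> with
      coefficients \<open>y k\<close>.\<close>
    define z where "z i = (\<Sum>k<m. y k * J k i) - g * w i" for i
    have adj: "(\<Sum>k<m. adj_mat JB $$ (l, k) * J k (B l')) = (if l = l' then g else 0)" if "l < m" "l' < m" for l l'
    proof -
      have "(\<Sum>k<m. adj_mat JB $$ (l, k) * J k (B l')) = (adj_mat JB * JB) $$ (l, l')"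
        using that adj_mat(1)[OF JB] JB by (simp add: scalar_prod_def atLeast0LessThan JB_def)
      also have "\<dots> = (if l = l' then g else 0)" unfolding adj_mat(3)[OF JB] using that by (simp add: g_def)
      finally show ?thesis .
    qed
    have z_B: "z (B l') = 0" if "l' < m" for l'
    proof -
      have "(\<Sum>k<m. y k * J k (B l')) = (\<Sum>l<m. w (B l) * (\<Sum>k<m. adj_mat JB $$ (l, k) * J k (B l')))"
        unfolding y_def sum_distrib_left sum_distrib_right by (subst sum.swap) (simp add: mult.assoc)
      also have "\<dots> = (\<Sum>l<m. w (B l) * (if l = l' then g else 0))" using adj that by (intro sum.cong) auto
      also have "\<dots> = w (B l') * g" using that by (simp add: if_distrib cong: if_cong)
      finally show ?thesis by (simp add: z_def mult.commute)
    qed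
    have "(\<Sum>i\<in>F. z i * Var (i, a + j)) = (if j = 0 then (\<Sum>k<m. y k * d k) - g * M else 0)" if "j \<le> s" for j
    proof -
      have "(\<Sum>i\<in>F. z i * Var (i, a + j)) =
          (\<Sum>k<m. y k * (\<Sum>i\<in>F. Var (i, a + j) * J k i)) - g * (\<Sum>i\<in>F. Var (i, a + j) * w i)"
        unfolding z_def left_diff_distrib sum_subtractf sum_distrib_left sum_distrib_right
        by (subst sum.swap) (simp add: mult_ac)
      also have "(\<Sum>k<m. y k * (\<Sum>i\<in>F. Var (i, a + j) * J k i)) = (\<Sum>k<m. y k * (if j = 0 then d k else 0))"
        using J_rel that by (intro sum.cong) auto
      finally show ?thesis unfolding w_rel[OF that] by simp
    qed
    moreover have "(\<Sum>i\<in>F. z i * Var (i, a + j)) = (\<Sum>p<s. z (i0 + p) * Var (i0 + p, a + j))" for j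
    proof -
      have "(\<Sum>i\<in>F. z i * Var (i, a + j)) = (\<Sum>i\<in>{i0..<i0 + s}. z i * Var (i, a + j))"
      proof (rule sum.mono_neutral_right)
        show "{i0..<i0 + s} \<subseteq> F" using m by (auto simp: F_eq)
        show "\<forall>i\<in>F - {i0..<i0 + s}. z i * Var (i, a + j) = 0"
        proof
          fix i assume "i \<in> F - {i0..<i0 + s}"
          then have "i - (i0 + s) < m" "B (i - (i0 + s)) = i" using m by (auto simp: F_eq B_def)
          then show "z i * Var (i, a + j) = 0" using z_B[of "i - (i0 + s)"] by simp
        qed
      qed (rule finF)
      also have "\<dots> = (\<Sum>p<s. z (i0 + p) * Var (i0 + p, a + j))"
        by (rule sum.reindex_bij_witness[of _ "\<lambda>p. i0 + p" "\<lambda>i. i - i0"]) auto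
      finally show ?thesis .
    qed
    ultimately have z_rel: "(\<Sum>p<s. z (i0 + p) * Var (i0 + p, a + j)) =
        (if j = 0 then (\<Sum>k<m. y k * d k) - g * M else 0)" if "j \<le> s" for j
      using that by simp
    have "det (mat s s (\<lambda>(p, q). Var (i0 + p, a + Suc q) :: 'k polynomial)) \<noteq> 0"
      using det_Var_low(2)[of s "\<lambda>p. i0 + p" "\<lambda>q. a + Suc q", where ?'k = 'k] by (auto simp: strict_mono_on_def)
    then have "z (i0 + p) = 0" if "p < s" for p
      using that z_rel[of "Suc _"]
      by (intro left_kernel_trivial[of s "\<lambda>p q. Var (i0 + p, a + Suc q)" "\<lambda>p. z (i0 + p)"]) auto
    then have "g * M = (\<Sum>k<m. y k * d k)" using z_rel[of 0] by simp
    also have "\<dots> \<in> Q"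
      by (rule ideal_sum_mem[OF K_ideal[OF Q(1)]])
        (use ideal_poly_ringD(4)[OF K_ideal[OF Q(1)]] Q(2) y_car in auto)
    finally show ?thesis by (simp add: M_def)
  qed
  then show ?thesis
    using g_hom by (intro colon_ladder_ideal[OF W_subset W_convex Q(1), of a "a + s" g])
      (use Q(3)[OF ideal_ladder_ideal[OF W_subset]] dI L'_car[OF g'] in auto)
qed

end

subsection \<open>Enlarging a window\<close>

context ladder_blocks
begin

lemma W_mono: "a' \<le> a \<Longrightarrow> b \<le> b' \<Longrightarrow> W a b \<subseteq> W a' b'"
  by (auto simp: column_part_def)

text \<open>A minor that avoids one of the two extreme columns fits into the window without it. A
  minor that uses both has only rows crossing the whole window.\<close>

lemma minor_outside_smaller_windows:
  assumes IJ: "(I, J) \<in> minor_positions t (W a b)" "(I, J) \<notin> minor_positions t (W a (b - 1))"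
    "(I, J) \<notin> minor_positions t (W (Suc a) b)" and "t > 0" "a < b"
  shows "a \<in> J" "b \<in> J" "I \<subseteq> {i. (i, a) \<in> L \<and> (i, b) \<in> L}"
proof -
  have "I \<noteq> {}" using IJ(1) assms(4) by (auto simp: minor_positions_def)
  then obtain i where "i \<in> I" by blast
  then have J: "J \<subseteq> {a..b}" using IJ(1) by (auto simp: minor_positions_def column_part_def)
  show a: "a \<in> J"
  proof (rule ccontr)
    assume "a \<notin> J"
    then have "Suc a \<le> j" if "j \<in> J" for j using J that by (cases "j = a") force+
    then show False using IJ(1,3) by (auto simp: minor_positions_def column_part_def)
  qed
  show b: "b \<in> J"
  proof (rule ccontr)
    assume "b \<notin> J"
    then have "j \<le> b - 1" if "j \<in> J" for j using J that by (cases "j = b") force+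
    then show False using IJ(1,2) by (auto simp: minor_positions_def column_part_def)
  qed
  show "I \<subseteq> {i. (i, a) \<in> L \<and> (i, b) \<in> L}"
    using IJ(1) a b by (auto simp: minor_positions_def column_part_def)
qed

text \<open>
  Modulo the minors of the window without its last column, the \<open>s\<close>-minor \<open>\<delta>\<close> expresses \<open>\<delta>\<close> times
  the first column as a combination of the next \<open>s\<close> columns.
\<close>

lemma window_minor_relation:
  fixes \<rho> \<rho>' \<kappa>' :: "nat \<Rightarrow> nat"
  assumes "a + s < b" and rows: "\<And>p. p < s \<Longrightarrow> (\<rho> p, a) \<in> L \<and> (\<rho> p, b) \<in> L"
    and rows': "\<And>p. p < Suc s \<Longrightarrow> (\<rho>' p, a) \<in> L \<and> (\<rho>' p, b) \<in> L"
    and cols': "\<And>q. q < Suc s \<Longrightarrow> q \<noteq> q0 \<Longrightarrow> a < \<kappa>' q \<and> \<kappa>' q \<le> b" and q0: "q0 < Suc s" "\<kappa>' q0 = a"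
    and Q: "ideal Q (poly_ring L)" "I_W a (b - 1) \<subseteq> Q" "I_W (Suc a) b \<subseteq> Q"
  shows "det (mat s s (\<lambda>(p, q). Var (\<rho> p, Suc a + q))) *
    det (mat (Suc s) (Suc s) (\<lambda>(p, q). Var (\<rho>' p, \<kappa>' q))) \<in> Q"
proof -
  \<comment> \<open>Column \<open>a\<close> is put last, behind the next s columns, so that the
    cofactor in the corner \<open>(s, s)\<close> is \<open>\<delta>\<close> without a sign.\<close>
  define c where "c q = (if q < s then Suc a + q else a)" for q
  define \<delta> where "\<delta> = (det (mat s s (\<lambda>(p, q). Var (\<rho> p, Suc a + q))) :: 'k polynomial)"
  define N where "N i = mat (Suc s) (Suc s) (\<lambda>(p, q). Var (if p < s then \<rho> p else i, c q) :: 'k polynomial)" for i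
  have N: "N i \<in> carrier_mat (Suc s) (Suc s)" for i by (simp add: N_def)
  have row_L: "(i, j) \<in> L" if "(i, a) \<in> L \<and> (i, b) \<in> L" "a \<le> j" "j \<le> b" for i j
    using that row_segment_in_L[of i a b j] by auto
  have c_range: "a \<le> c q" "c q \<le> b - 1" if "q < Suc s" for q using that assms(1) by (auto simp: c_def)
  have detN: "det (N i) \<in> I_W a (b - 1)" if "(i, a) \<in> L \<and> (i, b) \<in> L" for i
    unfolding N_def
  proof (rule det_Var_in_I_W[where e = 0])
    show "((if p < s then \<rho> p else i), c q) \<in> L" if "p < Suc s" "q < Suc s" for p q
      using rows[of p] that(1) \<open>(i, a) \<in> L \<and> (i, b) \<in> L\<close> c_range[OF that(2)] assms(1) by (intro row_L) auto
  qed (use c_range in auto)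
  \<comment> \<open>Only the last row of \<open>N i\<close> depends on \<open>i\<close>, so the
    cofactors along that row are the same for all \<open>i\<close>.\<close>
  have del: "mat_delete (N i) s q = mat_delete (N 0) s q" for i q
    by (rule eq_matI) (auto simp: mat_delete_def N_def)
  have "mat_delete (N 0) s s = mat s s (\<lambda>(p, q). Var (\<rho> p, Suc a + q))"
    by (rule eq_matI) (auto simp: mat_delete_def N_def c_def)
  then have cof_s: "cofactor (N i) s s = \<delta>" for i
    unfolding cofactor_def del[of i] by (simp add: \<delta>_def)
  define y where "y q = - cofactor (N 0) s q" for q
  have laplace: "\<delta> * Var (i, a) = det (N i) + (\<Sum>q<s. y q * Var (i, Suc a + q))" for i
  proof -
    have "det (N i) = (\<Sum>q<Suc s. N i $$ (s, q) * cofactor (N i) s q)"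
      by (rule laplace_expansion_row[OF N]) simp
    also have "\<dots> = (\<Sum>q<Suc s. Var (i, c q) * cofactor (N i) s q)"
      by (intro sum.cong refl arg_cong2[of _ _ _ _ "(*)"]) (simp add: N_def)
    also have "\<dots> = (\<Sum>q<s. Var (i, c q) * cofactor (N i) s q) + Var (i, a) * \<delta>"
      by (simp add: cof_s c_def)
    also have "(\<Sum>q<s. Var (i, c q) * cofactor (N i) s q) = (\<Sum>q<s. - (y q * Var (i, Suc a + q)))"
      by (intro sum.cong refl) (simp add: y_def cofactor_def del[of i] c_def mult.commute)
    finally show ?thesis by (simp add: sum_negf mult.commute)
  qed
  have y_car: "y q \<in> carrier (poly_ring L)" if "q < s" for q
  proof -
    have "mat_delete (N 0) s q \<in> carrier_mat s s" using mat_delete_carrier[OF N[of 0]] by simp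
    moreover have "mat_delete (N 0) s q $$ (i, j) \<in> carrier (poly_ring L)" if "i < s" "j < s" for i j
    proof -
      have "mat_delete (N 0) s q $$ (i, j) = Var (\<rho> i, c (if j < q then j else Suc j))"
        using that \<open>q < s\<close> by (simp add: mat_delete_def N_def)
      moreover have "(\<rho> i, c (if j < q then j else Suc j)) \<in> L"
        using that \<open>q < s\<close> c_range[of "if j < q then j else Suc j"] assms(1) by (intro row_L[OF rows]) auto
      ultimately show ?thesis by (simp add: carrier_Var)
    qed
    ultimately have "det (mat_delete (N 0) s q) \<in> carrier (poly_ring L)" by (rule carrier_det)
    moreover have "(- 1) ^ e \<in> carrier (poly_ring L :: 'k polynomial ring)" for e
      by (induction e) (use carrier_1 carrier_uminus in auto)
    ultimately show ?thesis unfolding y_def cofactor_def by (intro carrier_uminus carrier_mult)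
  qed
  \<comment> \<open>Index set for \<delta> times column \<open>a\<close>: the left part gives unit
    vectors weighted by minors of the window without \<open>b\<close>, the right part the next s
    columns weighted by \<open>y\<close>. Multilinearity in column \<open>q0\<close> then splits the
    determinant accordingly.\<close>
  define A where "A = {..<Suc s} <+> {..<s}"
  define Y where "Y = case_sum (\<lambda>i. det (N (\<rho>' i))) y"
  define V where "V = case_sum (\<lambda>i p. if i = p then 1 else 0) (\<lambda>q p. Var (\<rho>' p, Suc a + q) :: 'k polynomial)"
  let ?det = "\<lambda>v. det (mat (Suc s) (Suc s) (\<lambda>(p, q). if q = q0 then v p else Var (\<rho>' p, \<kappa>' q)))"
  have column: "\<delta> * Var (\<rho>' p, a) = (\<Sum>x\<in>A. Y x * V x p)" if "p < Suc s" for p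
  proof -
    have "(\<Sum>x\<in>A. Y x * V x p) =
        (\<Sum>i<Suc s. det (N (\<rho>' i)) * (if i = p then 1 else 0)) + (\<Sum>q<s. y q * Var (\<rho>' p, Suc a + q))"
      unfolding A_def Y_def V_def by (subst sum.Plus) auto
    also have "(\<Sum>i<Suc s. det (N (\<rho>' i)) * (if i = p then 1 else 0)) = (\<Sum>i<Suc s. if i = p then det (N (\<rho>' p)) else 0)"
      by (intro sum.cong) auto
    also have "\<dots> = det (N (\<rho>' p))" using that by simp
    finally show ?thesis by (simp add: laplace)
  qed
  have "mat (Suc s) (Suc s) (\<lambda>(p, q). if q = q0 then Var (\<rho>' p, a) else Var (\<rho>' p, \<kappa>' q)) =
      mat (Suc s) (Suc s) (\<lambda>(p, q). Var (\<rho>' p, \<kappa>' q) :: 'k polynomial)"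
    by (rule eq_matI) (use q0 in auto)
  then have "\<delta> * det (mat (Suc s) (Suc s) (\<lambda>(p, q). Var (\<rho>' p, \<kappa>' q))) =
      (\<Sum>_\<in>{()}. \<delta> * ?det (\<lambda>p. Var (\<rho>' p, a)))"
    by simp
  also have "\<dots> = ?det (\<lambda>p. \<Sum>_\<in>{()}. \<delta> * Var (\<rho>' p, a))" by (rule det_column_sum[OF q0(1), symmetric])
  also have "\<dots> = ?det (\<lambda>p. \<Sum>x\<in>A. Y x * V x p)"
    using column by (intro arg_cong[of _ _ det] eq_matI) auto
  also have "\<dots> = (\<Sum>x\<in>A. Y x * ?det (V x))" by (rule det_column_sum[OF q0(1)])
  also have "\<dots> \<in> Q"
  proof (rule ideal_sum_mem[OF Q(1)])
    fix x assume "x \<in> A"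
    then consider i where "x = Inl i" "i < Suc s" | q where "x = Inr q" "q < s" by (auto simp: A_def)
    then show "Y x * ?det (V x) \<in> Q"
    proof cases
      case 1
      have "det (N (\<rho>' i)) \<in> Q" using detN[OF rows'[OF 1(2)]] Q(2) by blast
      moreover have "?det (V x) \<in> carrier (poly_ring L)"
      proof (rule carrier_det[of _ "Suc s"])
        fix p j assume pj: "p < Suc s" "j < Suc s"
        have "(\<rho>' p, \<kappa>' j) \<in> L" if "j \<noteq> q0" using row_L[OF rows'[OF pj(1)]] cols'[OF pj(2) that] by auto
        then show "mat (Suc s) (Suc s) (\<lambda>(p, q). if q = q0 then V x p else Var (\<rho>' p, \<kappa>' q)) $$ (p, j)
            \<in> carrier (poly_ring L)"
          using pj by (auto simp: V_def 1 carrier_Var carrier_0 carrier_1)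
      qed simp
      ultimately show ?thesis
        using ideal_poly_ringD(4)[OF Q(1)] by (simp add: Y_def 1 mult.commute)
    next
      case 2
      \<comment> \<open>Column \<open>a\<close> has been replaced by \<open>Suc a + q\<close>, so
        all columns lie beyond \<open>a\<close>. The new column may repeat another or break the
        order; \<open>det_Var_in_I_W\<close> permits both.\<close>
      have "?det (V x) = det (mat (Suc s) (Suc s) (\<lambda>(p, j). Var (\<rho>' p, if j = q0 then Suc a + q else \<kappa>' j)))"
        by (intro arg_cong[of _ _ det] eq_matI) (auto simp: V_def 2)
      also have "\<dots> \<in> I_W (Suc a) b"
      proof (rule det_Var_in_I_W[where e = 0])
        show "(\<rho>' p, if j = q0 then Suc a + q else \<kappa>' j) \<in> L" if "p < Suc s" "j < Suc s" for p j
          using rows'[OF that(1)] cols'[OF that(2)] assms(1) 2(2) by (intro row_L) auto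
        show "Suc a \<le> (if j = q0 then Suc a + q else \<kappa>' j) \<and> (if j = q0 then Suc a + q else \<kappa>' j) \<le> b"
          if "0 \<le> j" "j \<le> 0 + s" for j
          using cols'[of j] that assms(1) 2(2) by auto
      qed simp
      finally have "?det (V x) \<in> Q" using Q(3) by blast
      then show ?thesis using ideal_poly_ringD(4)[OF Q(1) _ y_car[OF 2(2)]] by (simp add: Y_def 2(1))
    qed
  qed
  finally show ?thesis by (simp add: \<delta>_def)
qed

text \<open>\<open>Q\<close> combines the ideals of the two smaller windows; a window without minors
  is left out, since its ideal need not belong to \<open>K\<close>. Minors in neither smaller window
  have only full rows. With fewer than s + 1 full rows there are none, and \<open>Q\<close> is
  already the ideal sought; otherwise s full rows provide the minor \<delta> for the colon.\<close>

lemma window_step: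
  assumes ab: "a + s < b"
    and left: "minor_positions (Suc s) (W a (b - 1)) \<noteq> {} \<Longrightarrow> I_W a (b - 1) \<in> K"
    and right: "minor_positions (Suc s) (W (Suc a) b) \<noteq> {} \<Longrightarrow> I_W (Suc a) b \<in> K"
    and ne: "minor_positions (Suc s) (W a b) \<noteq> {}"
  shows "I_W a b \<in> K"
proof -
  define F where "F = {i. (i, a) \<in> L \<and> (i, b) \<in> L}"
  have finF: "finite F" unfolding F_def by (rule finite_full_rows)
  note outside = minor_outside_smaller_windows[of _ _ "Suc s" a b, folded F_def]
  have sub: "I_W a (b - 1) \<subseteq> I_W a b" "I_W (Suc a) b \<subseteq> I_W a b"
    by (intro ladder_ideal_mono W_mono W_subset; simp)+
  have empty: "I_W a' b' \<subseteq> Q" if "minor_positions (Suc s) (W a' b') = {}" "ideal Q (poly_ring L)" for a' b' Q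
    by (rule ladder_ideal_minimal[OF that(2)]) (use that(1) in auto)
  \<comment> \<open>A minor with full rows can be moved to the columns from \<open>a\<close> to
    \<open>a + s\<close>, which omit \<open>b\<close>.\<close>
  have "minor_positions (Suc s) (W a (b - 1)) \<noteq> {} \<or> minor_positions (Suc s) (W (Suc a) b) \<noteq> {}"
  proof (rule ccontr)
    assume none: "\<not> ?thesis"
    obtain I J where IJ: "(I, J) \<in> minor_positions (Suc s) (W a b)" using ne by auto
    then have "I \<subseteq> F" using outside(3)[OF IJ] none ab by auto
    then have "I \<times> {a..a + s} \<subseteq> W a (b - 1)"
      using ab row_segment_in_L[of _ a b] by (auto simp: F_def column_part_def)
    then have "(I, {a..a + s}) \<in> minor_positions (Suc s) (W a (b - 1))"
      using IJ by (auto simp: minor_positions_def)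
    then show False using none by auto
  qed
  then obtain Q where Q: "Q \<in> K" "I_W a (b - 1) \<subseteq> Q" "I_W (Suc a) b \<subseteq> Q" "Q \<subseteq> I_W a b"
  proof (elim disjE)
    assume l: "minor_positions (Suc s) (W a (b - 1)) \<noteq> {}"
    note l = left[OF l]
    show thesis
    proof (cases "minor_positions (Suc s) (W (Suc a) b) = {}")
      case True
      then show thesis using that[OF l] empty[OF True K_ideal[OF l]] sub by auto
    next
      case False
      note r = right[OF False]
      show thesis
      proof (rule that[OF K_sum[OF l r]])
        show "I_W a (b - 1) <+>\<^bsub>poly_ring L\<^esub> I_W (Suc a) b \<subseteq> I_W a b"
          unfolding add_ideals_poly_ring
          using ideal_poly_ringD(3)[OF ideal_ladder_ideal[OF W_subset]] sub by blast
      qed (use mem_add_ideals[OF K_ideal[OF l] K_ideal[OF r]] in auto)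
    qed
  next
    assume r: "minor_positions (Suc s) (W (Suc a) b) \<noteq> {}"
    note r = right[OF r]
    show thesis
    proof (cases "minor_positions (Suc s) (W a (b - 1)) = {}")
      case True
      then show thesis using that[OF r] empty[OF True K_ideal[OF r]] sub by auto
    next
      case False
      note l = left[OF False]
      show thesis
      proof (rule that[OF K_sum[OF l r]])
        show "I_W a (b - 1) <+>\<^bsub>poly_ring L\<^esub> I_W (Suc a) b \<subseteq> I_W a b"
          unfolding add_ideals_poly_ring
          using ideal_poly_ringD(3)[OF ideal_ladder_ideal[OF W_subset]] sub by blast
      qed (use mem_add_ideals[OF K_ideal[OF l] K_ideal[OF r]] in auto)
    qed
  qed
  note Q_ideal = K_ideal[OF Q(1)]
  have small: "(generic_minor I J :: 'k polynomial) \<in> Q"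
    if "(I, J) \<in> minor_positions (Suc s) (W a (b - 1)) \<or> (I, J) \<in> minor_positions (Suc s) (W (Suc a) b)" for I J
    using that generic_minor_in_ladder_ideal[OF W_subset, of I J "Suc s"] Q(2,3) by blast
  show ?thesis
  proof (cases "Suc s \<le> card F")
    case False
    have "I_W a b \<subseteq> Q"
    proof (rule ladder_ideal_minimal[OF Q_ideal])
      fix I J assume IJ: "(I, J) \<in> minor_positions (Suc s) (W a b)"
      have "\<not> I \<subseteq> F" using card_mono[OF finF, of I] IJ False by (auto simp: minor_positions_def)
      then show "generic_minor I J \<in> Q" using outside(3)[OF IJ] small ab by auto
    qed
    then have "I_W a b = Q" using Q(4) by blast
    then show ?thesis using Q(1) by simp
  next
    case True
    then obtain P where P: "P \<subseteq> F" "card P = s" "finite P"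
      using obtain_subset_with_card_n[of s F] by (metis Suc_leD)
    obtain \<rho> where \<rho>: "strict_mono_on {..<s} \<rho>" "P = \<rho> ` {..<s}" by (rule finite_set_strict_mono_enum[OF P(3,2)])
    have \<rho>F: "(\<rho> p, a) \<in> L \<and> (\<rho> p, b) \<in> L" if "p < s" for p using P(1) \<rho>(2) that by (auto simp: F_def)
    define \<delta> where "\<delta> = (det (mat s s (\<lambda>(p, q). Var (\<rho> p, Suc a + q))) :: 'k polynomial)"
    have "strict_mono_on {..<s} (\<lambda>q. Suc a + q)" by (auto simp: strict_mono_on_def)
    from det_Var_low(2)[OF \<rho>(1) this, where ?'k = 'k] have "\<delta> \<noteq> 0" by (auto simp: \<delta>_def)
    then have hom: "subst (rank_gen (W a b) s) \<delta> \<noteq> 0"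
    proof (rule rank_subst_nonzero)
      fix \<mu> assume "\<mu> \<in> Poly_Mapping.keys \<delta>"
      then have "total_degree \<mu> = s"
        using det_Var_keys[of \<mu> s \<rho> "\<lambda>q. Suc a + q", where ?'k = 'k] total_degree_permutation_monomial
        by (auto simp: \<delta>_def)
      then show "standard_monomial (W a b) (Suc s) \<mu>" by (intro standard_monomial_total_degree) simp
    qed
    have \<delta>_car: "\<delta> \<in> carrier (poly_ring L)"
      unfolding \<delta>_def
    proof (rule carrier_det_Var)
      fix p q assume "p < s" "q < s"
      then show "(\<rho> p, Suc a + q) \<in> L" using \<rho>F[of p] ab row_segment_in_L[of "\<rho> p" a b "Suc a + q"] by auto
    qed
    show ?thesis
    proof (rule colon_ladder_ideal[OF W_subset W_convex Q(1,4) \<delta>_car hom])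
      fix I J assume IJ: "(I, J) \<in> minor_positions (Suc s) (W a b)"
      show "\<delta> * generic_minor I J \<in> Q"
      proof (cases "(I, J) \<in> minor_positions (Suc s) (W a (b - 1)) \<or> (I, J) \<in> minor_positions (Suc s) (W (Suc a) b)")
        case True
        show ?thesis by (rule ideal_poly_ringD(4)[OF Q_ideal small[OF True] \<delta>_car])
      next
        case False
        then have J: "a \<in> J" and I: "I \<subseteq> F" using outside(1,3)[OF IJ] ab by auto
        show ?thesis
        proof (rule minor_positionsE[OF IJ, where ?'k = 'k])
          fix \<rho>' \<kappa>' assume rk: "strict_mono_on {..<Suc s} \<kappa>'" "I = \<rho>' ` {..<Suc s}" "J = \<kappa>' ` {..<Suc s}"
            "\<And>p q. p < Suc s \<Longrightarrow> q < Suc s \<Longrightarrow> (\<rho>' p, \<kappa>' q) \<in> W a b"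
            "generic_minor I J = det (mat (Suc s) (Suc s) (\<lambda>(p, q). Var (\<rho>' p, \<kappa>' q) :: 'k polynomial))"
          obtain q0 where q0: "q0 < Suc s" "\<kappa>' q0 = a" using J rk(3) by auto
          show "\<delta> * generic_minor I J \<in> Q"
            unfolding \<delta>_def rk(5)
          proof (rule window_minor_relation[where \<rho> = \<rho> and \<rho>' = \<rho>' and \<kappa>' = \<kappa>', OF ab \<rho>F _ _ q0 Q_ideal Q(2,3)])
            show "(\<rho>' p, a) \<in> L \<and> (\<rho>' p, b) \<in> L" if "p < Suc s" for p
              using I that by (auto simp: rk(2) F_def)
            fix q assume q: "q < Suc s" "q \<noteq> q0"
            have "a \<le> \<kappa>' q" "\<kappa>' q \<le> b" using rk(4)[of 0 q] q(1) by (auto simp: column_part_def)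
            moreover have "\<kappa>' q \<noteq> a"
              using q q0 strict_mono_on_eqD[OF rk(1), of q q0] by auto
            ultimately show "a < \<kappa>' q \<and> \<kappa>' q \<le> b" by simp
          qed
        qed
      qed
    qed
  qed
qed

theorem column_window:
  assumes "minor_positions (Suc s) (W a b) \<noteq> {}"
  shows "I_W a b \<in> K"
  using assms
proof (induction "b - a" arbitrary: a b rule: less_induct)
  case less
  obtain I J where IJ: "(I, J) \<in> minor_positions (Suc s) (W a b)" using less.prems by auto
  then have "I \<noteq> {}" "card J = Suc s" by (auto simp: minor_positions_def)
  moreover from this obtain i where "i \<in> I" by blast
  then have "J \<subseteq> {a..b}" using IJ by (auto simp: minor_positions_def column_part_def)
  ultimately have "Suc s \<le> card {a..b}" using card_mono[of "{a..b}" J] by simp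
  then consider "b = a + s" | "a + s < b" by force
  then show ?case
  proof cases
    case 1
    then show ?thesis using minimal_window less.prems by simp
  next
    case 2
    then have "b - 1 - a < b - a" "b - Suc a < b - a" by auto
    from less.hyps[OF this(1)] less.hyps[OF this(2)] show ?thesis by (rule window_step[OF 2 _ _ less.prems])
  qed
qed

end

section \<open>Transposition\<close>

definition transpose_poly :: "'k::field polynomial \<Rightarrow> 'k polynomial" where
  "transpose_poly = subst (\<lambda>x. Var (prod.swap x))"

lemma subst_mon_eval: "subst g (mon_eval h m) = mon_eval (\<lambda>x. subst g (h x)) m"
  by (induction m rule: monomial_induct)
    (simp_all add: mon_eval_0 mon_eval_add mon_eval_single subst_mult del: One_nat_def)

lemma mon_eval_Var: "mon_eval Var m = Poly_Mapping.single m (1::'k::field)"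
  by (induction m rule: monomial_induct)
    (simp_all add: mon_eval_0 mon_eval_add mon_eval_single Var_def mult_single del: One_nat_def)

lemma transpose_poly_hom:
  "transpose_poly 0 = 0" "transpose_poly (p + q) = transpose_poly p + transpose_poly q"
  "transpose_poly (p * q) = transpose_poly p * transpose_poly q"
  by (simp_all add: transpose_poly_def subst_add subst_mult)

lemma transpose_poly_Var: "transpose_poly (Var (i, j)) = Var (j, i)"
  by (simp add: transpose_poly_def subst_Var)

lemma transpose_poly_involution [simp]: "transpose_poly (transpose_poly p) = p"
proof (induction p rule: poly_mapping_add_induct)
  case (single m c)
  show ?case
    by (simp add: transpose_poly_def subst_single subst_mult subst_mon_eval subst_Var mon_eval_Var mult_single)
      (simp add: mon_eval_0 mult_single)
qed (simp_all add: transpose_poly_hom)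

lemma inj_transpose_poly: "inj transpose_poly"
  by (metis injI transpose_poly_involution)

lemma transpose_poly_carrier:
  fixes p :: "'k::field polynomial"
  assumes "p \<in> carrier (poly_ring L)"
  shows "transpose_poly p \<in> carrier (poly_ring (prod.swap ` L))"
  unfolding transpose_poly_def subst_def
proof (intro carrier_sum carrier_mult)
  fix m assume m: "m \<in> Poly_Mapping.keys p"
  show "Poly_Mapping.single 0 (Poly_Mapping.lookup p m) \<in> carrier (poly_ring (prod.swap ` L))"
    by (intro carrier_single) (simp add: monomials_on_0)
  have power: "x ^ e \<in> carrier (poly_ring (prod.swap ` L))"
    if "x \<in> carrier (poly_ring (prod.swap ` L))" for x :: "'k polynomial" and e
    by (induction e) (use that in \<open>auto intro: carrier_1 carrier_mult\<close>)
  have "Poly_Mapping.keys m \<subseteq> L" using assms m by (auto simp: poly_ring_sel monomials_on_def)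
  then show "mon_eval (\<lambda>x. Var (prod.swap x)) m \<in> carrier (poly_ring (prod.swap ` L) :: 'k polynomial ring)"
    unfolding mon_eval_def by (intro carrier_prod power carrier_Var) auto
qed

lemma swap_swap_image [simp]: "prod.swap ` prod.swap ` L = L"
  by (simp add: image_comp)

lemma mem_swap_image: "(i, j) \<in> prod.swap ` T \<longleftrightarrow> (j, i) \<in> T"
  by force

lemma minor_positions_swap: "(I, J) \<in> minor_positions t T \<Longrightarrow> (J, I) \<in> minor_positions t (prod.swap ` T)"
  by (auto simp: minor_positions_def mem_swap_image)

lemma transpose_poly_carrier_iff:
  "transpose_poly p \<in> carrier (poly_ring (prod.swap ` L)) \<longleftrightarrow> p \<in> carrier (poly_ring L)"
  using transpose_poly_carrier[of "transpose_poly p" "prod.swap ` L"] transpose_poly_carrier[of p L] by auto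

lemma transpose_poly_det_Var:
  "transpose_poly (det (mat n n (\<lambda>(p, q). Var (\<rho> p, \<kappa> q)))) = det (mat n n (\<lambda>(p, q). Var (\<kappa> p, \<rho> q)))"
proof -
  have "transpose_poly (det (mat n n (\<lambda>(p, q). Var (\<rho> p, \<kappa> q)))) =
      det (map_mat transpose_poly (mat n n (\<lambda>(p, q). Var (\<rho> p, \<kappa> q))))"
    unfolding transpose_poly_def by (rule subst_det)
  also have "map_mat transpose_poly (mat n n (\<lambda>(p, q). Var (\<rho> p, \<kappa> q))) =
      transpose_mat (mat n n (\<lambda>(p, q). Var (\<kappa> p, \<rho> q)))"
    by (rule eq_matI) (auto simp: transpose_poly_Var)
  also have "det \<dots> = det (mat n n (\<lambda>(p, q). Var (\<kappa> p, \<rho> q)))" by (rule det_transpose[OF mat_carrier])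
  finally show ?thesis .
qed

lemma transpose_poly_ideal:
  assumes "ideal I (poly_ring L :: 'k::field polynomial ring)"
  shows "ideal (transpose_poly ` I) (poly_ring (prod.swap ` L))"
proof (rule ideal_poly_ringI)
  note I = ideal_poly_ringD[OF assms]
  show "transpose_poly ` I \<subseteq> carrier (poly_ring (prod.swap ` L))" using I(1) transpose_poly_carrier by blast
  show "0 \<in> transpose_poly ` I" using I(2) transpose_poly_hom(1) by (metis image_eqI)
  show "x + y \<in> transpose_poly ` I" if "x \<in> transpose_poly ` I" "y \<in> transpose_poly ` I" for x y
    using that I(3) by (auto simp flip: transpose_poly_hom)
  show "y * x \<in> transpose_poly ` I"
    if xy: "x \<in> transpose_poly ` I" "y \<in> carrier (poly_ring (prod.swap ` L))" for x y
  proof -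
    obtain x' where x': "x = transpose_poly x'" "x' \<in> I" using xy(1) by blast
    have "transpose_poly y \<in> carrier (poly_ring L)" using transpose_poly_carrier[OF xy(2)] by simp
    then have "transpose_poly (transpose_poly y * x') \<in> transpose_poly ` I" using I(4)[OF x'(2)] by blast
    then show ?thesis by (simp add: transpose_poly_hom x'(1))
  qed
qed

lemma transpose_poly_image_eq: "transpose_poly ` I = {p. transpose_poly p \<in> I}"
  by (auto simp: image_iff) (metis transpose_poly_involution)

lemma transpose_poly_ladder_ideal_subset:
  assumes "T \<subseteq> L"
  shows "(ladder_ideal L t T :: 'k::field polynomial set) \<subseteq>
    transpose_poly ` ladder_ideal (prod.swap ` L) t (prod.swap ` T)"
proof (rule ladder_ideal_minimal)
  have T: "prod.swap ` T \<subseteq> prod.swap ` L" using assms by auto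
  show "ideal (transpose_poly ` ladder_ideal (prod.swap ` L) t (prod.swap ` T)) (poly_ring L :: 'k polynomial ring)"
    using transpose_poly_ideal[OF ideal_ladder_ideal[OF T]] by simp
  fix I J assume IJ: "(I, J) \<in> minor_positions t T"
  then have "(J, I) \<in> minor_positions t (prod.swap ` T)" by (rule minor_positions_swap)
  then have "(generic_minor J I :: 'k polynomial) \<in> ladder_ideal (prod.swap ` L) t (prod.swap ` T)"
    by (rule generic_minor_in_ladder_ideal[OF T])
  moreover have "transpose_poly (generic_minor I J :: 'k polynomial) = generic_minor J I"
  proof (rule minor_positionsE[OF IJ, where ?'k = 'k])
    fix \<rho> \<kappa> assume rk: "strict_mono_on {..<t} \<rho>" "strict_mono_on {..<t} \<kappa>" "I = \<rho> ` {..<t}" "J = \<kappa> ` {..<t}"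
    show ?thesis
      unfolding rk(3,4) generic_minor_strict_mono[OF rk(1,2)] generic_minor_strict_mono[OF rk(2,1)]
      by (rule transpose_poly_det_Var)
  qed
  ultimately show "(generic_minor I J :: 'k polynomial) \<in> transpose_poly ` ladder_ideal (prod.swap ` L) t (prod.swap ` T)"
    unfolding transpose_poly_image_eq by simp
qed

text \<open>Minimality of the generated ideal gives one inclusion for every ladder; the other is the
  same inclusion for the transposed sets, by involution.\<close>

lemma transpose_poly_ladder_ideal:
  assumes "T \<subseteq> L"
  shows "ladder_ideal (prod.swap ` L) t (prod.swap ` T) =
    transpose_poly ` (ladder_ideal L t T :: 'k::field polynomial set)"
proof
  show "transpose_poly ` (ladder_ideal L t T :: 'k polynomial set) \<subseteq> ladder_ideal (prod.swap ` L) t (prod.swap ` T)"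
    using transpose_poly_ladder_ideal_subset[OF assms, of t, where ?'k = 'k] by auto
  show "ladder_ideal (prod.swap ` L) t (prod.swap ` T) \<subseteq> transpose_poly ` (ladder_ideal L t T :: 'k polynomial set)"
    using transpose_poly_ladder_ideal_subset[of "prod.swap ` T" "prod.swap ` L" t, where ?'k = 'k] assms by auto
qed

lemma ladder_convex_swap: "ladder_convex L \<Longrightarrow> ladder_convex (prod.swap ` L)"
  unfolding ladder_convex_def mem_swap_image by blast

context ladder_blocks
begin

text \<open>\<alpha> and \<gamma> exchange roles. A cover of columns is also a cover of rows,
  because \<alpha> + \<gamma> + n = r + 1 converts the column bounds of a square block into row
  bounds.\<close>

lemma transposed: "ladder_blocks (prod.swap ` L) s ((`) transpose_poly ` K) D \<gamma> \<alpha> n"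
proof (rule ladder_blocks.intro)
  let ?L = "prod.swap ` L" and ?K = "(`) transpose_poly ` K"
  show "finite ?L" using finite_L by simp
  show "ladder_convex ?L" using convex_L by (rule ladder_convex_swap)
  show "ideal I (poly_ring ?L)" if "I \<in> ?K" for I using that K_ideal transpose_poly_ideal by blast
  show "{x \<in> carrier (poly_ring ?L). x * g \<in> I} \<in> ?K" if Ig: "I \<in> ?K" "g \<in> carrier (poly_ring ?L)" for I g
  proof -
    obtain I' where I': "I = transpose_poly ` I'" "I' \<in> K" using Ig(1) by blast
    have "transpose_poly g \<in> carrier (poly_ring L)" using transpose_poly_carrier[OF Ig(2)] by simp
    then have "{x \<in> carrier (poly_ring L). x * transpose_poly g \<in> I'} \<in> K" by (rule K_colon[OF I'(2)])
    moreover have "{x \<in> carrier (poly_ring ?L). x * g \<in> I} =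
        transpose_poly ` {x \<in> carrier (poly_ring L). x * transpose_poly g \<in> I'}"
      unfolding transpose_poly_image_eq I'(1)
      using transpose_poly_carrier_iff[of _ ?L] by (auto simp: transpose_poly_hom)
    ultimately show ?thesis by blast
  qed
  show "I <+>\<^bsub>poly_ring ?L\<^esub> J \<in> ?K" if "I \<in> ?K" "J \<in> ?K" for I J
  proof -
    from that obtain I' J' where IJ: "I = transpose_poly ` I'" "I' \<in> K" "J = transpose_poly ` J'" "J' \<in> K" by blast
    have "I <+>\<^bsub>poly_ring ?L\<^esub> J = transpose_poly ` (I' <+>\<^bsub>poly_ring L\<^esub> J')"
      unfolding add_ideals_poly_ring IJ(1,3) by (auto simp: image_iff transpose_poly_hom) (metis transpose_poly_hom(2))+
    then show ?thesis using K_sum[OF IJ(2,4)] by blast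
  qed
  show "(\<gamma> r + p, \<alpha> r + q) \<in> ?L" if "r \<in> D" "p < n r" "q < n r" for r p q
    using block_subset[OF that(1,3,2)] by (simp add: mem_swap_image)
  show "\<gamma> r + \<alpha> r + n r = Suc r" if "r \<in> D" for r using block_antidiagonal[OF that] by simp
  show "i + s + a \<in> D \<and> \<alpha> (i + s + a) \<le> a \<and> a + s < \<alpha> (i + s + a) + n (i + s + a)"
    if "(i + s, a) \<in> ?L" "(i, a + s) \<in> ?L" for i a
  proof -
    have "a + s + i \<in> D \<and> \<gamma> (a + s + i) \<le> i \<and> i + s < \<gamma> (a + s + i) + n (a + s + i)"
      using that by (intro block_covers) (auto simp: mem_swap_image)
    moreover have "a + s + i = i + s + a" by simp
    ultimately show ?thesis using block_antidiagonal[of "i + s + a"] by auto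
  qed
  show "PIdl\<^bsub>poly_ring ?L\<^esub> block_minor (\<gamma> r) (\<alpha> r) (n r) \<in> ?K" if "r \<in> D" for r
  proof -
    let ?d = "block_minor (\<alpha> r) (\<gamma> r) (n r) :: 'k polynomial"
    let ?d' = "block_minor (\<gamma> r) (\<alpha> r) (n r) :: 'k polynomial"
    have d: "?d \<in> carrier (poly_ring L)"
      unfolding block_minor_def using block_subset[OF that] by (intro carrier_det_Var) auto
    have td: "?d' = transpose_poly ?d" unfolding block_minor_def by (rule transpose_poly_det_Var[symmetric])
    then have d': "?d' \<in> carrier (poly_ring ?L)" using transpose_poly_carrier[OF d] by simp
    have "PIdl\<^bsub>poly_ring ?L\<^esub> ?d' = transpose_poly ` (PIdl\<^bsub>poly_ring L\<^esub> ?d)"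
    proof (intro Set.set_eqI iffI)
      fix x assume "x \<in> PIdl\<^bsub>poly_ring ?L\<^esub> ?d'"
      then obtain y where y: "x = y * ?d'" "y \<in> carrier (poly_ring ?L)" unfolding PIdl_poly_ring[OF d'] by blast
      have "transpose_poly y * ?d \<in> PIdl\<^bsub>poly_ring L\<^esub> ?d"
        unfolding PIdl_poly_ring[OF d] using transpose_poly_carrier[OF y(2)] by auto
      then have "transpose_poly (transpose_poly y * ?d) \<in> transpose_poly ` (PIdl\<^bsub>poly_ring L\<^esub> ?d)" by (rule imageI)
      then show "x \<in> transpose_poly ` (PIdl\<^bsub>poly_ring L\<^esub> ?d)" by (simp add: transpose_poly_hom y(1) td)
    next
      fix x assume "x \<in> transpose_poly ` (PIdl\<^bsub>poly_ring L\<^esub> ?d)"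
      then obtain y where y: "x = transpose_poly (y * ?d)" "y \<in> carrier (poly_ring L)"
        unfolding PIdl_poly_ring[OF d] by blast
      then show "x \<in> PIdl\<^bsub>poly_ring ?L\<^esub> ?d'"
        unfolding PIdl_poly_ring[OF d'] using transpose_poly_carrier[OF y(2)] by (auto simp: transpose_poly_hom td)
    qed
    then show ?thesis using block_ideal[OF that] by blast
  qed
qed

theorem row_window:
  assumes "minor_positions (Suc s) (row_part L a b) \<noteq> {}"
  shows "ladder_ideal L (Suc s) (row_part L a b) \<in> K"
proof -
  interpret T: ladder_blocks "prod.swap ` L" s "(`) transpose_poly ` K" D \<gamma> \<alpha> n by (rule transposed)
  have part: "column_part (prod.swap ` L) a b = prod.swap ` row_part L a b"
    by (auto simp: column_part_def row_part_def mem_swap_image)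
  have sub: "row_part L a b \<subseteq> L" by (auto simp: row_part_def)
  obtain I J where "(I, J) \<in> minor_positions (Suc s) (row_part L a b)" using assms by auto
  then have "(J, I) \<in> minor_positions (Suc s) (column_part (prod.swap ` L) a b)"
    unfolding part by (rule minor_positions_swap)
  then have "ladder_ideal (prod.swap ` L) (Suc s) (column_part (prod.swap ` L) a b) \<in> (`) transpose_poly ` K"
    by (intro T.column_window) auto
  then have "transpose_poly ` ladder_ideal L (Suc s) (row_part L a b) \<in> (`) transpose_poly ` K"
    unfolding part transpose_poly_ladder_ideal[OF sub] .
  then show ?thesis by (auto simp: inj_image_eq_iff[OF inj_transpose_poly])
qed

end

section \<open>The blocks of the polynomial attached to a ladder\<close>

text \<open>Gives names to the data inside \<open>ladder_poly\<close>:
  \<open>last_inner_row\<close>, \<open>last_corner\<close>, \<open>first_row\<close> and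
  \<open>last_row\<close> are the numbers w_r, p_r, a_r and b_r in the construction of f.\<close>

locale cornered_ladder =
  fixes k l t v :: nat and L :: "entry set" and d c :: "nat \<Rightarrow> nat"
  assumes t_pos: "t > 0" and ladder: "ladder k l L" and corners: "lower_outside_corners k L v d c"
begin

definition diagonals :: "nat set" where
  "diagonals = {r\<in>{2..k + l}. antidiagonal k l r \<inter> inner_ladder L v d c t \<noteq> {}}"

definition last_inner_row :: "nat \<Rightarrow> nat" where
  "last_inner_row r = Max (fst ` (antidiagonal k l r \<inter> inner_ladder L v d c t))"

definition last_corner :: "nat \<Rightarrow> nat" where
  "last_corner r = Max {j\<in>{1..v}. (last_inner_row r, r - last_inner_row r) \<in> inner_part L d c t j}"

definition block_rows :: "nat \<Rightarrow> nat set" where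
  "block_rows r = fst ` (subladder L d c (last_corner r) \<inter> antidiagonal k l r)"

definition first_row :: "nat \<Rightarrow> nat" where "first_row r = Min (block_rows r)"

definition last_row :: "nat \<Rightarrow> nat" where "last_row r = Max (block_rows r)"

definition first_col :: "nat \<Rightarrow> nat" where "first_col r = r - last_row r"

definition block_size :: "nat \<Rightarrow> nat" where "block_size r = Suc (last_row r) - first_row r"

lemma L_range: "(i, j) \<in> L \<Longrightarrow> 1 \<le> i \<and> i \<le> k \<and> 1 \<le> j \<and> j \<le> l"
  using ladder by (auto simp: ladder_def)

lemma finite_L: "finite L"
  by (rule finite_subset[of _ "{1..k} \<times> {1..l}"]) (use ladder in \<open>auto simp: ladder_def\<close>)

lemma convex_L: "ladder_convex L"
  using ladder unfolding ladder_def ladder_convex_def by blast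

lemma finite_antidiagonal: "finite (antidiagonal k l r)"
  by (rule finite_subset[of _ "{1..k} \<times> {1..l}"]) (auto simp: antidiagonal_def)

text \<open>Inside \<open>L\<close> one walks down or to the left as long as possible. Each step
  increases the row or decreases the column, and the walk can only stop at a lower-outside
  corner.\<close>

lemma ex_corner_below:
  assumes "(x, y) \<in> L"
  shows "\<exists>h\<in>{1..v}. x \<le> d h \<and> c h \<le> y"
  using assms
proof (induction "k - x + y" arbitrary: x y rule: less_induct)
  case less
  note xy = L_range[OF less.prems]
  consider "(x + 1, y) \<in> L" | "(x, y - 1) \<in> L" | "(x + 1, y) \<notin> L" "(x, y - 1) \<notin> L" by blast
  then show ?case
  proof cases
    case 1
    then have "k - (x + 1) + y < k - x + y" using L_range[OF 1] by arith
    from less.hyps[OF this 1] show ?thesis by (meson Suc_leD Suc_eq_plus1 add_leD1)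
  next
    case 2
    then have "k - x + (y - 1) < k - x + y" using xy by arith
    from less.hyps[OF this 2] show ?thesis by (meson diff_le_self order_trans)
  next
    case 3
    then have "(x, y) \<in> (\<lambda>h. (d h, c h)) ` {1..v}"
      using corners less.prems unfolding lower_outside_corners_def by blast
    then show ?thesis by auto
  qed
qed

lemma last_inner_row_mem:
  assumes "r \<in> diagonals"
  shows "(last_inner_row r, r - last_inner_row r) \<in> antidiagonal k l r \<inter> inner_ladder L v d c t"
proof -
  let ?A = "antidiagonal k l r \<inter> inner_ladder L v d c t"
  have "finite (fst ` ?A)" "fst ` ?A \<noteq> {}" using assms finite_antidiagonal by (auto simp: diagonals_def)
  then have "last_inner_row r \<in> fst ` ?A" unfolding last_inner_row_def by (rule Max_in)
  then obtain j where "(last_inner_row r, j) \<in> ?A" by auto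
  moreover from this have "j = r - last_inner_row r" by (auto simp: antidiagonal_def)
  ultimately show ?thesis by simp
qed

lemma last_inner_row_ge:
  assumes "(i, j) \<in> antidiagonal k l r \<inter> inner_ladder L v d c t"
  shows "i \<le> last_inner_row r"
  unfolding last_inner_row_def using assms finite_antidiagonal by (intro Max_ge) force+

lemma last_corner_mem:
  assumes "r \<in> diagonals"
  shows "(last_inner_row r, r - last_inner_row r) \<in> inner_part L d c t (last_corner r)"
proof -
  let ?P = "{j\<in>{1..v}. (last_inner_row r, r - last_inner_row r) \<in> inner_part L d c t j}"
  have "?P \<noteq> {}" using last_inner_row_mem[OF assms] by (auto simp: inner_ladder_def)
  then have "last_corner r \<in> ?P" unfolding last_corner_def by (intro Max_in) auto
  then show ?thesis by blast
qed

lemma block_rows_iff: "i \<in> block_rows r \<longleftrightarrow> i \<le> r \<and> (i, r - i) \<in> subladder L d c (last_corner r)"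
proof
  assume "i \<in> block_rows r"
  then obtain j where ij: "(i, j) \<in> subladder L d c (last_corner r)" "i + j = r"
    by (auto simp: block_rows_def antidiagonal_def)
  then show "i \<le> r \<and> (i, r - i) \<in> subladder L d c (last_corner r)" by auto
next
  assume "i \<le> r \<and> (i, r - i) \<in> subladder L d c (last_corner r)"
  then have "(i, r - i) \<in> subladder L d c (last_corner r) \<inter> antidiagonal k l r"
    using L_range[of i "r - i"] by (auto simp: antidiagonal_def subladder_def)
  then show "i \<in> block_rows r" unfolding block_rows_def by force
qed

lemma finite_block_rows: "finite (block_rows r)"
  unfolding block_rows_def using finite_antidiagonal by auto

lemma block_rows_nonempty: "r \<in> diagonals \<Longrightarrow> last_inner_row r \<in> block_rows r"
  using last_corner_mem[of r] last_inner_row_mem[of r] t_pos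
  by (auto simp: block_rows_iff subladder_def inner_part_def antidiagonal_def)

lemma first_last_row:
  assumes "r \<in> diagonals"
  shows "first_row r \<in> block_rows r" "last_row r \<in> block_rows r" "first_row r \<le> last_row r" "last_row r \<le> r"
proof -
  have ne: "block_rows r \<noteq> {}" using block_rows_nonempty[OF assms] by auto
  show 1: "first_row r \<in> block_rows r" and 2: "last_row r \<in> block_rows r"
    unfolding first_row_def last_row_def using ne finite_block_rows by auto
  show "first_row r \<le> last_row r" unfolding last_row_def using 1 finite_block_rows by (rule Max_ge[rotated])
  show "last_row r \<le> r" using 2 by (simp add: block_rows_iff)
qed

text \<open>The ends of the block's antidiagonal lie in \<open>L\<close> as its north-east and
  south-west corners; convexity fills the square.\<close>

lemma block_in_L:
  assumes "r \<in> diagonals" "p < block_size r" "q < block_size r"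
  shows "(first_row r + p, first_col r + q) \<in> L"
proof -
  note fl = first_last_row[OF assms(1)]
  have "(first_row r, r - first_row r) \<in> L" "(last_row r, r - last_row r) \<in> L"
    using fl(1,2) by (auto simp: block_rows_iff subladder_def)
  then show ?thesis
    by (rule ladder_convexD[OF convex_L]) (use fl assms(2,3) in \<open>auto simp: first_col_def block_size_def\<close>)
qed

lemma block_antidiagonal: "r \<in> diagonals \<Longrightarrow> first_row r + first_col r + block_size r = Suc r"
  using first_last_row[of r] by (simp add: first_col_def block_size_def)

text \<open>A corner south-west of the lower end of the segment puts its upper end into the inner
  ladder, so i \<le> w by maximality of w. The inequalities satisfied by the corner p at row w,
  namely w + t - 1 \<le> d_p and c_p \<le> r - w - t + 1, then put both ends of the segment into
  L_p, hence into the range of the block.\<close>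

lemma block_covers:
  assumes ia: "(i + (t - 1), a) \<in> L" "(i, a + (t - 1)) \<in> L"
  defines "r \<equiv> i + (t - 1) + a"
  shows "r \<in> diagonals \<and> first_col r \<le> a \<and> a + (t - 1) < first_col r + block_size r"
proof -
  define w where "w = last_inner_row r"
  define p where "p = last_corner r"
  obtain h where h: "h \<in> {1..v}" "i + (t - 1) \<le> d h" "c h \<le> a" using ex_corner_below[OF ia(1)] by blast
  have mem: "(i, a + (t - 1)) \<in> antidiagonal k l r \<inter> inner_ladder L v d c t"
    using ia(2) h t_pos L_range[OF ia(2)]
    by (auto simp: antidiagonal_def inner_ladder_def inner_part_def r_def intro!: bexI[of _ h])
  then have r: "r \<in> diagonals"
    using L_range[OF ia(2)] by (auto simp: diagonals_def r_def)
  have w: "i \<le> w" using last_inner_row_ge[OF mem] by (simp add: w_def)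
  have wr: "w \<le> r" using last_inner_row_mem[OF r] by (auto simp: antidiagonal_def w_def)
  have p: "w + t \<le> d p + 1" "c p + t \<le> r - w + 1"
    using last_corner_mem[OF r] by (auto simp: inner_part_def w_def p_def)
  have "i \<in> block_rows r" "i + (t - 1) \<in> block_rows r"
    using ia p w wr t_pos by (auto simp: block_rows_iff subladder_def r_def p_def add.commute add.left_commute)
  then have "first_row r \<le> i" "i + (t - 1) \<le> last_row r"
    unfolding first_row_def last_row_def using finite_block_rows by auto
  then show ?thesis
    using r first_last_row[OF r] by (auto simp: first_col_def block_size_def r_def)
qed

section \<open>Lowest monomial and admissibility of the ladder polynomial\<close>

abbreviation D :: "nat \<Rightarrow> 'k::field polynomial" where
  "D r \<equiv> block_minor (first_row r) (first_col r) (block_size r)"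

lemma generic_minor_block:
  assumes "r \<in> diagonals"
  shows "generic_minor {first_row r..last_row r} {r - last_row r..r - first_row r} = (D r :: 'k::field polynomial)"
proof -
  have shift: "{x..<x + n} = (\<lambda>p. x + p) ` {..<n}" for x n :: nat
    using image_add_atLeastLessThan[of x 0 n] by (simp add: atLeast0LessThan add.commute)
  note fl = first_last_row[OF assms]
  have "{first_row r..last_row r} = {first_row r..<first_row r + block_size r}"
    "{r - last_row r..r - first_row r} = {first_col r..<first_col r + block_size r}"
    using fl by (auto simp: block_size_def first_col_def)
  then show ?thesis
    unfolding shift block_minor_def by (simp only:) (rule generic_minor_strict_mono; auto simp: strict_mono_on_def)
qed

lemma ladder_poly_eq_prod: "ladder_poly k l L v d c t = (\<Prod>r\<in>diagonals. D r :: 'k::field polynomial)"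
  unfolding ladder_poly_def diagonals_def[symmetric] Let_def
  by (rule prod.cong[OF refl])
    (simp only: generic_minor_block[symmetric],
      simp only: first_row_def last_row_def block_rows_def last_corner_def last_inner_row_def)

lemma finite_diagonals: "finite diagonals"
  by (simp add: diagonals_def)

lemma D_carrier: "r \<in> diagonals \<Longrightarrow> D r \<in> carrier (poly_ring L :: 'k::field polynomial ring)"
  unfolding block_minor_def by (intro carrier_det_Var block_in_L)

definition low :: "nat \<Rightarrow> monomial" where
  "low r = permutation_monomial (\<lambda>p. first_row r + p) (\<lambda>q. first_col r + q) (block_size r) (\<lambda>i. block_size r - 1 - i)"

lemma D_low: "bounded_below (low r) (D r :: 'k::field polynomial)"
  "Poly_Mapping.lookup (D r :: 'k polynomial) (low r) \<noteq> 0"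
  using det_Var_low[of "block_size r" "\<lambda>p. first_row r + p" "\<lambda>q. first_col r + q", where ?'k = 'k]
  by (auto simp: block_minor_def low_def strict_mono_on_def)

lemma ladder_poly_low:
  "bounded_below (\<Sum>r\<in>diagonals. low r) (ladder_poly k l L v d c t :: 'k::field polynomial)"
  "Poly_Mapping.lookup (ladder_poly k l L v d c t :: 'k polynomial) (\<Sum>r\<in>diagonals. low r) \<noteq> 0"
  using bounded_below_prod[OF finite_diagonals, of low "\<lambda>r. D r :: 'k polynomial"] D_low[where ?'k = 'k] finite_diagonals
  by (auto simp: ladder_poly_eq_prod)

text \<open>The lowest monomial of a block minor contains each position of the block on i + j = r
  once. Different r use disjoint positions, which makes the product over all blocks
  squarefree.\<close>

lemma lookup_low:
  assumes "r \<in> diagonals"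
  shows "Poly_Mapping.lookup (low r) x \<le> (if fst x + snd x = r then 1 else 0)"
proof -
  have "Poly_Mapping.lookup (low r) x =
      (\<Sum>i<block_size r. if (first_row r + i, first_col r + (block_size r - 1 - i)) = x then 1 else 0)"
    unfolding low_def permutation_monomial_def lookup_sum by (intro sum.cong) (auto simp: lookup_single when_def)
  also have "\<dots> \<le> (\<Sum>i<block_size r. if i = fst x - first_row r then if fst x + snd x = r then 1 else 0 else 0)"
    by (intro sum_mono) (use block_antidiagonal[OF assms] in \<open>cases x; auto\<close>)
  also have "\<dots> \<le> (if fst x + snd x = r then 1 else 0)" by simp
  finally show ?thesis .
qed

lemma squarefree_low: "squarefree_monomial (\<Sum>r\<in>diagonals. low r)"
  unfolding squarefree_monomial_def
proof
  fix x
  have "Poly_Mapping.lookup (\<Sum>r\<in>diagonals. low r) x \<le> (\<Sum>r\<in>diagonals. if fst x + snd x = r then 1 else 0)"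
    unfolding lookup_sum by (intro sum_mono lookup_low)
  also have "\<dots> \<le> 1" using finite_diagonals by simp
  finally show "Poly_Mapping.lookup (\<Sum>r\<in>diagonals. low r) x \<le> 1" .
qed

lemma ladder_poly_degree:
  assumes "m \<in> Poly_Mapping.keys (ladder_poly k l L v d c t :: 'k::field polynomial)"
  shows "total_degree m = (\<Sum>r\<in>diagonals. block_size r)"
proof -
  have "total_degree m = (\<Sum>r\<in>A. block_size r)" if "finite A" "m \<in> Poly_Mapping.keys (\<Prod>r\<in>A. D r :: 'k polynomial)" for A m
    using that
  proof (induction A arbitrary: m rule: finite_induct)
    case (insert r A)
    then obtain a b where ab: "m = a + b" "a \<in> Poly_Mapping.keys (D r :: 'k polynomial)"
        "b \<in> Poly_Mapping.keys (\<Prod>r\<in>A. D r :: 'k polynomial)"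
      using keys_mult[of "D r :: 'k polynomial" "\<Prod>r\<in>A. D r"] by auto
    have "total_degree a = block_size r"
      using det_Var_keys[OF ab(2)[unfolded block_minor_def]] total_degree_permutation_monomial by auto
    then show ?case using insert ab by (simp add: total_degree_add)
  qed (simp add: total_degree_0)
  then show ?thesis using assms finite_diagonals by (simp add: ladder_poly_eq_prod)
qed

text \<open>Graded orders that reverse the lexicographic order turn lowest monomials into leading ones.\<close>

lemma ladder_poly_admissible: "knutson_admissible L (ladder_poly k l L v d c t :: 'k::field polynomial)"
proof -
  let ?f = "ladder_poly k l L v d c t :: 'k polynomial"
  define \<Delta> where "\<Delta> = (\<Sum>r\<in>diagonals. low r)"
  \<comment> \<open>Comparing degrees first makes 1 the least monomial, as a term order demands; the
    reversed lexicographic order alone would make it the greatest.\<close>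
  define R where "R = {(m, n). m \<in> monomials_on L \<and> n \<in> monomials_on L \<and>
    (total_degree m < total_degree n \<or> total_degree m = total_degree n \<and> n \<le> m)}"
  have f: "?f \<in> carrier (poly_ring L)"
    unfolding ladder_poly_eq_prod by (intro carrier_prod D_carrier)
  have "linear_order_on (monomials_on L) R"
    unfolding order_on_defs
    by (auto simp: R_def intro!: refl_onI transI antisymI total_onI)
  moreover have "(0, m) \<in> R" if "m \<in> monomials_on L" for m
  proof (cases "m = 0")
    case False
    then obtain x where x: "x \<in> Poly_Mapping.keys m" using keys_eq_empty[of m] by blast
    have "0 < Poly_Mapping.lookup m x" using x by (simp add: in_keys_iff)
    also have "\<dots> \<le> total_degree m" unfolding total_degree_def using x by (intro member_le_sum) auto
    finally show ?thesis using that by (simp add: R_def monomials_on_0 total_degree_0)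
  qed (simp add: R_def monomials_on_0)
  moreover have "(m + s, n + s) \<in> R" if "(m, n) \<in> R" "s \<in> monomials_on L" for m n s
    using that by (auto simp: R_def monomials_on_add_iff total_degree_add)
  ultimately have "term_order_on L R" by (simp add: term_order_on_def)
  moreover have "leading_monomial R ?f \<Delta>"
    unfolding leading_monomial_def
  proof (intro conjI ballI)
    show \<Delta>: "\<Delta> \<in> Poly_Mapping.keys ?f" using ladder_poly_low(2)[where ?'k = 'k] by (simp add: \<Delta>_def in_keys_iff)
    fix n assume n: "n \<in> Poly_Mapping.keys ?f"
    have "\<Delta> \<le> n" using n ladder_poly_low(1)[where ?'k = 'k] by (auto simp: \<Delta>_def bounded_below_def)
    moreover have "\<Delta> \<in> monomials_on L" "n \<in> monomials_on L" using f \<Delta> n by (auto simp: poly_ring_sel)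
    ultimately show "(n, \<Delta>) \<in> R" using ladder_poly_degree[OF \<Delta>] ladder_poly_degree[OF n] by (simp add: R_def)
  qed
  moreover have "homogeneous ?f" unfolding homogeneous_def using ladder_poly_degree by blast
  ultimately show ?thesis
    unfolding knutson_admissible_def using f squarefree_low by (auto simp: \<Delta>_def)
qed

lemma ladder_blocks_knutson:
  "ladder_blocks L (t - 1) (knutson_ideals L (ladder_poly k l L v d c t :: 'k::field polynomial))
    diagonals first_row first_col block_size"
proof (rule ladder_blocks.intro)
  let ?f = "ladder_poly k l L v d c t :: 'k polynomial"
  show "PIdl\<^bsub>poly_ring L\<^esub> (D r) \<in> knutson_ideals L ?f" if "r \<in> diagonals" for r
  proof (rule knutson_factor[OF ladder_poly_admissible])
    show "?f = D r * (\<Prod>r'\<in>diagonals - {r}. D r')"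
      unfolding ladder_poly_eq_prod using that finite_diagonals by (rule prod.remove[rotated])
    show "?f \<noteq> 0" using ladder_poly_low(2)[where ?'k = 'k] by auto
  qed (use that in \<open>auto intro!: carrier_prod D_carrier\<close>)
qed (use finite_L convex_L ideal_knutson knutson_colon_element knutson_ideals.sum block_in_L block_antidiagonal
    block_covers in auto)

end

text \<open>The ideal generated by no minors is zero, so a nonzero ideal supplies the minor from
  which the window theorems start.\<close>

lemma minor_positions_nonempty:
  assumes "(ladder_ideal L t T :: 'k::field polynomial set) \<noteq> {0}"
  shows "minor_positions t T \<noteq> {}"
proof
  assume none: "minor_positions t T = {}"
  have "ideal {0} (poly_ring L :: 'k polynomial ring)"
    by (rule ideal_poly_ringI) (auto intro: carrier_0)
  then have "(ladder_ideal L t T :: 'k polynomial set) \<subseteq> {0}"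
    by (rule ladder_ideal_minimal) (simp add: none)
  moreover interpret R: cring "poly_ring L :: 'k polynomial ring" by (rule cring_poly_ring)
  have "0 \<in> (ladder_ideal L t T :: 'k polynomial set)"
    unfolding ladder_ideal_def none
    using ideal_poly_ringD(2)[OF R.genideal_ideal[of "{}"]] by simp
  ultimately show False using assms by auto
qed

theorem theorem4p8:
  fixes k l t u v :: nat
    and L :: "entry set"
    and a b c d :: "nat \<Rightarrow> nat"
    and f :: "'k::field polynomial"
  assumes "CHAR('k) > 0 \<Longrightarrow> F_finite TYPE('k)"
    and "t > 0"
    and "ladder k l L"
    and "upper_outside_corners l L u b a"
    and "lower_outside_corners k L v d c"
    and "ladder_assumptions TYPE('k) k l L u b a v d c t"
    and "f = ladder_poly k l L v d c t"
  shows "(\<forall>p q. 1 \<le> p \<and> p < q \<and> q \<le> l \<and>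
            (ladder_ideal L t (column_part L p q) :: 'k polynomial set) \<noteq> {0} \<longrightarrow>
            ladder_ideal L t (column_part L p q) \<in> knutson_ideals L f) \<and>
         (\<forall>p q. 1 \<le> p \<and> p < q \<and> q \<le> k \<and>
            (ladder_ideal L t (row_part L p q) :: 'k polynomial set) \<noteq> {0} \<longrightarrow>
            ladder_ideal L t (row_part L p q) \<in> knutson_ideals L f) \<and>
         ((ladder_ideal L t L :: 'k polynomial set) \<noteq> {0} \<longrightarrow>
            ladder_ideal L t L \<in> knutson_ideals L f)"
proof -
  interpret cornered_ladder k l t v L d c
    using assms(2,3,5) by unfold_locales
  interpret B: ladder_blocks L "t - 1" "knutson_ideals L f" diagonals first_row first_col block_size
    unfolding assms(7) by (rule ladder_blocks_knutson)
  have t: "Suc (t - 1) = t" using assms(2) by simp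
  note windows = B.column_window[unfolded t] B.row_window[unfolded t]
  \<comment> \<open>The whole ladder is the window of all columns; using
    \<open>column_window\<close> directly also covers \<open>l = 1\<close>.\<close>
  have "column_part L 1 l = L" using L_range by (auto simp: column_part_def)
  then have whole: "(ladder_ideal L t L :: 'k polynomial set) \<in> knutson_ideals L f" if "minor_positions t L \<noteq> {}"
    using windows(1)[of 1 l] that by simp
  show ?thesis
    using windows whole minor_positions_nonempty[where ?'k = 'k] by blast
qed

end
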